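(* Let $X$ be an infinite polygonal $\mathbb{Z}^2$-subshift. Assume that $\mathcal{P}$ is a coding polygon for a recoding $Y$ of $X$ such that $\mathcal{P}$ has the minimal number of sides among all coding polygons for recodings of $X$. Then each of the oriented edges of $\mathcal{P}$ determines a ray which is closing for $X$, and these rays are (up to translation) the only nonexpansive rays for $X$.
   Context: Subshifts and coding. For a finite alphabet $\mathcal{A}$ (discrete topology), a $\mathbb{Z}^2$-subshift is a closed subset $X\subset\mathcal{A}^{\mathbb{Z}^2}$ (product topology) invariant under the shifts $(T^ux)(v)=x(u+v)$, $u\in\mathbb{Z}^2$. For $A,B\subset\mathbb{R}^2$, $A$ $X$-codes $B$ if whenever $x,x'\in X$ agree on $A\cap\mathbb{Z}^2$ they agree on $B\cap\mathbb{Z}^2$. Recoding. A $\mathbb{Z}^2$-subshift $Y$ (possibly over another finite alphabet) is a recoding of $X$ if there are a finite set $F\subset\mathbb{Z}^2$ and a homeomorphism $\Psi:X\to Y$ commuting with the shift actions such that for all $(i,j)\in\mathbb{Z}^2$ and $x,x'\in X$: $\Psi(x)(i,j)=\Psi(x')(i,j)$ if and only if $x$ and $x'$ agree on $F+(i,j)$. Polygons. An integer polygon is a polygon in $\mathbb{R}^2$ (including its interior) with all vertices in $\mathbb{Z}^2$. A convex integer polygon $\mathcal{P}$ is a coding polygon for an infinite $\mathbb{Z}^2$-subshift $X$ if for every vertex $v$ of $\mathcal{P}$, $\mathcal{P}\setminus\{v\}$ $X$-codes $\{v\}$. $X$ is polygonal if it is infinite and has a coding polygon. Degenerate polygons are allowed: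 a line segment with distinct endpoints in $\mathbb{Z}^2$ is regarded as a polygon with two vertices (its endpoints) and two edges (the segment with each of its two orientations). The edges of a polygon carry the boundary (counterclockwise) orientation; an oriented edge with direction vector $e$ determines the ray $\{te:t\ge0\}$. Rays. A ray is a translate of $\{tv: t\ge 0\}$, $v\neq0$ in $\mathbb{R}^2$, oriented in the direction of increasing $t$. A half space $H\subset\mathbb{R}^2$ (open or closed half plane) is expansive for $X$ if $H$ $X$-codes $\mathbb{R}^2$, and nonexpansive otherwise; this depends only on $H$ up to translation. A ray $\ell$ is expansive (nonexpansive) for $X$ if the half space $H$ bounded by the line containing $\ell$ and lying to the left of $\ell$ (so that $\ell$ has the orientation that $\partial H$ inherits from $H$) is expansive (nonexpansive). Closing. Let $L$ be a one-dimensional subspace of $\mathbb{R}^2$ of rational slope bounding a nonexpansive closed half space $H$, and let $L_0$ be the line in the complement of $H$ closest to $L$ among lines of the form $z+L$, $z\in\mathbb{Z}^2$. A block in $L_0\cap\mathbb{Z}^2$ is the intersection of $\mathbb{Z}^2$ with a connected segment of $L_0$. $H$ is closing if there is $N>0$ such that for every block $\mathcal{B}$ in $L_0\cap\mathbb{Z}^2$ of length at least $N$, $H\cup\mathcal{B}$ $X$-codes $H\cup L_0$. A ray in $L$ with the orientation $L=\partial H$ inherits from $H$ (i.e. $H$ lies to its left) is then called closing; a closing ray is by definition nonexpansive. *)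

theory Defs
  imports "HOL-Analysis.Analysis"
begin

section \<open>The plane and its integer points\<close>

type_synonym plane = "real \<times> real"

definition pt :: "int \<times> int \<Rightarrow> plane"
  where "pt u = (real_of_int (fst u), real_of_int (snd u))"

definition cross :: "plane \<Rightarrow> plane \<Rightarrow> real"
  where "cross v w = fst v * snd w - snd v * fst w"

text \<open>The closed half plane lying to the left of the line through \<open>p\<close> directed by \<open>v \<noteq> 0\<close>;
  \<open>v\<close> gives the orientation that the boundary line inherits from it.\<close>

definition left_half_plane :: "plane \<Rightarrow> plane \<Rightarrow> plane set"
  where "left_half_plane p v = {x. 0 \<le> cross v (x - p)}"

definition closed_half_plane :: "plane set \<Rightarrow> bool"
  where "closed_half_plane H \<longleftrightarrow> (\<exists>a b. a \<noteq> 0 \<and> H = {x. a \<bullet> x \<le> b})"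

definition ray :: "plane \<Rightarrow> plane \<Rightarrow> plane set"
  where "ray p v = {p + t *\<^sub>R v | t. 0 \<le> t}"


section \<open>Subshifts, coding and recodings\<close>

type_synonym 'a config = "int \<times> int \<Rightarrow> 'a"

definition shift :: "int \<times> int \<Rightarrow> 'a config \<Rightarrow> 'a config"
  where "shift u x = (\<lambda>v. x (u + v))"

definition full_shift :: "'a set \<Rightarrow> 'a config topology"
  where "full_shift A = product_topology (\<lambda>_. discrete_topology A) UNIV"

definition subshift :: "'a set \<Rightarrow> 'a config set \<Rightarrow> bool"
  where "subshift A X \<longleftrightarrow>
    finite A \<and> closedin (full_shift A) X \<and> (\<forall>u. \<forall>x\<in>X. shift u x \<in> X)"

definition agree_on :: "plane set \<Rightarrow> 'a config \<Rightarrow> 'a config \<Rightarrow> bool"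
  where "agree_on S x x' \<longleftrightarrow> (\<forall>u. pt u \<in> S \<longrightarrow> x u = x' u)"

definition codes :: "'a config set \<Rightarrow> plane set \<Rightarrow> plane set \<Rightarrow> bool"
  where "codes X S T \<longleftrightarrow> (\<forall>x\<in>X. \<forall>x'\<in>X. agree_on S x x' \<longrightarrow> agree_on T x x')"

definition recoding :: "'a set \<Rightarrow> 'a config set \<Rightarrow> 'b set \<Rightarrow> 'b config set \<Rightarrow> bool"
  where "recoding A X B Y \<longleftrightarrow>
    subshift B Y \<and>
    (\<exists>F \<Psi>. finite F \<and>
      homeomorphic_map (subtopology (full_shift A) X) (subtopology (full_shift B) Y) \<Psi> \<and>
      (\<forall>u. \<forall>x\<in>X. \<Psi> (shift u x) = shift u (\<Psi> x)) \<and>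
      (\<forall>u. \<forall>x\<in>X. \<forall>x'\<in>X. \<Psi> x u = \<Psi> x' u \<longleftrightarrow> (\<forall>f\<in>F. x (f + u) = x' (f + u))))"


section \<open>Convex integer polygons\<close>

text \<open>The vertices of a convex polygon are its extreme points. The condition on the affine
  dimension allows nondegenerate line segments and excludes the empty set and single points.\<close>

definition convex_integer_polygon :: "plane set \<Rightarrow> bool"
  where "convex_integer_polygon P \<longleftrightarrow>
    polytope P \<and> 1 \<le> aff_dim P \<and> (\<forall>v. v extreme_point_of P \<longrightarrow> v \<in> range pt)"

text \<open>Edges with the counterclockwise orientation, as pairs of initial and terminal vertex: an
  edge is traversed so that \<open>P\<close> lies to its left. If \<open>P\<close> is a line segment, this is true of
  both orientations, so that \<open>P\<close> has two oriented edges.\<close>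

definition oriented_edges :: "plane set \<Rightarrow> (plane \<times> plane) set"
  where "oriented_edges P =
    {(a, b). closed_segment a b edge_of P \<and> P \<subseteq> left_half_plane a (b - a)}"

definition num_sides :: "plane set \<Rightarrow> nat"
  where "num_sides P = card (oriented_edges P)"

definition coding_polygon :: "'a config set \<Rightarrow> plane set \<Rightarrow> bool"
  where "coding_polygon X P \<longleftrightarrow>
    convex_integer_polygon P \<and> (\<forall>v. v extreme_point_of P \<longrightarrow> codes X (P - {v}) {v})"

definition polygonal :: "'a config set \<Rightarrow> bool"
  where "polygonal X \<longleftrightarrow> infinite X \<and> (\<exists>P. coding_polygon X P)"

text \<open>Competing recodings may use any finite alphabet. As HOL cannot quantify over types here,
  they range over the subshifts with a finite alphabet of natural numbers, which is no restriction
  since renaming the symbols of a recoding does not affect its coding polygons.\<close>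

definition minimal_coding_polygon ::
    "'a set \<Rightarrow> 'a config set \<Rightarrow> 'b set \<Rightarrow> 'b config set \<Rightarrow> plane set \<Rightarrow> bool"
  where "minimal_coding_polygon A X B Y P \<longleftrightarrow>
    recoding A X B Y \<and> coding_polygon Y P \<and>
    (\<forall>(C :: nat set) Z Q. recoding A X C Z \<and> coding_polygon Z Q \<longrightarrow> num_sides P \<le> num_sides Q)"


section \<open>Nonexpansive and closing rays\<close>

definition expansive :: "'a config set \<Rightarrow> plane set \<Rightarrow> bool"
  where "expansive X H \<longleftrightarrow> codes X H UNIV"

text \<open>A ray, as a set, determines its endpoint \<open>p\<close> uniquely and its direction \<open>v\<close> up to a
  positive factor, so the half plane to its left is well defined. Using the closed one is no loss:
  each of the open and the closed half plane contains an integer translate of the other.\<close>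

definition nonexpansive_ray :: "'a config set \<Rightarrow> plane set \<Rightarrow> bool"
  where "nonexpansive_ray X l \<longleftrightarrow>
    (\<exists>p v. v \<noteq> 0 \<and> l = ray p v \<and> \<not> expansive X (left_half_plane p v))"

definition lattice_line :: "plane set \<Rightarrow> plane set \<Rightarrow> bool"
  where "lattice_line L M \<longleftrightarrow> (\<exists>z. M = (+) (pt z) ` L)"

definition next_line :: "plane set \<Rightarrow> plane set \<Rightarrow> plane set \<Rightarrow> bool"
  where "next_line H L M \<longleftrightarrow>
    lattice_line L M \<and> M \<subseteq> - H \<and>
    (\<forall>M'. lattice_line L M' \<and> M' \<subseteq> - H \<longrightarrow> setdist L M \<le> setdist L M')"

definition block_in :: "plane set \<Rightarrow> plane set \<Rightarrow> bool"
  where "block_in M B \<longleftrightarrow> (\<exists>a\<in>M. \<exists>b\<in>M. B = range pt \<inter> closed_segment a b)"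

text \<open>The length of a block is its number of points.\<close>

definition closing_half_plane :: "'a config set \<Rightarrow> plane set \<Rightarrow> bool"
  where "closing_half_plane X H \<longleftrightarrow>
    (\<exists>L M. subspace L \<and> dim L = 1 \<and> (\<exists>u. u \<noteq> 0 \<and> pt u \<in> L) \<and>
      closed_half_plane H \<and> frontier H = L \<and> \<not> expansive X H \<and>
      next_line H L M \<and>
      (\<exists>N>0. \<forall>B. block_in M B \<and> N \<le> card B \<longrightarrow> codes X (H \<union> B) (H \<union> M)))"

text \<open>As the boundary of a closing half plane passes through the origin, a closing ray lies on a
  line through the origin.\<close>

definition closing_ray :: "'a config set \<Rightarrow> plane set \<Rightarrow> bool"
  where "closing_ray X l \<longleftrightarrow>
    (\<exists>p v. v \<noteq> 0 \<and> l = ray p v \<and> closing_half_plane X (left_half_plane p v))"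

end

theory Submission
  imports Defs
begin

text \<open>Whether a half plane is expansive depends only on the direction of its boundary, and
passing to a recoding only moves the boundary by a bounded distance. So expansiveness may be studied for \<open>Y\<close> instead of
\<open>X\<close>, and the theorem splits into three claims.

A direction that is not the direction of an edge of \<open>P\<close> is expansive: then \<open>P\<close> has a single
lowest vertex with respect to it, and sliding \<open>P\<close> along the boundary of the half plane codes site
after site below it (\<open>expansive_direction_no_edge\<close>).

A nonexpansive edge is closing: if the edge is placed on the row below the half plane, then the
rest of \<open>P\<close> lies in the half plane, so that a known block as long as the edge spreads along the
row in both directions, by the coding property at either end of the edge
(\<open>edge_closes_row\<close>, and \<open>edge_ray_closing\<close> for the passage back to \<open>X\<close>).

Every edge is nonexpansive; this is where minimality enters (\<open>minimal_edge_nonexpansive\<close>). Suppose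
that the edge from \<open>a\<close> to \<open>b\<close> is expansive. By compactness finitely many sites strictly
above a line parallel to the edge, on the side of \<open>P\<close>, determine a site on this line. Hence in a large
dilate of \<open>P\<close> the sites away from this edge determine all sites: the middle of each further row follows from
expansiveness, and the two ends follow by sliding \<open>P\<close> along the row
(\<open>upper_part_determines_dilate\<close>). There are three cases.

\<^item> If \<open>P\<close> is a segment, then the coding property makes \<open>Y\<close> periodic along it, expansiveness makes
  \<open>Y\<close> periodic in a transversal direction as well, and \<open>Y\<close> is finite (\<open>finite_of_segment\<close>).

\<^item> If the two adjacent edges, extended beyond \<open>a\<close> and \<open>b\<close>, meet in a point \<open>q\<close>, let \<open>Q\<close> be a
  multiple of the convex hull of \<open>P\<close> and \<open>q\<close>; the given edge has disappeared from \<open>Q\<close>. If each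
  symbol is replaced by the pattern that is seen in a large dilate of \<open>P\<close>, then \<open>Q\<close> becomes a
  coding polygon: at the new vertex all but a bounded layer of the window is covered by windows
  based at other sites of \<open>Q\<close>, and the missing layer is determined by the previous paragraph
  (\<open>cut_corner\<close>).

\<^item> Otherwise \<open>P\<close> does not widen in the direction \<open>d\<close> of one of the adjacent edges, and a large
  dilate of \<open>P\<close> determines its own translate by \<open>- d\<close>. By the pigeonhole principle \<open>Y\<close> has a period
  (\<open>period_of_converging_neighbours\<close>), so that a segment is a coding polygon, whereas \<open>P\<close> has at
  least three sides.

The last two cases contradict the minimality of \<open>P\<close>, and the first one the infinity of \<open>X\<close>.\<close>

section \<open>Integer points and cross products\<close>

lemma pt_add: "pt (u + v) = pt u + pt v" by (simp add: pt_def)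
lemma pt_diff: "pt (u - v) = pt u - pt v" by (simp add: pt_def)
lemma pt_zero: "pt 0 = 0" by (simp add: pt_def zero_prod_def)
lemma pt_inject: "pt u = pt v \<longleftrightarrow> u = v" by (auto simp: pt_def prod_eq_iff)

definition zscale :: "int \<Rightarrow> int \<times> int \<Rightarrow> int \<times> int"
  where "zscale n u = (n * fst u, n * snd u)"

lemma pt_zscale: "pt (zscale n u) = of_int n *\<^sub>R pt u"
  by (simp add: pt_def zscale_def)

lemma zscale_simps: "zscale 0 u = 0" "zscale 1 u = u" "zscale (m + n) u = zscale m u + zscale n u"
  "zscale m (zscale n u) = zscale (m * n) u" "zscale (m - n) u = zscale m u - zscale n u"
  "zscale (- m) u = - zscale m u"
  by (auto simp: zscale_def prod_eq_iff algebra_simps)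

lemma cross_simps:
  "cross v (x + y) = cross v x + cross v y" "cross v (x - y) = cross v x - cross v y"
  "cross v (c *\<^sub>R x) = c * cross v x" "cross (x + y) v = cross x v + cross y v"
  "cross (x - y) v = cross x v - cross y v" "cross (c *\<^sub>R x) v = c * cross x v"
  "cross v (- x) = - cross v x" "cross (- x) v = - cross x v"
  "cross v 0 = 0" "cross 0 v = 0" "cross v v = 0"
  by (simp_all add: cross_def algebra_simps)

lemma cross_commute: "cross v w = - cross w v" by (simp add: cross_def)

lemma cross_sum: "cross v (\<Sum>i\<in>I. f i) = (\<Sum>i\<in>I. cross v (f i))"
  by (induction I rule: infinite_finite_induct) (auto simp: cross_simps)

lemma cross_pt_Ints: "cross (pt u) (pt v) \<in> \<int>"
  by (simp add: cross_def pt_def)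

lemma zscale_Suc: "zscale (int (Suc n)) u = u + zscale (int n) u"
  by (simp add: zscale_def prod_eq_iff algebra_simps)

section \<open>Determination between sets of sites\<close>

definition determines :: "'a config set \<Rightarrow> (int \<times> int) set \<Rightarrow> (int \<times> int) set \<Rightarrow> bool"
  where "determines X S T \<longleftrightarrow>
    (\<forall>x\<in>X. \<forall>x'\<in>X. (\<forall>u\<in>S. x u = x' u) \<longrightarrow> (\<forall>u\<in>T. x u = x' u))"

lemma codes_iff_determines: "codes X S T \<longleftrightarrow> determines X (pt -` S) (pt -` T)"
  unfolding codes_def agree_on_def determines_def vimage_def mem_Collect_eq by blast

lemma determinesD:
  assumes "determines X S T" "x \<in> X" "x' \<in> X" "\<And>u. u \<in> S \<Longrightarrow> x u = x' u" "u \<in> T"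
  shows "x u = x' u"
  using assms unfolding determines_def by blast

lemma determinesI:
  assumes "\<And>x x' u. x \<in> X \<Longrightarrow> x' \<in> X \<Longrightarrow> (\<And>s. s \<in> S \<Longrightarrow> x s = x' s) \<Longrightarrow> u \<in> T \<Longrightarrow> x u = x' u"
  shows "determines X S T"
  using assms unfolding determines_def by blast

lemma determines_mono:
  assumes "determines X S T" "S \<subseteq> S'" "T' \<subseteq> T" shows "determines X S' T'"
  using assms unfolding determines_def by blast

lemma determines_trans:
  assumes "determines X S T" "determines X T U" shows "determines X S U"
  using assms unfolding determines_def by blast

lemma determines_translate:
  assumes inv: "\<forall>u. \<forall>x\<in>X. shift u x \<in> X" and det: "determines X S T"
  shows "determines X ((+) t ` S) ((+) t ` T)"
  unfolding determines_def
proof (intro ballI impI)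
  fix x x' u assume x: "x \<in> X" "x' \<in> X" and eq: "\<forall>u\<in>(+) t ` S. x u = x' u" and "u \<in> (+) t ` T"
  then obtain w where w: "w \<in> T" "u = t + w" by auto
  have "shift t x \<in> X" "shift t x' \<in> X" using inv x by blast+
  moreover have "shift t x s = shift t x' s" if "s \<in> S" for s
    using eq that unfolding shift_def by blast
  ultimately have "shift t x w = shift t x' w" using determinesD[OF det _ _ _ w(1)] by blast
  then show "x u = x' u" by (simp add: shift_def w)
qed

lemma determinesD_translate:
  assumes inv: "\<forall>u. \<forall>x\<in>X. shift u x \<in> X" and det: "determines X S {z}"
    and "x \<in> X" "x' \<in> X" "\<And>s. s \<in> S \<Longrightarrow> x (t + s) = x' (t + s)"
  shows "x (t + z) = x' (t + z)"
  by (rule determinesD[OF determines_translate[OF inv det, of t] assms(3,4)]) (use assms(5) in blast)+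

lemma subshift_inv: "subshift A X \<Longrightarrow> \<forall>u. \<forall>x\<in>X. shift u x \<in> X"
  by (simp add: subshift_def)

section \<open>Compactness and periods\<close>

lemma subshift_value: "subshift A X \<Longrightarrow> x \<in> X \<Longrightarrow> x u \<in> A"
  unfolding subshift_def full_shift_def using closedin_subset[of _ X] by fastforce

lemma topspace_subshift: "subshift A X \<Longrightarrow> topspace (subtopology (full_shift A) X) = X"
  by (auto simp: subshift_def dest: closedin_subset)

lemma compact_space_subshift:
  assumes "subshift A X" shows "compact_space (subtopology (full_shift A) X)"
proof -
  have "compact_space (full_shift A)"
    unfolding full_shift_def using assms
    by (auto simp: compact_space_product_topology subshift_def compact_space_discrete_topology)
  then show ?thesis
    using assms by (auto simp: subshift_def intro: closedin_compact_space compact_space_subtopology)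
qed

lemma continuous_map_coordinate:
  "continuous_map (subtopology (full_shift A) X) (discrete_topology A) (\<lambda>x. x u)"
  unfolding full_shift_def
  by (intro continuous_map_from_subtopology continuous_map_product_projection) simp

text \<open>If no finite part of \<open>S\<close> determined the site \<open>z\<close>, then the closed sets of pairs that agree at a
site of \<open>S\<close> and differ at \<open>z\<close> would have the finite intersection property in \<open>X \<times> X\<close>.\<close>

lemma determines_finite_subset:
  assumes X: "subshift A X" and det: "determines X S {z}"
  obtains K where "finite K" "K \<subseteq> S" "determines X K {z}"
proof -
  let ?T = "subtopology (full_shift A) X"
  let ?TT = "prod_topology ?T ?T"
  have top: "topspace ?TT = X \<times> X" using topspace_subshift[OF X] by simp
  have cl: "closedin ?TT {p \<in> X \<times> X. (fst p u, snd p u) \<in> U}" if "U \<subseteq> A \<times> A" for U u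
  proof -
    have "continuous_map ?TT (discrete_topology A) (\<lambda>p. fst p u)"
      by (rule continuous_map_compose[OF continuous_map_fst continuous_map_coordinate, unfolded o_def])
    moreover have "continuous_map ?TT (discrete_topology A) (\<lambda>p. snd p u)"
      by (rule continuous_map_compose[OF continuous_map_snd continuous_map_coordinate, unfolded o_def])
    ultimately have "continuous_map ?TT (discrete_topology (A \<times> A)) (\<lambda>p. (fst p u, snd p u))"
      unfolding prod_topology_discrete_topology by (rule continuous_map_pairedI)
    from closedin_continuous_map_preimage[OF this, of U] that show ?thesis
      unfolding top by simp
  qed
  define agr where "agr u = {p \<in> X \<times> X. fst p u = snd p u}" for u
  define dif where "dif = {p \<in> X \<times> X. fst p z \<noteq> snd p z}"
  have val: "x u \<in> A" if "x \<in> X" for x u using subshift_value[OF X that] .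
  have cagr: "closedin ?TT (agr u)" for u
    by (rule back_subst[of "closedin _", OF cl[of "{q\<in>A \<times> A. fst q = snd q}" u]])
       (use val[of _ u] in \<open>auto simp: agr_def\<close>)
  have cdif: "closedin ?TT dif"
    by (rule back_subst[of "closedin _", OF cl[of "{q\<in>A \<times> A. fst q \<noteq> snd q}" z]])
       (use val[of _ z] in \<open>auto simp: dif_def\<close>)
  have cpt: "compact_space ?TT"
    using compact_space_subshift[OF X] by (simp add: compact_space_prod_topology)
  have "\<Inter>(insert dif (agr ` S)) = {}"
  proof (rule equals0I)
    fix p assume "p \<in> \<Inter>(insert dif (agr ` S))"
    then have "p \<in> dif" "\<forall>u\<in>S. p \<in> agr u" by blast+
    then have "fst p \<in> X" "snd p \<in> X" "fst p z \<noteq> snd p z" "\<And>u. u \<in> S \<Longrightarrow> fst p u = snd p u"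
      unfolding dif_def agr_def by auto
    then show False using determinesD[OF det, of "fst p" "snd p" z] by blast
  qed
  then obtain Fs where Fs: "finite Fs" "Fs \<subseteq> insert dif (agr ` S)" "\<Inter>Fs = {}"
  proof -
    have "\<forall>C\<in>insert dif (agr ` S). closedin ?TT C" using cagr cdif by auto
    then have "\<not> (\<forall>\<F>. finite \<F> \<and> \<F> \<subseteq> insert dif (agr ` S) \<longrightarrow> \<Inter>\<F> \<noteq> {})"
      using cpt \<open>\<Inter>(insert dif (agr ` S)) = {}\<close> unfolding compact_space_fip by blast
    with that show thesis by blast
  qed
  then obtain K where K: "finite K" "K \<subseteq> S" "Fs - {dif} = agr ` K"
    using finite_subset_image[of "Fs - {dif}" agr S] by (metis Diff_subset_conv finite_Diff insert_is_Un)
  have "determines X K {z}"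
  proof (rule determinesI, rule ccontr)
    fix x x' u assume x: "x \<in> X" "x' \<in> X" and eq: "\<And>u. u \<in> K \<Longrightarrow> x u = x' u"
      and u: "u \<in> {z}" "x u \<noteq> x' u"
    have "(x, x') \<in> dif" using x u by (simp add: dif_def)
    moreover have "(x, x') \<in> agr k" if "k \<in> K" for k
      unfolding agr_def using x eq[OF that] by simp
    ultimately have "(x, x') \<in> \<Inter>(insert dif (agr ` K))" by blast
    moreover have "Fs \<subseteq> insert dif (agr ` K)" unfolding K(3)[symmetric] by (simp add: subset_insert_iff)
    ultimately have "(x, x') \<in> \<Inter>Fs" by (meson Inter_anti_mono subsetD)
    then show False unfolding Fs(3) by simp
  qed
  with K that show thesis by blast
qed

lemma finite_restrictions:
  assumes X: "subshift A X" and "finite S" shows "finite ((\<lambda>x. restrict x S) ` X)"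
proof (rule finite_subset)
  show "(\<lambda>x. restrict x S) ` X \<subseteq> S \<rightarrow>\<^sub>E A" using subshift_value[OF X] by auto
  show "finite (S \<rightarrow>\<^sub>E A)" using assms by (intro finite_PiE) (auto simp: subshift_def)
qed

lemma restrict_eq_iff: "restrict x S = restrict x' S \<longleftrightarrow> (\<forall>u\<in>S. x u = x' u)"
  by (metis restrict_apply' restrict_ext)

lemma finite_subshift:
  assumes X: "subshift A X" and S: "finite S" and det: "determines X S UNIV"
  shows "finite X"
proof -
  have "inj_on (\<lambda>x. restrict x S) X"
  proof (rule inj_onI, rule ext)
    fix x x' u assume x: "x \<in> X" "x' \<in> X" "restrict x S = restrict x' S"
    then have eq: "\<forall>u\<in>S. x u = x' u" by (simp only: restrict_eq_iff)
    show "x u = x' u" by (rule determinesD[OF det x(1,2)]) (use eq in blast)+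
  qed
  then show ?thesis using finite_restrictions[OF X S] finite_imageD by blast
qed

definition has_period :: "'a config set \<Rightarrow> int \<times> int \<Rightarrow> bool"
  where "has_period X d \<longleftrightarrow> (\<forall>x\<in>X. \<forall>u. x (u + d) = x u)"

lemma has_period_multiple:
  assumes "has_period X d" "x \<in> X" shows "x (u + zscale n d) = x u"
proof -
  have pos: "x (u + zscale (int k) d) = x u" for u k
  proof (induction k)
    case (Suc k)
    have "x (u + zscale (int (Suc k)) d) = x ((u + zscale (int k) d) + d)"
      unfolding zscale_Suc by (simp only: ac_simps)
    then show ?case using Suc assms unfolding has_period_def by metis
  qed (simp add: zscale_simps)
  show ?thesis
  proof (cases "n \<ge> 0")
    case True then show ?thesis using pos[of u "nat n"] by simp
  next
    case False
    then have "x (u + zscale n d + zscale (int (nat (- n))) d) = x (u + zscale n d)" using pos by blast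
    then show ?thesis using False by (simp add: zscale_simps)
  qed
qed

lemma determines_iterate:
  assumes inv: "\<forall>u. \<forall>x\<in>X. shift u x \<in> X" and det: "determines X S ((+) d ` S)"
  shows "determines X S ((+) (zscale (int n) d) ` S)"
proof (induction n)
  case (Suc n)
  have "determines X ((+) (zscale (int n) d) ` S) ((+) (zscale (int n) d) ` (+) d ` S)"
    by (rule determines_translate[OF inv det])
  moreover have "(+) (zscale (int n) d) ` (+) d ` S = (+) (zscale (int (Suc n)) d) ` S"
    unfolding image_image zscale_Suc by (intro image_cong refl) (simp only: ac_simps)
  ultimately show ?case using Suc determines_trans by metis
qed (simp add: zscale_simps determines_def)

text \<open>Since \<open>S\<close> determines \<open>S + n d\<close> for all \<open>n\<close>, shifting by \<open>n d\<close> induces a map on the finite set of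
patterns on \<open>S\<close>. Two of these maps coincide, say for \<open>m < n\<close>, and then \<open>(n - m) d\<close> is a period at
the sites of \<open>S\<close>, for all configurations and hence at all sites.\<close>

lemma period_of_determines:
  assumes X: "subshift A X" and S: "finite S" "S \<noteq> {}" and det: "determines X S ((+) d ` S)"
  obtains p :: nat where "p > 0" "has_period X (zscale (int p) d)"
proof -
  note inv = subshift_inv[OF X]
  let ?P = "(\<lambda>x. restrict x S) ` X"
  \<comment> \<open>the graph of the map on patterns induced by the shift by \<open>n d\<close>\<close>
  define gr where "gr n = (\<lambda>x. (restrict x S, restrict (shift (zscale (int n) d) x) S)) ` X" for n
  have "range gr \<subseteq> Pow (?P \<times> ?P)" using inv unfolding gr_def by blast
  then have "finite (range gr)"
    using finite_restrictions[OF X S(1)] by (meson finite_Pow_iff finite_SigmaI finite_subset)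
  then have "\<not> inj gr" using finite_imageD infinite_UNIV_nat by blast
  then obtain m n where mn: "m < n" "gr m = gr n"
    by (metis (no_types, lifting) injI linorder_neqE_nat)
  have eq: "x (zscale (int m) d + s) = x (zscale (int n) d + s)" if x: "x \<in> X" and s: "s \<in> S" for x s
  proof -
    have "(restrict x S, restrict (shift (zscale (int m) d) x) S) \<in> gr n"
      using x unfolding mn(2)[symmetric] by (auto simp: gr_def)
    then obtain x2 where x2: "x2 \<in> X" "restrict x S = restrict x2 S"
      "restrict (shift (zscale (int m) d) x) S = restrict (shift (zscale (int n) d) x2) S"
      by (auto simp: gr_def)
    have "x (zscale (int n) d + s) = x2 (zscale (int n) d + s)"
      by (rule determinesD[OF determines_iterate[OF inv det, of n]])
         (use x x2 s in \<open>auto simp: restrict_eq_iff\<close>)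
    then show ?thesis using x2(3) s by (auto simp: restrict_eq_iff shift_def)
  qed
  obtain s where s: "s \<in> S" using S by auto
  have "x (u + zscale (int (n - m)) d) = x u" if x: "x \<in> X" for x u
  proof -
    define t where "t = u - s - zscale (int m) d"
    have "shift t x (zscale (int m) d + s) = shift t x (zscale (int n) d + s)"
      using inv x eq s by blast
    moreover have "t + (zscale (int m) d + s) = u" by (simp add: t_def)
    moreover have "t + (zscale (int n) d + s) = u + zscale (int (n - m)) d"
      using mn by (simp add: t_def zscale_def prod_eq_iff of_nat_diff algebra_simps)
    ultimately show ?thesis by (simp add: shift_def)
  qed
  with that[of "n - m"] mn show thesis by (simp add: has_period_def)
qed

section \<open>Block recodings\<close>

text \<open>The block map that records the pattern in the window \<open>G\<close> around each site is a recoding. It is a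
continuous injection of a compact space into a Hausdorff space, hence a homeomorphism onto its
image.\<close>

lemma block_recoding:
  assumes X: "subshift A X" and G: "finite G" "G \<noteq> {}"
  obtains C :: "nat set" and Z \<Theta> where "recoding A X C Z" "Z = \<Theta> ` X"
    "\<And>x x' u. x \<in> X \<Longrightarrow> x' \<in> X \<Longrightarrow> \<Theta> x u = \<Theta> x' u \<longleftrightarrow> (\<forall>g\<in>G. x (g + u) = x' (g + u))"
proof -
  note inv = subshift_inv[OF X] and val = subshift_value[OF X]
  have finA: "finite A" using X by (simp add: subshift_def)
  have "finite (G \<rightarrow>\<^sub>E A)" using finA G by (intro finite_PiE) auto
  then obtain enc :: "(int \<times> int \<Rightarrow> 'a) \<Rightarrow> nat" where enc: "inj_on enc (G \<rightarrow>\<^sub>E A)"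
    using finite_imp_inj_to_nat_seg[OF \<open>finite (G \<rightarrow>\<^sub>E A)\<close>] by auto
  define C where "C = enc ` (G \<rightarrow>\<^sub>E A)"
  define \<Theta> where "\<Theta> x u = enc (restrict (shift u x) G)" for x u
  define Z where "Z = \<Theta> ` X"
  have res: "restrict (shift u x) G \<in> G \<rightarrow>\<^sub>E A" if "x \<in> X" for x u
    using val[OF that] by (auto simp: shift_def)
  have iff: "\<Theta> x u = \<Theta> x' u \<longleftrightarrow> (\<forall>g\<in>G. x (g + u) = x' (g + u))" if "x \<in> X" "x' \<in> X" for x x' u
    unfolding \<Theta>_def inj_on_eq_iff[OF enc res[OF that(1)] res[OF that(2)]] restrict_eq_iff
    by (simp add: shift_def add.commute)
  have equiv: "\<Theta> (shift u x) = shift u (\<Theta> x)" for u x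
    by (simp add: \<Theta>_def shift_def fun_eq_iff add.assoc)
  let ?T = "subtopology (full_shift A) X" and ?S = "subtopology (full_shift C) Z"
  have top: "topspace ?T = X" by (rule topspace_subshift[OF X])
  have inC: "\<Theta> x u \<in> C" if "x \<in> X" for x u using res[OF that] by (auto simp: C_def \<Theta>_def)
  have cyl: "openin ?T {x' \<in> X. \<forall>g\<in>G. x' (g + u) = x (g + u)}" if "x \<in> X" for x u
  proof -
    have "openin ?T {x' \<in> topspace ?T. x' w \<in> {x w}}" for w
      by (rule openin_continuous_map_preimage[OF continuous_map_coordinate])
         (use val that in auto)
    then have "openin ?T (\<Inter>g\<in>G. {x' \<in> topspace ?T. x' (g + u) \<in> {x (g + u)}})"
      using G by (intro openin_INT2) auto
    then show ?thesis unfolding top using G(2) by (auto elim!: back_subst[of "openin _"])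
  qed
  have "continuous_map ?T (discrete_topology C) (\<lambda>x. \<Theta> x u)" for u
    unfolding continuous_map_def
  proof (intro conjI allI impI)
    fix U
    show "openin ?T {x \<in> topspace ?T. \<Theta> x u \<in> U}"
      unfolding top
    proof (subst openin_subopen, intro ballI)
      fix x assume x: "x \<in> {x \<in> X. \<Theta> x u \<in> U}"
      let ?N = "{x' \<in> X. \<forall>g\<in>G. x' (g + u) = x (g + u)}"
      have "?N \<subseteq> {x \<in> X. \<Theta> x u \<in> U}"
      proof
        fix x' assume x': "x' \<in> ?N"
        then have "\<Theta> x' u = \<Theta> x u" using iff[of x' x u] x by blast
        then show "x' \<in> {x \<in> X. \<Theta> x u \<in> U}" using x x' by simp
      qed
      then show "\<exists>T. openin ?T T \<and> x \<in> T \<and> T \<subseteq> {x \<in> X. \<Theta> x u \<in> U}"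
        using cyl[of x u] x by blast
    qed
  qed (use inC top in auto)
  then have cont0: "continuous_map ?T (full_shift C) \<Theta>"
    unfolding full_shift_def by (subst continuous_map_componentwise_UNIV) auto
  then have cont: "continuous_map ?T ?S \<Theta>"
    by (rule continuous_map_into_subtopology) (auto simp: Z_def top)
  have haus: "Hausdorff_space (full_shift C)"
    unfolding full_shift_def by (simp add: Hausdorff_space_product_topology)
  have "compactin ?T X" using compact_space_subshift[OF X] top by (simp add: compact_space_def)
  then have "compactin (full_shift C) Z" unfolding Z_def by (rule image_compactin[OF _ cont0])
  then have clZ: "closedin (full_shift C) Z" using haus compactin_imp_closedin by blast
  have topS: "topspace ?S = Z" using closedin_subset[OF clZ] by auto
  have "finite C" using \<open>finite (G \<rightarrow>\<^sub>E A)\<close> by (simp add: C_def)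
  moreover have "shift u z \<in> Z" if "z \<in> Z" for u z
  proof -
    obtain x where x: "x \<in> X" "z = \<Theta> x" using \<open>z \<in> Z\<close> unfolding Z_def by blast
    then have "shift u z = \<Theta> (shift u x)" by (simp only: equiv)
    then show ?thesis using inv x(1) unfolding Z_def by blast
  qed
  ultimately have subZ: "subshift C Z" using clZ by (simp add: subshift_def)
  have inj: "inj_on \<Theta> X"
  proof (rule inj_onI, rule ext)
    fix x x' u assume x: "x \<in> X" "x' \<in> X" "\<Theta> x = \<Theta> x'"
    obtain g where g: "g \<in> G" using G by auto
    have "\<Theta> x (u - g) = \<Theta> x' (u - g)" using x by simp
    then have "x (g + (u - g)) = x' (g + (u - g))" using iff x g by blast
    then show "x u = x' u" by simp
  qed
  have "homeomorphic_map ?T ?S \<Theta>"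
    by (rule continuous_imp_homeomorphic_map[OF cont compact_space_subshift[OF X]
        Hausdorff_space_subtopology[OF haus]]) (simp_all only: top topS inj Z_def[symmetric])
  then have "recoding A X C Z"
    unfolding recoding_def using subZ G(1) iff equiv by blast
  then show thesis using that[of C Z \<Theta>] Z_def iff by blast
qed

lemma recoding_data:
  assumes X: "subshift A X" and rec: "recoding A X B Y" and inf: "infinite X"
  obtains F \<Psi> where "finite F" "F \<noteq> {}" "bij_betw \<Psi> X Y" "subshift B Y"
    "\<And>u x x'. x \<in> X \<Longrightarrow> x' \<in> X \<Longrightarrow> \<Psi> x u = \<Psi> x' u \<longleftrightarrow> (\<forall>f\<in>F. x (f + u) = x' (f + u))"
proof -
  obtain F \<Psi> where Y: "subshift B Y" and F: "finite F" and
      hom: "homeomorphic_map (subtopology (full_shift A) X) (subtopology (full_shift B) Y) \<Psi>" and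
      iff: "\<forall>u. \<forall>x\<in>X. \<forall>x'\<in>X. \<Psi> x u = \<Psi> x' u \<longleftrightarrow> (\<forall>f\<in>F. x (f + u) = x' (f + u))"
    using rec unfolding recoding_def by (elim conjE exE)
  have bij: "bij_betw \<Psi> X Y"
    using homeomorphic_imp_surjective_map[OF hom] homeomorphic_imp_injective_map[OF hom]
    unfolding topspace_subshift[OF X] topspace_subshift[OF Y] by (simp add: bij_betw_def)
  have "F \<noteq> {}"
  proof
    assume "F = {}"
    then have "\<Psi> x = \<Psi> x'" if "x \<in> X" "x' \<in> X" for x x' using iff that by (auto intro!: ext)
    then have "x = x'" if "x \<in> X" "x' \<in> X" for x x'
      using bij that by (meson bij_betw_def inj_onD)
    then have "\<exists>x. X \<subseteq> {x}" by blast
    then show False using inf finite_subset by blast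
  qed
  show thesis by (rule that[OF F \<open>F \<noteq> {}\<close> bij Y]) (use iff in blast)
qed

text \<open>A site of \<open>Y\<close> stands for a translate of the window \<open>F\<close>, so coding among sites of \<open>Y\<close> is coding
among the sites of \<open>X\<close> that these windows cover.\<close>

lemma recoding_determines:
  assumes iff: "\<And>u x x'. x \<in> X \<Longrightarrow> x' \<in> X \<Longrightarrow> \<Psi> x u = \<Psi> x' u \<longleftrightarrow> (\<forall>f\<in>F. x (f + u) = x' (f + u))"
    and im: "\<Psi> ` X = Y"
  shows "determines Y S T \<longleftrightarrow> determines X (\<Union>f\<in>F. (+) f ` S) (\<Union>f\<in>F. (+) f ` T)"
proof -
  have eq: "(\<forall>u\<in>S. \<Psi> x u = \<Psi> x' u) \<longleftrightarrow> (\<forall>w\<in>(\<Union>f\<in>F. (+) f ` S). x w = x' w)"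
    if "x \<in> X" "x' \<in> X" for x x' S
    unfolding iff[OF that] by blast
  show ?thesis
    unfolding determines_def im[symmetric] ball_simps
    by (intro ball_cong refl) (simp only: eq)
qed

section \<open>Lines in the plane\<close>

lemma cross_as_inner: "cross v x = (- snd v, fst v) \<bullet> x"
  by (simp add: cross_def inner_prod_def)

lemma inner_self_pos: "v \<noteq> 0 \<Longrightarrow> v \<bullet> v > (0::real)" for v :: plane by simp

lemma plane_coordinates: "(v \<bullet> v) *\<^sub>R x = (v \<bullet> x) *\<^sub>R v + cross v x *\<^sub>R (- snd v, fst v)" for v x :: plane
  by (simp add: cross_def inner_prod_def prod_eq_iff algebra_simps)

lemma inner_cross_identity: "(v \<bullet> v) * cross x y = (v \<bullet> x) * cross v y - cross v x * (v \<bullet> y)"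
  for v x y :: plane
  by (simp add: cross_def inner_prod_def algebra_simps)

lemma cross_zero_multiple:
  assumes "cross v x = 0" "v \<noteq> 0" shows "x = ((v \<bullet> x) / (v \<bullet> v)) *\<^sub>R v"
proof -
  have "v \<bullet> v > 0" using assms by simp
  have "(v \<bullet> v) *\<^sub>R x = (v \<bullet> x) *\<^sub>R v"
    using assms(1) by (auto simp: cross_def inner_prod_def prod_eq_iff algebra_simps)
  then have "x = (1 / (v \<bullet> v)) *\<^sub>R ((v \<bullet> x) *\<^sub>R v)"
    using \<open>v \<bullet> v > 0\<close> by (metis divide_self_if less_irrefl scaleR_one scaleR_scaleR
        mult.commute times_divide_eq_right mult.right_neutral)
  then show ?thesis by simp
qed

lemma plane_eqI:
  assumes "v \<noteq> 0" "cross v x = cross v y" "v \<bullet> x = v \<bullet> y" shows "x = y"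
  using cross_zero_multiple[of v "x - y"] assms by (simp add: cross_simps inner_diff_right)

lemma closed_segment_on_line_iff:
  assumes "v \<noteq> 0" "cross v a = m" "cross v b = m"
  shows "x \<in> closed_segment a b \<longleftrightarrow> cross v x = m \<and> v \<bullet> x \<in> closed_segment (v \<bullet> a) (v \<bullet> b)"
proof
  assume "x \<in> closed_segment a b"
  then obtain s where s: "0 \<le> s" "s \<le> 1" "x = (1 - s) *\<^sub>R a + s *\<^sub>R b" by (auto simp: in_segment)
  have "cross v x = m" unfolding s(3) cross_simps assms by (simp add: algebra_simps)
  moreover have "v \<bullet> x = (1 - s) *\<^sub>R (v \<bullet> a) + s *\<^sub>R (v \<bullet> b)"
    unfolding s(3) by (simp add: inner_add_right)
  ultimately show "cross v x = m \<and> v \<bullet> x \<in> closed_segment (v \<bullet> a) (v \<bullet> b)"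
    using s(1,2) unfolding in_segment by blast
next
  assume x: "cross v x = m \<and> v \<bullet> x \<in> closed_segment (v \<bullet> a) (v \<bullet> b)"
  then obtain s where s: "0 \<le> s" "s \<le> 1" "v \<bullet> x = (1 - s) *\<^sub>R (v \<bullet> a) + s *\<^sub>R (v \<bullet> b)"
    unfolding in_segment by blast
  have "x = (1 - s) *\<^sub>R a + s *\<^sub>R b"
  proof (rule plane_eqI[OF assms(1)])
    show "cross v x = cross v ((1 - s) *\<^sub>R a + s *\<^sub>R b)"
      unfolding cross_simps assms using x by (simp add: algebra_simps)
    show "v \<bullet> x = v \<bullet> ((1 - s) *\<^sub>R a + s *\<^sub>R b)" unfolding s(3) by (simp add: inner_add_right)
  qed
  then show "x \<in> closed_segment a b" using s(1,2) unfolding in_segment by blast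
qed

section \<open>Vertices and oriented edges of integer polygons\<close>

definition vertices :: "plane set \<Rightarrow> plane set" where "vertices P = {v. v extreme_point_of P}"

lemma polygon_vertices:
  assumes "convex_integer_polygon P"
  shows "finite (vertices P)" "P = convex hull (vertices P)" "vertices P \<subseteq> range pt"
    "convex P" "compact P" "vertices P \<subseteq> P"
proof -
  have P: "polytope P" "\<And>v. v extreme_point_of P \<Longrightarrow> v \<in> range pt"
    using assms unfolding convex_integer_polygon_def by blast+
  show "finite (vertices P)"
    unfolding vertices_def by (intro finite_polyhedron_extreme_points polytope_imp_polyhedron P)
  show "convex P" "compact P" using P polytope_imp_convex polytope_imp_compact by blast+
  then show "P = convex hull (vertices P)"
    unfolding vertices_def by (rule Krein_Milman_Minkowski[rotated])
  show "vertices P \<subseteq> range pt" using P(2) by (auto simp: vertices_def)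
  show "vertices P \<subseteq> P" by (auto simp: vertices_def extreme_point_of_def)
qed

lemma cross_ge_on_hull:
  assumes "\<And>x. x \<in> S \<Longrightarrow> m \<le> cross v x" "x \<in> convex hull S" shows "m \<le> cross v x"
proof -
  have "convex {x. m \<le> cross v x}" unfolding cross_as_inner by (rule convex_halfspace_ge)
  then have "convex hull S \<subseteq> {x. m \<le> cross v x}" using assms(1) by (intro hull_minimal) auto
  then show ?thesis using assms(2) by blast
qed

lemma vertices_convex_hull: "vertices (convex hull S) \<subseteq> S"
  unfolding vertices_def by (intro subsetI extreme_point_of_convex_hull) (erule CollectD)

lemma finite_lattice_points:
  assumes "bounded S" shows "finite {u. pt u \<in> S}"
proof -
  obtain n where n: "\<And>x. x \<in> S \<Longrightarrow> norm x \<le> n" using assms by (auto simp: bounded_iff)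
  have "{u. pt u \<in> S} \<subseteq> {- \<lceil>n\<rceil>..\<lceil>n\<rceil>} \<times> {- \<lceil>n\<rceil>..\<lceil>n\<rceil>}"
  proof
    fix u assume "u \<in> {u. pt u \<in> S}"
    then have "norm (pt u) \<le> n" using n by auto
    then have "\<bar>real_of_int (fst u)\<bar> \<le> n" "\<bar>real_of_int (snd u)\<bar> \<le> n"
      using norm_fst_le[of "real_of_int (fst u)" "real_of_int (snd u)"]
        norm_snd_le[of "real_of_int (snd u)" "real_of_int (fst u)"] by (auto simp: pt_def)
    then show "u \<in> {- \<lceil>n\<rceil>..\<lceil>n\<rceil>} \<times> {- \<lceil>n\<rceil>..\<lceil>n\<rceil>}"
      by (cases u) (auto simp: abs_le_iff le_ceiling_iff ceiling_le_iff minus_le_iff; linarith)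
  qed
  then show ?thesis using finite_subset by blast
qed

lemma oriented_edgeD:
  assumes "(a, b) \<in> oriented_edges P"
  shows "a \<noteq> b" "a \<in> vertices P" "b \<in> vertices P"
    "\<And>x. x \<in> P \<Longrightarrow> 0 \<le> cross (b - a) (x - a)"
    "\<And>x. x \<in> P \<Longrightarrow> cross (b - a) (x - a) = 0 \<Longrightarrow> x \<in> closed_segment a b"
proof -
  have face: "closed_segment a b face_of P" and dim: "aff_dim (closed_segment a b) = 1"
    and left: "P \<subseteq> left_half_plane a (b - a)"
    using assms by (auto simp: oriented_edges_def edge_of_def)
  show ne: "a \<noteq> b" using dim by auto
  have "a extreme_point_of closed_segment a b" "b extreme_point_of closed_segment a b"
    by (auto simp: extreme_point_of_segment)
  then show ab: "a \<in> vertices P" "b \<in> vertices P"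
    using extreme_point_of_face[OF face] by (auto simp: vertices_def)
  then have abP: "a \<in> P" "b \<in> P" by (auto simp: vertices_def extreme_point_of_def)
  show "0 \<le> cross (b - a) (x - a)" if "x \<in> P" for x
    using left that by (auto simp: left_half_plane_def)
  show "x \<in> closed_segment a b" if x: "x \<in> P" and 0: "cross (b - a) (x - a) = 0" for x
  proof -
    obtain s where "x - a = s *\<^sub>R (b - a)" using cross_zero_multiple[OF 0] ne by auto
    then have s: "x = a + s *\<^sub>R (b - a)" by (simp add: algebra_simps)
    have seg: "u + t *\<^sub>R (v - u) \<in> open_segment u v" if "0 < t" "t < 1" "u \<noteq> v" for u v :: plane and t
      unfolding in_segment using that by (intro conjI exI[of _ t]) (auto simp: algebra_simps)
    consider "s < 0" | "0 \<le> s" "s \<le> 1" | "s > 1" by linarith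
    then show ?thesis
    proof cases
      case 1
      have "x \<noteq> b" using 1 ne s by (auto simp: algebra_simps)
      have "a = x + (- s / (1 - s)) *\<^sub>R (b - x)"
      proof -
        have "b - x = (1 - s) *\<^sub>R (b - a)" by (simp add: s algebra_simps)
        then have "(- s / (1 - s)) *\<^sub>R (b - x) = (- s) *\<^sub>R (b - a)" using 1 by simp
        then show ?thesis by (simp add: s)
      qed
      moreover have "0 < - s / (1 - s)" "- s / (1 - s) < 1" using 1 by (auto simp: field_simps)
      ultimately have "a \<in> open_segment x b" using seg \<open>x \<noteq> b\<close> by metis
      then show ?thesis using face x abP unfolding face_of_def by blast
    next
      case 2
      then show ?thesis unfolding in_segment by (intro exI[of _ s]) (auto simp: s algebra_simps)
    next
      case 3
      have "a \<noteq> x" using 3 ne s by auto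
      have "b = a + (1 / s) *\<^sub>R (x - a)" using 3 by (simp add: s)
      moreover have "0 < 1 / s" "1 / s < 1" using 3 by auto
      ultimately have "b \<in> open_segment a x" using seg \<open>a \<noteq> x\<close> by metis
      then show ?thesis using face x abP unfolding face_of_def by blast
    qed
  qed
qed

text \<open>The face on which \<open>cross v\<close> is minimal lies on a line of direction \<open>v\<close>; as it contains two points
it is a segment, oriented from its least to its greatest point in the direction \<open>v\<close>.\<close>

lemma oriented_edge_exists:
  assumes "convex P" "compact P" "v \<noteq> 0" and min: "\<And>x. x \<in> P \<Longrightarrow> m \<le> cross v x"
    and p: "p1 \<in> P" "p2 \<in> P" "p1 \<noteq> p2" "cross v p1 = m" "cross v p2 = m"
  obtains a b c where "(a, b) \<in> oriented_edges P" "c > 0" "b - a = c *\<^sub>R v" "cross v a = m"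
proof -
  define F where "F = P \<inter> {x. (- snd v, fst v) \<bullet> x = m}"
  have F: "x \<in> F \<longleftrightarrow> x \<in> P \<and> cross v x = m" for x by (auto simp: F_def cross_as_inner)
  have face: "F face_of P"
    unfolding F_def using assms(1) min by (intro face_of_Int_supporting_hyperplane_ge) (auto simp: cross_as_inner)
  have cF: "compact F" unfolding F_def using assms(2) closed_hyperplane by (rule compact_Int_closed)
  have "convex F" using face face_of_imp_convex by blast
  have "F \<noteq> {}" using p F[of p1] by blast
  have cont: "continuous_on F (\<lambda>x. v \<bullet> x)" by (intro continuous_intros)
  obtain a where a: "a \<in> F" "\<And>y. y \<in> F \<Longrightarrow> v \<bullet> a \<le> v \<bullet> y"
    using continuous_attains_inf[OF cF \<open>F \<noteq> {}\<close> cont] by auto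
  obtain b where b: "b \<in> F" "\<And>y. y \<in> F \<Longrightarrow> v \<bullet> y \<le> v \<bullet> b"
    using continuous_attains_sup[OF cF \<open>F \<noteq> {}\<close> cont] by auto
  have line: "x - a = ((v \<bullet> (x - a)) / (v \<bullet> v)) *\<^sub>R v" if "x \<in> F" for x
    by (rule cross_zero_multiple) (use that a F assms in \<open>auto simp: cross_simps\<close>)
  define c where "c = (v \<bullet> (b - a)) / (v \<bullet> v)"
  have ba: "b - a = c *\<^sub>R v" unfolding c_def by (rule line[OF b(1)])
  have "v \<bullet> a < v \<bullet> b"
  proof (rule ccontr)
    assume "\<not> v \<bullet> a < v \<bullet> b"
    then have "v \<bullet> p1 = v \<bullet> p2" using a(2)[of p1] a(2)[of p2] b(2)[of p1] b(2)[of p2] p F by auto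
    then show False using plane_eqI[OF assms(3), of p1 p2] p by auto
  qed
  then have c: "c > 0" unfolding c_def using assms(3) by (simp add: inner_diff_right)
  have ab: "a \<in> P" "b \<in> P" "cross v a = m" "cross v b = m" using a(1) b(1) F by blast+
  have "F = closed_segment a b"
  proof (intro equalityI subsetI)
    fix x assume x: "x \<in> F"
    then show "x \<in> closed_segment a b"
      using a(2)[OF x] b(2)[OF x] F[of x]
      unfolding closed_segment_on_line_iff[OF assms(3) ab(3,4)] closed_segment_eq_real_ivl by simp
  next
    fix x assume "x \<in> closed_segment a b"
    then show "x \<in> F" using closed_segment_subset[OF a(1) b(1) \<open>convex F\<close>] by (rule subsetD[rotated])
  qed
  moreover have "aff_dim (closed_segment a b) = 1"
    using \<open>v \<bullet> a < v \<bullet> b\<close> by (auto simp: segment_convex_hull aff_dim_convex_hull)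
  moreover have "P \<subseteq> left_half_plane a (b - a)"
    using min a(1) F c by (auto simp: left_half_plane_def ba cross_simps)
  ultimately have "(a, b) \<in> oriented_edges P"
    using face by (simp add: oriented_edges_def edge_of_def)
  then show thesis by (rule that[OF _ c ba]) (use a(1) F in simp)
qed

text \<open>Both edges are the face exposed by the same direction. Oriented edges may therefore be counted by
their directions.\<close>

lemma oriented_edges_parallel_unique:
  assumes e: "(a, b) \<in> oriented_edges P" and e': "(a', b') \<in> oriented_edges P"
    and c: "c > 0" "b' - a' = c *\<^sub>R (b - a)"
  shows "a' = a \<and> b' = b"
proof -
  note E = oriented_edgeD[OF e] and E' = oriented_edgeD[OF e']
  let ?v = "b - a"
  have P: "a \<in> P" "b \<in> P" "a' \<in> P" "b' \<in> P" using E E' by (auto simp: vertices_def extreme_point_of_def)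
  have "0 \<le> cross ?v (a' - a)" by (rule E(4)[OF P(3)])
  moreover have "0 \<le> cross ?v (a - a')" using E'(4)[OF P(1)] c by (simp add: cross_simps zero_le_mult_iff)
  ultimately have z: "cross ?v (a' - a) = 0" by (simp add: cross_simps)
  have "cross ?v (b' - a') = 0" using c by (simp add: cross_simps)
  then have z': "cross ?v (b' - a) = 0" using z by (simp add: cross_simps)
  have sa: "a' \<in> closed_segment a b" "b' \<in> closed_segment a b" using E(5) P z z' by auto
  have "a - a' = - (a' - a)" "b - a' = ?v - (a' - a)" by simp_all
  then have "cross ?v (a - a') = 0" "cross ?v (b - a') = 0"
    by (simp_all only: cross_simps(2,7,11) z[unfolded cross_simps(2)] minus_zero diff_zero)
  then have y: "cross (b' - a') (a - a') = 0" "cross (b' - a') (b - a') = 0"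
    unfolding c cross_simps(6) by simp_all
  have sb: "a \<in> closed_segment a' b'" "b \<in> closed_segment a' b'" using E'(5) P y by auto
  have "?v \<noteq> 0" using E(1) by auto
  have inn: "?v \<bullet> x \<in> closed_segment (?v \<bullet> p) (?v \<bullet> q)"
    if "cross ?v p = cross ?v q" "x \<in> closed_segment p q" for x p q
    using closed_segment_on_line_iff[OF \<open>?v \<noteq> 0\<close> refl that(1)[symmetric]] that(2) by blast
  have cab: "cross ?v a = cross ?v b" "cross ?v a' = cross ?v b'"
    using z z' by (auto simp: cross_simps cross_commute[of a b])
  have "?v \<bullet> ?v \<ge> 0" by simp
  then have ab: "?v \<bullet> a \<le> ?v \<bullet> b" by (simp add: inner_diff_right)
  have "?v \<bullet> (b' - a') \<ge> 0" unfolding c using c by simp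
  then have ab': "?v \<bullet> a' \<le> ?v \<bullet> b'" by (simp add: inner_diff_right)
  have "?v \<bullet> a' = ?v \<bullet> a" "?v \<bullet> b' = ?v \<bullet> b"
    using inn[OF cab(1) sa(1)] inn[OF cab(1) sa(2)] inn[OF cab(2) sb(1)] inn[OF cab(2) sb(2)]
    unfolding closed_segment_eq_real_ivl if_P[OF ab] if_P[OF ab'] atLeastAtMost_iff by linarith+
  moreover have "cross ?v a' = cross ?v a" "cross ?v b' = cross ?v b"
    using z z' cab unfolding cross_simps(2) by linarith+
  ultimately show ?thesis using plane_eqI[OF \<open>?v \<noteq> 0\<close>] by blast
qed

lemma finite_oriented_edges:
  assumes "finite (vertices P)" shows "finite (oriented_edges P)"
proof (rule finite_subset)
  show "oriented_edges P \<subseteq> vertices P \<times> vertices P" using oriented_edgeD(2,3) by auto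
qed (use assms in simp)

lemma coding_vertex:
  assumes "coding_polygon Y P" "pt k \<in> vertices P"
  shows "determines Y {u. pt u \<in> P \<and> u \<noteq> k} {k}"
proof -
  have "codes Y (P - {pt k}) {pt k}" using assms unfolding coding_polygon_def vertices_def by blast
  then show ?thesis unfolding codes_iff_determines
    by (rule determines_mono) (auto simp: pt_inject)
qed

section \<open>Expansive directions\<close>

lemma half_plane_integer_translate:
  assumes "v \<noteq> 0" obtains t where "cross v (pt t) \<ge> r"
proof -
  have "fst v \<noteq> 0 \<or> snd v \<noteq> 0" using assms by (auto simp: prod_eq_iff)
  then consider "fst v \<noteq> 0" | "snd v \<noteq> 0" by blast
  then show thesis
  proof cases
    case 1
    then have "cross v (pt (0, (if fst v > 0 then 1 else - 1) * \<lceil>\<bar>r\<bar> / \<bar>fst v\<bar>\<rceil>)) = \<bar>fst v\<bar> * of_int \<lceil>\<bar>r\<bar> / \<bar>fst v\<bar>\<rceil>"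
      by (auto simp: cross_def pt_def)
    also have "\<dots> \<ge> \<bar>fst v\<bar> * (\<bar>r\<bar> / \<bar>fst v\<bar>)" by (intro mult_left_mono) auto
    finally show ?thesis using that 1 by (auto simp: abs_le_iff)
  next
    case 2
    then have "cross v (pt ((if snd v > 0 then - 1 else 1) * \<lceil>\<bar>r\<bar> / \<bar>snd v\<bar>\<rceil>, 0)) = \<bar>snd v\<bar> * of_int \<lceil>\<bar>r\<bar> / \<bar>snd v\<bar>\<rceil>"
      by (auto simp: cross_def pt_def)
    also have "\<dots> \<ge> \<bar>snd v\<bar> * (\<bar>r\<bar> / \<bar>snd v\<bar>)" by (intro mult_left_mono) auto
    finally show ?thesis using that 2 by (auto simp: abs_le_iff)
  qed
qed

text \<open>All half planes with a given direction at once: one of them suffices by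
\<open>determines_half_plane_translate\<close>, and quantifying over them makes the notion visibly independent
of the position.\<close>

definition expansive_direction :: "'a config set \<Rightarrow> plane \<Rightarrow> bool"
  where "expansive_direction X v \<longleftrightarrow> (\<forall>r. determines X {u. r \<le> cross v (pt u)} UNIV)"

lemma determines_half_plane_translate:
  assumes inv: "\<forall>u. \<forall>x\<in>X. shift u x \<in> X" and "v \<noteq> 0"
    and det: "determines X {u. r \<le> cross v (pt u)} UNIV"
  shows "expansive_direction X v"
  unfolding expansive_direction_def
proof
  fix s
  obtain t where t: "cross v (pt t) \<ge> s - r" using half_plane_integer_translate[OF assms(2)] .
  have "determines X ((+) t ` {u. r \<le> cross v (pt u)}) ((+) t ` UNIV)"
    by (rule determines_translate[OF inv det])
  then show "determines X {u. s \<le> cross v (pt u)} UNIV"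
    by (rule determines_mono) (use t in \<open>auto simp: pt_add cross_simps\<close>)
qed

lemma expansive_left_half_plane:
  assumes "\<forall>u. \<forall>x\<in>X. shift u x \<in> X" "v \<noteq> 0"
  shows "expansive X (left_half_plane p v) \<longleftrightarrow> expansive_direction X v"
proof -
  have "pt -` left_half_plane p v = {u. cross v p \<le> cross v (pt u)}"
    by (auto simp: left_half_plane_def cross_simps)
  then have "expansive X (left_half_plane p v) \<longleftrightarrow> determines X {u. cross v p \<le> cross v (pt u)} UNIV"
    by (simp add: expansive_def codes_iff_determines)
  then show ?thesis
    using determines_half_plane_translate[OF assms] by (auto simp: expansive_direction_def)
qed

text \<open>The set of sites of \<open>X\<close> covered by the windows over a half plane contains one half plane and is
contained in another one with the same direction.\<close>

lemma expansive_direction_recoding: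
  assumes X: "subshift A X" and inf: "infinite X" and rec: "recoding A X B Y" and v: "v \<noteq> 0"
  shows "expansive_direction Y v \<longleftrightarrow> expansive_direction X v"
proof -
  obtain F \<Psi> where F: "finite F" "F \<noteq> {}" and bij: "bij_betw \<Psi> X Y" and Y: "subshift B Y"
    and iff: "\<And>u x x'. x \<in> X \<Longrightarrow> x' \<in> X \<Longrightarrow> \<Psi> x u = \<Psi> x' u \<longleftrightarrow> (\<forall>f\<in>F. x (f + u) = x' (f + u))"
    by (rule recoding_data[OF X rec inf]) (rule that; assumption)
  have im: "\<Psi> ` X = Y" using bij by (simp add: bij_betw_def)
  note det = recoding_determines[OF iff im]
  obtain f where f: "f \<in> F" using F by auto
  have U: "(\<Union>f\<in>F. (+) f ` UNIV) = UNIV"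
  proof (intro equalityI subsetI)
    fix w :: "int \<times> int"
    have "w = f + (w - f)" by simp
    then show "w \<in> (\<Union>f\<in>F. (+) f ` UNIV)" using f by blast
  qed simp
  have det': "determines Y S UNIV \<longleftrightarrow> determines X (\<Union>f\<in>F. (+) f ` S) UNIV" for S
    using det[of S UNIV] unfolding U .
  define m where "m = Min ((\<lambda>f. cross v (pt f)) ` F)"
  have m: "m \<le> cross v (pt f)" if "f \<in> F" for f unfolding m_def using F that by simp
  show ?thesis
  proof
    assume Yv: "expansive_direction Y v"
    have "determines X (\<Union>f\<in>F. (+) f ` {u. - m \<le> cross v (pt u)}) UNIV"
      using Yv unfolding expansive_direction_def det' by blast
    then have "determines X {u. 0 \<le> cross v (pt u)} UNIV"
      proof (rule determines_mono)
      have "0 \<le> cross v (pt (f + u))" if "f \<in> F" "- m \<le> cross v (pt u)" for f u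
        using m[OF that(1)] that(2) by (simp add: pt_add cross_simps)
      then show "(\<Union>f\<in>F. (+) f ` {u. - m \<le> cross v (pt u)}) \<subseteq> {u. 0 \<le> cross v (pt u)}" by blast
    qed simp
    then show "expansive_direction X v" by (rule determines_half_plane_translate[OF subshift_inv[OF X] v])
  next
    assume Xv: "expansive_direction X v"
    have "determines X (\<Union>f\<in>F. (+) f ` {u. 0 \<le> cross v (pt u)}) UNIV"
    proof (rule determines_mono)
      show "determines X {u. cross v (pt f) \<le> cross v (pt u)} UNIV"
        using Xv unfolding expansive_direction_def by blast
      show "{u. cross v (pt f) \<le> cross v (pt u)} \<subseteq> (\<Union>f\<in>F. (+) f ` {u. 0 \<le> cross v (pt u)})"
      proof
        fix u assume "u \<in> {u. cross v (pt f) \<le> cross v (pt u)}"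
        then have "u = f + (u - f)" "u - f \<in> {u. 0 \<le> cross v (pt u)}"
          by (auto simp: pt_diff cross_simps)
        then show "u \<in> (\<Union>f\<in>F. (+) f ` {u. 0 \<le> cross v (pt u)})" using f by blast
      qed
    qed simp
    then show "expansive_direction Y v"
      using determines_half_plane_translate[OF subshift_inv[OF Y] v, of 0] det' by blast
  qed
qed

text \<open>A direction without a parallel edge singles out one vertex of \<open>P\<close>. Every other integer point of
\<open>P\<close> is higher by at least some \<open>d > 0\<close>, so a half plane determines a strip of width \<open>d\<close> below it,
and by iteration everything. The argument by steps of width \<open>d\<close> needs no row structure and
covers irrational directions.\<close>

lemma expansive_direction_no_edge:
  assumes Y: "subshift B Y" and P: "coding_polygon Y P" and v: "v \<noteq> 0"
    and no: "\<And>a b c. (a, b) \<in> oriented_edges P \<Longrightarrow> c > 0 \<Longrightarrow> b - a \<noteq> c *\<^sub>R v"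
  shows "expansive_direction Y v"
proof (rule determines_half_plane_translate[OF subshift_inv[OF Y] v, of 0], rule determinesI)
  have cP: "convex_integer_polygon P" using P by (simp add: coding_polygon_def)
  note PV = polygon_vertices[OF cP]
  have "P \<noteq> {}" using cP by (auto simp: convex_integer_polygon_def)
  then have Vne: "vertices P \<noteq> {}" using PV(2) by force
  define m where "m = Min (cross v ` vertices P)"
  have "m \<in> cross v ` vertices P" unfolding m_def by (rule Min_in) (use PV(1) Vne in auto)
  then obtain p where p: "p \<in> vertices P" "cross v p = m" by (metis imageE)
  obtain k where k: "p = pt k" using p PV(3) by auto
  have minV: "m \<le> cross v x" if "x \<in> vertices P" for x using that PV(1) by (simp add: m_def)
  have min: "m \<le> cross v x" if "x \<in> P" for x
  proof (rule cross_ge_on_hull)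
    show "m \<le> cross v y" if "y \<in> vertices P" for y using that by (rule minV)
    show "x \<in> convex hull (vertices P)" using that unfolding PV(2)[symmetric] .
  qed
  have strict: "m < cross v x" if "x \<in> P" "x \<noteq> p" for x
  proof (rule ccontr)
    assume "\<not> m < cross v x"
    then have "cross v x = m" using min[OF that(1)] by auto
    moreover have "p \<in> P" using p(1) PV(6) by blast
    ultimately show False
      using oriented_edge_exists[OF PV(4,5) v min that(1) _ that(2) _ p(2)] no by metis
  qed
  define L where "L = {u. pt u \<in> P \<and> u \<noteq> k}"
  have "finite L" unfolding L_def
    by (rule finite_subset[OF _ finite_lattice_points[of P]]) (use PV(5) compact_imp_bounded in auto)
  \<comment> \<open>the 1 only keeps the minimum defined when \<open>L\<close> is empty\<close>
  define d where "d = Min (insert 1 ((\<lambda>u. cross v (pt u) - m) ` L))"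
  have "d > 0" unfolding d_def using \<open>finite L\<close> strict by (auto simp: L_def k pt_inject)
  have d: "cross v (pt z) \<ge> m + d" if "z \<in> L" for z
  proof -
    have "d \<le> cross v (pt z) - m" unfolding d_def using \<open>finite L\<close> that by (intro Min_le) auto
    then show ?thesis by simp
  qed
  have det: "determines Y L {k}" unfolding L_def using coding_vertex[OF P] p k by simp
  fix x x' u assume x: "x \<in> Y" "x' \<in> Y" and eq: "\<And>s. s \<in> {u. 0 \<le> cross v (pt u)} \<Longrightarrow> x s = x' s"
  have "- real n * d \<le> cross v (pt u) \<Longrightarrow> x u = x' u" for n u
  proof (induction n arbitrary: u)
    case 0
    then show ?case using eq[of u] by simp
  next
    case (Suc n)
    have "x ((u - k) + k) = x' ((u - k) + k)"
    proof (rule determinesD_translate[OF subshift_inv[OF Y] det x])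
      fix z assume z: "z \<in> L"
      have "cross v (pt (u - k + z)) = cross v (pt u) + (cross v (pt z) - m)"
        using p(2) k by (simp add: pt_add pt_diff cross_simps)
      then have "cross v (pt (u - k + z)) \<ge> cross v (pt u) + d" using d[OF z] by simp
      then show "x (u - k + z) = x' (u - k + z)"
        using Suc.prems by (intro Suc.IH) (simp add: algebra_simps)
    qed
    then show ?case by simp
  qed
  moreover obtain n where "real n * d \<ge> - cross v (pt u)"
    using reals_Archimedean3[OF \<open>d > 0\<close>] less_imp_le by blast
  ultimately show "x u = x' u" by (metis minus_le_iff minus_mult_left)
qed

section \<open>Nonexpansive edges are closing\<close>

definition idot :: "int \<times> int \<Rightarrow> int \<times> int \<Rightarrow> int"
  where "idot u w = fst u * fst w + snd u * snd w"

lemma of_int_idot: "of_int (idot u w) = pt u \<bullet> pt w"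
  by (simp add: idot_def pt_def)

lemma idot_simps: "idot k (u + w) = idot k u + idot k w" "idot k (u - w) = idot k u - idot k w"
  "idot k (- u) = - idot k u" "idot k (zscale n u) = n * idot k u" "idot k 0 = 0"
  by (simp_all add: idot_def zscale_def algebra_simps)

text \<open>An induction along the values of \<open>g\<close>, to be used in both directions of a row: agreement on a
block \<open>g1 \<le> g \<le> g1 + G\<close> spreads towards larger values of \<open>g\<close>, if the translates of \<open>L\<close> only use
sites where agreement is known or which come earlier.\<close>

lemma agreement_propagates:
  fixes g :: "int \<times> int \<Rightarrow> int"
  assumes inv: "\<forall>u. \<forall>x\<in>Y. shift u x \<in> Y" and det: "determines Y L {k}"
    and y: "y \<in> Y" "y' \<in> Y"
    and start: "\<And>u. u \<in> U \<Longrightarrow> g1 \<le> g u \<Longrightarrow> g u \<le> g1 + G \<Longrightarrow> y u = y' u"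
    and step: "\<And>u z. u \<in> U \<Longrightarrow> g1 + G < g u \<Longrightarrow> z \<in> L \<Longrightarrow>
      y (u - k + z) = y' (u - k + z) \<or> (u - k + z \<in> U \<and> g1 \<le> g (u - k + z) \<and> g (u - k + z) < g u)"
    and u: "u \<in> U" "g1 \<le> g u"
  shows "y u = y' u"
  using u
proof (induction "nat (g u - g1)" arbitrary: u rule: less_induct)
  case less
  show ?case
  proof (cases "g u \<le> g1 + G")
    case True
    then show ?thesis using start less.prems by blast
  next
    case False
    have "y ((u - k) + k) = y' ((u - k) + k)"
    proof (rule determinesD_translate[OF inv det y])
      fix z assume z: "z \<in> L"
      from step[OF less.prems(1) _ z] False
      consider "y (u - k + z) = y' (u - k + z)"
        | "u - k + z \<in> U" "g1 \<le> g (u - k + z)" "g (u - k + z) < g u" by fastforce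
      then show "y (u - k + z) = y' (u - k + z)"
      proof cases
        case 2
        show ?thesis by (rule less.hyps) (use 2 in auto)
      qed
    qed
    then show ?thesis by simp
  qed
qed

lemma edge_integer_vector:
  assumes P: "convex_integer_polygon P" and e: "(a, b) \<in> oriented_edges P"
  obtains ka kb where "a = pt ka" "b = pt kb" "b - a = pt (kb - ka)"
proof -
  have "vertices P \<subseteq> range pt" using polygon_vertices(3)[OF P] .
  then obtain ka kb where "a = pt ka" "b = pt kb" using oriented_edgeD(2,3)[OF e] by blast
  then show thesis using that[of ka kb] by (simp add: pt_diff)
qed

text \<open>With \<open>b\<close> placed at a site of the row, the other integer points of \<open>P\<close> lie above the row or among
the preceding sites of the row at distance at most the length of the edge; with \<open>a\<close> in place of
\<open>b\<close> the same holds in the opposite direction. So a block as long as the edge spreads both ways.\<close>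

lemma edge_closes_row:
  assumes Y: "subshift B Y" and P: "coding_polygon Y P" and edge: "(a, b) \<in> oriented_edges P"
    and ke: "b - a = pt ke"
    and y: "y \<in> Y" "y' \<in> Y"
    and above: "\<And>u. c < cross (b - a) (pt u) \<Longrightarrow> y u = y' u"
    and block: "\<And>u. cross (b - a) (pt u) = c \<Longrightarrow> g1 \<le> idot ke u \<Longrightarrow> idot ke u \<le> g1 + idot ke ke \<Longrightarrow> y u = y' u"
    and u: "c \<le> cross (b - a) (pt u)"
  shows "y u = y' u"
proof (cases "c < cross (b - a) (pt u)")
  case True
  then show ?thesis by (rule above)
next
  case False
  define e where "e = b - a"
  define U where "U = {u. cross e (pt u) = c}"
  have uU: "u \<in> U" using False u by (auto simp: U_def e_def)
  have cP: "convex_integer_polygon P" using P by (simp add: coding_polygon_def)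
  note E = oriented_edgeD[OF edge]
  obtain ka kb where k: "a = pt ka" "b = pt kb" using edge_integer_vector[OF cP edge] by metis
  have e: "e = pt ke" "e \<noteq> 0" using ke E(1) by (auto simp: e_def)
  have ee: "real_of_int (idot ke ke) = e \<bullet> e" "e \<bullet> e > 0" using e by (auto simp: of_int_idot)
  have "0 \<le> idot ke ke" by (simp add: idot_def)
  have cab: "cross e a = cross e b" by (simp add: e_def cross_simps cross_commute[of a b])
  have seg: "cross e (pt z) = cross e a \<and> idot ke ka \<le> idot ke z \<and> idot ke z \<le> idot ke kb"
    if "pt z \<in> P" "cross e (pt z) \<le> cross e a" for z
  proof -
    have eq: "cross e (pt z) = cross e a"
      using E(4)[OF that(1)] that(2) by (simp add: e_def[symmetric] cross_simps(2))
    then have "pt z \<in> closed_segment a b"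
      using E(5)[OF that(1)] by (simp add: e_def[symmetric] cross_simps(2))
    then have "e \<bullet> pt z \<in> closed_segment (e \<bullet> a) (e \<bullet> b)"
      using closed_segment_on_line_iff[OF e(2) refl cab[symmetric]] by blast
    moreover have "e \<bullet> a \<le> e \<bullet> b"
      using inner_ge_zero[of e] unfolding e_def[symmetric] by (simp add: e_def inner_diff_right)
    ultimately have "e \<bullet> a \<le> e \<bullet> pt z" "e \<bullet> pt z \<le> e \<bullet> b"
      by (auto simp: closed_segment_eq_real_ivl)
    then show ?thesis using eq by (simp add: e k flip: of_int_idot)
  qed
  have kba: "idot ke kb - idot ke ka = idot ke ke"
  proof -
    have "ke = kb - ka" using ke k by (metis pt_diff pt_inject)
    then show ?thesis by (metis idot_simps(2))
  qed
  have inj: "z = z'" if "cross e (pt z) = cross e (pt z')" "idot ke z = idot ke z'" for z z'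
    using plane_eqI[OF e(2) that(1)] that(2) by (simp add: pt_inject e(1) flip: of_int_idot)
  have lev: "cross e (pt (u - k + z)) = c + (cross e (pt z) - cross e (pt k))" if "u \<in> U" for u k z
    using that by (simp add: U_def pt_add pt_diff cross_simps)
  have pV: "pt ka \<in> vertices P" "pt kb \<in> vertices P" using E(2,3) k by auto
  note inv = subshift_inv[OF Y]
  show ?thesis
  proof (cases "g1 \<le> idot ke u")
    case True
    show ?thesis
    proof (rule agreement_propagates[OF inv coding_vertex[OF P pV(2)] y, of U g1 "idot ke" "idot ke ke"])
      show "y u = y' u" if "u \<in> U" "g1 \<le> idot ke u" "idot ke u \<le> g1 + idot ke ke" for u
        using block[of u] that by (auto simp: U_def e_def)
      fix u z assume u: "u \<in> U" "g1 + idot ke ke < idot ke u" and z: "z \<in> {u. pt u \<in> P \<and> u \<noteq> kb}"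
      show "y (u - kb + z) = y' (u - kb + z) \<or>
        (u - kb + z \<in> U \<and> g1 \<le> idot ke (u - kb + z) \<and> idot ke (u - kb + z) < idot ke u)"
      proof (cases "cross e (pt z) \<le> cross e a")
        case True
        have s: "cross e (pt z) = cross e a" "idot ke ka \<le> idot ke z" "idot ke z \<le> idot ke kb"
          using seg[of z] True z by auto
        have "idot ke z \<noteq> idot ke kb" using inj[of z kb] s cab z k by auto
        then show ?thesis using s kba u lev[OF u(1), of kb z] cab
          by (auto simp: U_def k idot_simps)
      next
        case False
        then show ?thesis using above[of "u - kb + z"] lev[OF u(1), of kb z] cab by (auto simp: k e_def)
      qed
    qed (use uU True in auto)
  next
    case False
    show ?thesis
    proof (rule agreement_propagates[OF inv coding_vertex[OF P pV(1)] y, of U "- g1 - idot ke ke" "\<lambda>u. - idot ke u" "idot ke ke"])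
      show "y u = y' u" if "u \<in> U" "- g1 - idot ke ke \<le> - idot ke u" "- idot ke u \<le> - g1 - idot ke ke + idot ke ke" for u
        using block[of u] that by (auto simp: U_def e_def)
      fix u z assume u: "u \<in> U" "- g1 - idot ke ke + idot ke ke < - idot ke u" and z: "z \<in> {u. pt u \<in> P \<and> u \<noteq> ka}"
      show "y (u - ka + z) = y' (u - ka + z) \<or>
        (u - ka + z \<in> U \<and> - g1 - idot ke ke \<le> - idot ke (u - ka + z) \<and> - idot ke (u - ka + z) < - idot ke u)"
      proof (cases "cross e (pt z) \<le> cross e a")
        case True
        have s: "cross e (pt z) = cross e a" "idot ke ka \<le> idot ke z" "idot ke z \<le> idot ke kb"
          using seg[of z] True z by auto
        have "idot ke z \<noteq> idot ke ka" using inj[of z ka] s cab z k by auto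
        then show ?thesis using s kba u lev[OF u(1), of ka z] cab
          by (auto simp: U_def k idot_simps)
      next
        case False
        then show ?thesis using above[of "u - ka + z"] lev[OF u(1), of ka z] cab by (auto simp: k e_def)
      qed
    qed (use uU False \<open>0 \<le> idot ke ke\<close> in auto)
  qed
qed

text \<open>To pass from \<open>Y\<close> to \<open>X\<close>, let \<open>m\<close> be the height of the lowest sites of the window \<open>F\<close>. Then the
configurations of \<open>Y\<close> agree from height \<open>- m\<close> on when those of \<open>X\<close> agree on the half plane, and on
the next row they agree on a block that is shorter by the width \<open>q - p\<close> of the window.\<close>

lemma edge_ray_closing:
  assumes X: "subshift A X" and inf: "infinite X" and rec: "recoding A X B Y"
    and P: "coding_polygon Y P" and edge: "(a, b) \<in> oriented_edges P"
    and nonexp: "\<not> expansive_direction X (b - a)"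
  shows "closing_ray X (ray 0 (b - a))"
proof -
  define e where "e = b - a"
  obtain F \<Psi> where F: "finite F" "F \<noteq> {}" and bij: "bij_betw \<Psi> X Y" and Y: "subshift B Y"
    and iff: "\<And>u x x'. x \<in> X \<Longrightarrow> x' \<in> X \<Longrightarrow> \<Psi> x u = \<Psi> x' u \<longleftrightarrow> (\<forall>f\<in>F. x (f + u) = x' (f + u))"
    by (rule recoding_data[OF X rec inf]) (rule that; assumption)
  have cP: "convex_integer_polygon P" using P by (simp add: coding_polygon_def)
  note E = oriented_edgeD[OF edge]
  obtain ke where ke: "b - a = pt ke" using edge_integer_vector[OF cP edge] by metis
  have e: "e = pt ke" "e \<noteq> 0" using ke E(1) by (auto simp: e_def)
  define n where "n = (- snd e, fst e)"
  have n: "n \<noteq> 0" "cross e x = n \<bullet> x" for x using e(2) by (auto simp: n_def cross_as_inner prod_eq_iff)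
  define H where "H = left_half_plane 0 e"
  have H: "H = {x. 0 \<le> cross e x}" by (simp add: H_def left_half_plane_def)
  define L where "L = {x. cross e x = 0}"
  have lvl: "\<exists>k::int. cross e (pt z) = of_int k" for z
    using cross_pt_Ints[of ke z] unfolding e(1) by (auto elim!: Ints_cases)
  define lv where "lv k \<longleftrightarrow> 0 < k \<and> (\<exists>z. cross e (pt z) = real k)" for k
  obtain z1 where z1: "cross e (pt z1) \<ge> 1" by (rule half_plane_integer_translate[OF e(2)])
  have ex: "\<exists>k. lv k \<and> cross e (pt z) = real k" if pos: "0 < cross e (pt z)" for z
  proof -
    obtain k :: int where k: "cross e (pt z) = of_int k" using lvl by blast
    then have "cross e (pt z) = real (nat k)" "0 < nat k" using pos by auto
    then show ?thesis unfolding lv_def by blast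
  qed
  then have "\<exists>k. lv k" using z1 by (metis less_le_trans zero_less_one)
  \<comment> \<open>heights of integer points are multiples of \<open>g\<close>, so the next row is at height \<open>- g\<close>\<close>
  define g where "g = (LEAST k. lv k)"
  have g: "lv g" unfolding g_def using \<open>\<exists>k. lv k\<close> by (rule LeastI_ex)
  have gmin: "real g \<le> cross e (pt z)" if "0 < cross e (pt z)" for z
    using ex[OF that] Least_le[of lv] by (auto simp: g_def)
  obtain z0' where z0': "cross e (pt z0') = real g" using g by (auto simp: lv_def)
  define z0 where "z0 = - z0'"
  have z0: "cross e (pt z0) = - real g" using pt_diff[of 0 z0'] z0' by (simp add: z0_def pt_zero cross_simps)
  have gpos: "real g > 0" using g by (simp add: lv_def)
  have above: "0 \<le> cross e (pt z)" if "- real g < cross e (pt z)" for z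
  proof (rule ccontr)
    assume "\<not> 0 \<le> cross e (pt z)"
    then have "0 < cross e (pt (- z))" using pt_diff[of 0 z] by (simp add: pt_zero cross_simps)
    from gmin[OF this] show False using that pt_diff[of 0 z] by (simp add: pt_zero cross_simps)
  qed
  have line: "(+) (pt z) ` L = {x. cross e x = cross e (pt z)}" for z
  proof (intro equalityI subsetI)
    fix x assume "x \<in> {x. cross e x = cross e (pt z)}"
    then have "x = pt z + (x - pt z)" "x - pt z \<in> L" by (auto simp: L_def cross_simps)
    then show "x \<in> (+) (pt z) ` L" by blast
  qed (auto simp: L_def cross_simps)
  define M where "M = {x. cross e x = - real g}"
  have next_line: "next_line H L M"
    unfolding next_line_def
  proof (intro conjI allI impI)
    show "lattice_line L M" unfolding lattice_line_def M_def by (rule exI[of _ z0]) (simp only: line z0)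
    show "M \<subseteq> - H" using gpos by (auto simp: M_def H)
    fix M' assume M': "lattice_line L M' \<and> M' \<subseteq> - H"
    then obtain z where z: "M' = {x. cross e x = cross e (pt z)}"
      unfolding lattice_line_def line by blast
    have "cross e (pt z) < 0" using M' by (auto simp: z H)
    then have zg: "cross e (pt z) \<le> - real g" using above[of z] by linarith
    show "setdist L M \<le> setdist L M'"
    proof (rule le_setdistI)
      have "0 \<in> L" by (simp add: L_def cross_simps)
      then show "L \<noteq> {}" by blast
      have "pt z \<in> M'" by (simp add: z)
      then show "M' \<noteq> {}" by blast
      fix x y assume x: "x \<in> L" and y: "y \<in> M'"
      \<comment> \<open>shrinking by \<open>r\<close> fixes \<open>L\<close> and moves \<open>M'\<close> to the closer line \<open>M\<close>\<close>
      define r where "r = - real g / cross e (pt z)"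
      have r: "0 \<le> r" "r \<le> 1" using zg gpos \<open>cross e (pt z) < 0\<close> by (auto simp: r_def field_simps)
      have "r *\<^sub>R x \<in> L" "r *\<^sub>R y \<in> M"
        using x y \<open>cross e (pt z) < 0\<close> by (auto simp: L_def M_def z cross_simps r_def)
      then have "setdist L M \<le> dist (r *\<^sub>R x) (r *\<^sub>R y)" by (rule setdist_le_dist)
      also have "\<dots> = r * dist x y" using r by (simp add: dist_norm flip: scaleR_diff_right)
      also have "\<dots> \<le> dist x y" using r mult_right_mono[of r 1 "dist x y"] by simp
      finally show "setdist L M \<le> dist x y" .
    qed
  qed
  define m where "m = Min ((\<lambda>f. cross e (pt f)) ` F)"
  have m: "m \<le> cross e (pt f)" if "f \<in> F" for f unfolding m_def using F that by simp
  have "m \<in> (\<lambda>f. cross e (pt f)) ` F" unfolding m_def using F by (intro Min_in) auto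
  then obtain f0 where f0: "f0 \<in> F" "cross e (pt f0) = m" by blast
  define p q where "p = Min (idot ke ` F)" and "q = Max (idot ke ` F)"
  have pq: "p \<le> idot ke f" "idot ke f \<le> q" if "f \<in> F" for f
    unfolding p_def q_def using F that by simp_all
  \<comment> \<open>the number of points of a block bounds its extent because \<open>idot ke\<close> is injective on a row;
    values from \<open>l\<close> to \<open>h\<close> allow \<open>h - l + 1\<close> points, hence the summand 1\<close>
  define N where "N = nat (idot ke ke + q - p) + 1"
  have closing: "codes X (H \<union> K) (H \<union> M)" if K: "block_in M K" "N \<le> card K" for K
  proof -
    obtain \<alpha> \<beta> where ab: "cross e \<alpha> = - real g" "cross e \<beta> = - real g"
        and K': "K = range pt \<inter> closed_segment \<alpha> \<beta>"
      using K(1) by (auto simp: block_in_def M_def)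
    define l h where "l = \<lceil>min (e \<bullet> \<alpha>) (e \<bullet> \<beta>)\<rceil>" and "h = \<lfloor>max (e \<bullet> \<alpha>) (e \<bullet> \<beta>)\<rfloor>"
    have Kiff: "pt u \<in> K \<longleftrightarrow> cross e (pt u) = - real g \<and> l \<le> idot ke u \<and> idot ke u \<le> h" for u
    proof -
      have "pt u \<in> K \<longleftrightarrow> cross e (pt u) = - real g \<and>
          min (e \<bullet> \<alpha>) (e \<bullet> \<beta>) \<le> of_int (idot ke u) \<and> of_int (idot ke u) \<le> max (e \<bullet> \<alpha>) (e \<bullet> \<beta>)"
        unfolding K' Int_iff closed_segment_on_line_iff[OF e(2) ab] closed_segment_eq_real_ivl
          of_int_idot e(1)[symmetric] by (auto simp: min_def max_def)
      then show ?thesis by (simp add: l_def h_def ceiling_le_iff le_floor_iff)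
    qed
    have "card K \<le> card {l..h}"
    proof -
      let ?K = "{u. pt u \<in> K}"
      have "K = pt ` ?K" unfolding K' by auto
      then have "card K = card ?K" by (metis card_image inj_onI pt_inject)
      have inj: "inj_on (idot ke) ?K"
      proof (rule inj_onI)
        fix u w assume "u \<in> ?K" "w \<in> ?K" "idot ke u = idot ke w"
        then show "u = w" using plane_eqI[OF e(2), of "pt u" "pt w"] Kiff
          by (simp add: pt_inject e(1) flip: of_int_idot)
      qed
      have "idot ke ` ?K \<subseteq> {l..h}" using Kiff by auto
      then have "card ?K \<le> card {l..h}" by (rule card_inj_on_le[OF inj]) simp
      then show ?thesis using \<open>card K = card ?K\<close> by simp
    qed
    then have hl: "idot ke ke + q - p \<le> h - l" using K(2) by (simp add: N_def)
    have "determines X (pt -` (H \<union> K)) (pt -` (H \<union> M))"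
    proof (rule determinesI)
      fix x x' u assume x: "x \<in> X" "x' \<in> X" and eq: "\<And>s. s \<in> pt -` (H \<union> K) \<Longrightarrow> x s = x' s"
        and u: "u \<in> pt -` (H \<union> M)"
      have y: "\<Psi> x \<in> Y" "\<Psi> x' \<in> Y" using bij x by (auto simp: bij_betw_def)
      have eqH: "x s = x' s" if "- real g < cross e (pt s)" for s
        by (rule eq) (use above[OF that] in \<open>simp add: H\<close>)
      have eqK: "x s = x' s" if "cross e (pt s) = - real g" "l \<le> idot ke s" "idot ke s \<le> h" for s
        by (rule eq) (use Kiff[of s] that in simp)
      have "\<Psi> x (u - f0) = \<Psi> x' (u - f0)"
      proof (rule edge_closes_row[OF Y P edge ke y, of "- m - real g" "l - p"], unfold e_def[symmetric])
        fix w assume w: "- m - real g < cross e (pt w)"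
        have "x (f + w) = x' (f + w)" if "f \<in> F" for f
          by (rule eqH) (use m[OF that] w in \<open>simp add: pt_add cross_simps\<close>)
        then show "\<Psi> x w = \<Psi> x' w" using iff[OF x] by blast
      next
        fix w assume w: "cross e (pt w) = - m - real g" "l - p \<le> idot ke w" "idot ke w \<le> l - p + idot ke ke"
        have "x (f + w) = x' (f + w)" if "f \<in> F" for f
        proof (cases "cross e (pt f) = m")
          case True
          show ?thesis by (rule eqK) (use True w pq[OF that] hl in \<open>simp_all add: pt_add cross_simps idot_simps\<close>)
        next
          case False
          show ?thesis by (rule eqH) (use m[OF that] False w in \<open>simp add: pt_add cross_simps\<close>)
        qed
        then show "\<Psi> x w = \<Psi> x' w" using iff[OF x] by blast
      next
        show "- m - real g \<le> cross e (pt (u - f0))"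
          using u f0(2) gpos by (auto simp: H M_def pt_diff cross_simps)
      qed
      then have "x (f0 + (u - f0)) = x' (f0 + (u - f0))" using iff[OF x] f0(1) by blast
      then show "x u = x' u" by simp
    qed
    then show ?thesis by (simp add: codes_iff_determines)
  qed
  have "closing_half_plane X H"
    unfolding closing_half_plane_def
  proof (rule exI[of _ L], rule exI[of _ M], intro conjI)
    have Ln: "L = {x. n \<bullet> x = 0}" by (simp add: L_def n)
    show "subspace L" unfolding Ln by (rule subspace_hyperplane)
    show "dim L = 1" unfolding Ln using dim_hyperplane[OF n(1)] by simp
    show "\<exists>u. u \<noteq> 0 \<and> pt u \<in> L" using e pt_zero by (intro exI[of _ ke]) (auto simp: L_def cross_simps)
    show "closed_half_plane H" unfolding closed_half_plane_def
      by (intro exI[of _ "- n"] exI[of _ 0]) (use n in \<open>auto simp: H\<close>)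
    show "frontier H = L" unfolding H Ln n(2) by (rule frontier_halfspace_ge) (use n in simp)
    show "\<not> expansive X H" unfolding H_def expansive_left_half_plane[OF subshift_inv[OF X] e(2)]
      using nonexp by (simp add: e_def)
    show "next_line H L M" by (rule next_line)
    show "\<exists>N>0. \<forall>K. block_in M K \<and> N \<le> card K \<longrightarrow> codes X (H \<union> K) (H \<union> M)"
      by (intro exI[of _ N]) (use closing in \<open>auto simp: N_def\<close>)
  qed
  then show ?thesis unfolding closing_ray_def H_def e_def[symmetric] using e(2) by blast
qed

section \<open>Dilates of a polygon\<close>

text \<open>A point of the \<open>M\<close>-th dilate of the convex hull of \<open>V\<close>, written as a nonnegative combination of
the vertices with total weight \<open>M\<close>. All later geometry consists in moving weight between vertices.\<close>

definition weights :: "plane set \<Rightarrow> real \<Rightarrow> (plane \<Rightarrow> real) \<Rightarrow> plane \<Rightarrow> bool"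
  where "weights V M \<mu> x \<longleftrightarrow> (\<forall>v\<in>V. 0 \<le> \<mu> v) \<and> sum \<mu> V = M \<and> (\<Sum>v\<in>V. \<mu> v *\<^sub>R v) = x"

definition dilate :: "plane set \<Rightarrow> real \<Rightarrow> plane set"
  where "dilate V M = {x. \<exists>\<mu>. weights V M \<mu> x}"

lemma convex_hull_eq_dilate: "finite V \<Longrightarrow> convex hull V = dilate V 1"
  by (simp add: convex_hull_finite dilate_def weights_def)

lemma weights_add: "weights V M \<mu> x \<Longrightarrow> weights V N \<nu> y \<Longrightarrow> weights V (M + N) (\<lambda>v. \<mu> v + \<nu> v) (x + y)"
  by (auto simp: weights_def sum.distrib scaleR_left_distrib)

lemma dilate_add: "x \<in> dilate V M \<Longrightarrow> y \<in> dilate V N \<Longrightarrow> x + y \<in> dilate V (M + N)"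
  using weights_add unfolding dilate_def by blast

lemma weights_update:
  assumes "finite V" "weights V M \<mu> x" "w \<in> V" "0 \<le> \<mu> w + c"
  shows "weights V (M + c) (\<mu>(w := \<mu> w + c)) (x + c *\<^sub>R w)"
proof -
  let ?\<mu> = "\<mu>(w := \<mu> w + c)"
  have "sum ?\<mu> V = (\<mu> w + c) + sum \<mu> (V - {w})"
    using assms(1,3) by (subst sum.remove[of V w]) (auto intro!: sum.cong)
  also have "\<dots> = sum \<mu> V + c" using assms(1,3) by (simp add: sum.remove[of V w])
  finally have 1: "sum ?\<mu> V = M + c" using assms(2) by (simp add: weights_def)
  have "(\<Sum>v\<in>V. ?\<mu> v *\<^sub>R v) = (\<mu> w + c) *\<^sub>R w + (\<Sum>v\<in>V - {w}. \<mu> v *\<^sub>R v)"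
    using assms(1,3) by (subst sum.remove[of V w]) (auto intro!: sum.cong)
  also have "\<dots> = (\<Sum>v\<in>V. \<mu> v *\<^sub>R v) + c *\<^sub>R w"
    using assms(1,3) by (simp add: sum.remove[of V w] scaleR_left_distrib)
  finally have 2: "(\<Sum>v\<in>V. ?\<mu> v *\<^sub>R v) = x + c *\<^sub>R w" using assms(2) by (simp add: weights_def)
  show ?thesis using assms 1 2 unfolding weights_def by simp
qed

lemma dilate_mult:
  assumes "x \<in> dilate V M" "0 \<le> c" shows "c *\<^sub>R x \<in> dilate V (c * M)"
proof -
  obtain \<mu> where "weights V M \<mu> x" using assms by (auto simp: dilate_def)
  then have "weights V (c * M) (\<lambda>v. c * \<mu> v) (c *\<^sub>R x)"
    using assms(2) by (auto simp: weights_def sum_distrib_left scaleR_sum_right)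
  then show ?thesis by (auto simp: dilate_def)
qed

lemma dilate_vertex:
  assumes "finite V" "v \<in> V" shows "v \<in> dilate V 1"
proof -
  have "weights V 0 (\<lambda>_. 0) 0" by (simp add: weights_def)
  from weights_update[OF assms(1) this assms(2), of 1] show ?thesis by (auto simp: dilate_def)
qed

lemma bounded_dilate:
  assumes "finite V" shows "bounded (dilate V M)"
  unfolding bounded_iff
proof (intro exI ballI)
  fix x assume "x \<in> dilate V M"
  then obtain \<mu> where \<mu>: "\<And>v. v \<in> V \<Longrightarrow> 0 \<le> \<mu> v" "sum \<mu> V = M" "x = (\<Sum>v\<in>V. \<mu> v *\<^sub>R v)"
    unfolding dilate_def weights_def by blast
  have "norm x \<le> (\<Sum>v\<in>V. norm (\<mu> v *\<^sub>R v))" unfolding \<mu>(3) by (rule norm_sum)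
  also have "\<dots> \<le> (\<Sum>v\<in>V. M * norm v)"
  proof (rule sum_mono)
    fix v assume v: "v \<in> V"
    have "\<mu> v \<le> M" unfolding \<mu>(2)[symmetric] using v \<mu>(1) assms by (intro member_le_sum) auto
    then show "norm (\<mu> v *\<^sub>R v) \<le> M * norm v" using \<mu>(1)[OF v] by (simp add: mult_right_mono)
  qed
  finally show "norm x \<le> (\<Sum>v\<in>V. M * norm v)" .
qed

lemma cross_weights:
  assumes "weights V M \<mu> x"
  shows "cross e x - M * cross e a = (\<Sum>v\<in>V. \<mu> v * cross e (v - a))"
proof -
  have "(\<Sum>v\<in>V. \<mu> v * cross e (v - a)) = (\<Sum>v\<in>V. \<mu> v * cross e v) - (\<Sum>v\<in>V. \<mu> v) * cross e a"
    by (simp add: cross_simps right_diff_distrib sum_subtractf sum_distrib_right)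
  then show ?thesis using assms by (auto simp: weights_def cross_sum cross_simps)
qed

section \<open>An expansive edge of a coding polygon\<close>

text \<open>The vertices of a coding polygon of \<open>Y\<close> with a distinguished edge from \<open>a\<close> to \<open>b\<close>, whose interior
side is the side of positive height.\<close>

locale polygon_edge =
  fixes V :: "plane set" and a b :: plane and B :: "'b set" and Y :: "'b config set"
  assumes finV: "finite V" and abV: "a \<in> V" "b \<in> V" "a \<noteq> b" and intV: "V \<subseteq> range pt"
    and left: "\<And>v. v \<in> V \<Longrightarrow> v \<noteq> a \<Longrightarrow> v \<noteq> b \<Longrightarrow> 0 < cross (b - a) (v - a)"
    and Y: "subshift B Y"
    and coding: "\<And>k. pt k \<in> V \<Longrightarrow> determines Y {u. pt u \<in> convex hull V \<and> u \<noteq> k} {k}"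
begin

definition height :: "plane \<Rightarrow> real" where "height x = cross (b - a) x"

lemma height_simps: "height (x + y) = height x + height y" "height (x - y) = height x - height y" "height (c *\<^sub>R x) = c * height x"
  "height b = height a" "height 0 = 0"
  by (simp_all add: height_def cross_simps cross_commute[of a b])

lemma height_integer: "\<exists>n::int. height (pt u) = of_int n"
proof -
  obtain ka kb where "a = pt ka" "b = pt kb" using abV intV by blast
  then have "b - a = pt (kb - ka)" by (simp add: pt_diff)
  then show ?thesis unfolding height_def using cross_pt_Ints by (metis Ints_cases)
qed

lemma height_vertex: "v \<in> V \<Longrightarrow> v \<noteq> a \<Longrightarrow> v \<noteq> b \<Longrightarrow> 1 \<le> height (v - a)"
proof -
  assume v: "v \<in> V" "v \<noteq> a" "v \<noteq> b"
  obtain ka kv where "a = pt ka" "v = pt kv" using v abV intV by blast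
  then have "v - a = pt (kv - ka)" by (simp add: pt_diff)
  then obtain n :: int where "height (v - a) = of_int n" using height_integer by metis
  moreover have "0 < height (v - a)" using left[OF v] by (simp add: height_def)
  ultimately show ?thesis by simp
qed

lemma height_vertex_nonneg: "v \<in> V \<Longrightarrow> 0 \<le> height (v - a)"
  using height_vertex[of v] by (cases "v = a \<or> v = b") (auto simp: height_simps(2,4))

text \<open>The height above the bottom edge bounds the weight on the other vertices, since these have height
at least 1. So a point near the bottom edge has almost all of its weight on \<open>a\<close> and \<open>b\<close>.\<close>

lemma height_weights:
  assumes "weights V M \<mu> x"
  shows "(\<Sum>v\<in>V - {a, b}. \<mu> v) \<le> height x - M * height a" "sum \<mu> V = \<mu> a + \<mu> b + (\<Sum>v\<in>V - {a, b}. \<mu> v)"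
    "height x - M * height a = (\<Sum>v\<in>V - {a, b}. \<mu> v * height (v - a))"
proof -
  have split: "sum f V = f a + f b + (\<Sum>v\<in>V - {a, b}. f v)" for f :: "plane \<Rightarrow> real"
  proof -
    have "sum f V = f a + sum f (V - {a})" using abV finV by (simp add: sum.remove)
    also have "sum f (V - {a}) = f b + sum f (V - {a} - {b})" using abV finV by (intro sum.remove) auto
    also have "V - {a} - {b} = V - {a, b}" by auto
    finally show ?thesis by simp
  qed
  show "sum \<mu> V = \<mu> a + \<mu> b + (\<Sum>v\<in>V - {a, b}. \<mu> v)" by (rule split)
  show 3: "height x - M * height a = (\<Sum>v\<in>V - {a, b}. \<mu> v * height (v - a))"
    using cross_weights[OF assms, of "b - a" a] unfolding height_def[symmetric] split by (simp add: height_simps)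
  have "(\<Sum>v\<in>V - {a, b}. \<mu> v * 1) \<le> (\<Sum>v\<in>V - {a, b}. \<mu> v * height (v - a))"
    by (intro sum_mono mult_left_mono) (use height_vertex assms in \<open>auto simp: weights_def\<close>)
  then show "(\<Sum>v\<in>V - {a, b}. \<mu> v) \<le> height x - M * height a" unfolding 3 by simp
qed

lemma height_dilate: "x \<in> dilate V M \<Longrightarrow> M * height a \<le> height x"
proof -
  assume "x \<in> dilate V M"
  then obtain \<mu> where \<mu>: "weights V M \<mu> x" by (auto simp: dilate_def)
  have "0 \<le> (\<Sum>v\<in>V - {a, b}. \<mu> v)" by (intro sum_nonneg) (use \<mu> in \<open>auto simp: weights_def\<close>)
  then show ?thesis using height_weights(1)[OF \<mu>] by simp
qed

lemma edge_points:
  assumes "x \<in> convex hull V" "height x \<le> height a"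
  obtains s where "0 \<le> s" "s \<le> 1" "x = a + s *\<^sub>R (b - a)"
proof -
  obtain \<mu> where \<mu>: "weights V 1 \<mu> x" using assms finV by (auto simp: convex_hull_eq_dilate dilate_def)
  have pos: "0 \<le> \<mu> v" if "v \<in> V" for v using \<mu> that by (simp add: weights_def)
  have "(\<Sum>v\<in>V - {a, b}. \<mu> v) \<le> 0" using height_weights(1)[OF \<mu>] assms(2) by simp
  moreover have "0 \<le> (\<Sum>v\<in>V - {a, b}. \<mu> v)" by (intro sum_nonneg) (use pos in auto)
  ultimately have 0: "(\<Sum>v\<in>V - {a, b}. \<mu> v) = 0" by simp
  then have z: "\<mu> v = 0" if "v \<in> V - {a, b}" for v
    using sum_nonneg_eq_0_iff[of "V - {a, b}" \<mu>] pos finV that by auto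
  have 1: "\<mu> a + \<mu> b = 1" using height_weights(2)[OF \<mu>] 0 \<mu> by (simp add: weights_def)
  have "x = (\<Sum>v\<in>V. \<mu> v *\<^sub>R v)" using \<mu> by (simp add: weights_def)
  also have "\<dots> = (\<Sum>v\<in>{a, b}. \<mu> v *\<^sub>R v)"
    by (rule sum.mono_neutral_right) (use z finV abV in auto)
  also have "\<dots> = \<mu> a *\<^sub>R a + \<mu> b *\<^sub>R b" using abV by simp
  also have "\<mu> a = 1 - \<mu> b" using 1 by simp
  finally have "x = a + \<mu> b *\<^sub>R (b - a)" by (simp add: algebra_simps)
  with that[of "\<mu> b"] pos[of a] pos[of b] abV 1 show thesis by simp
qed

text \<open>The end of a row near \<open>c\<close>, where the weight on \<open>d\<close> is less than \<open>R\<close>; the lemma is used for both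
orders of \<open>a\<close> and \<open>b\<close>. Take a disagreement there that is furthest towards \<open>d\<close>. Its weight on \<open>c\<close>
is large, so \<open>P\<close> fits into the dilate with \<open>c\<close> at this site; hence there is another disagreement
on the same row, displaced by at most the edge towards \<open>d\<close>. The latter still has weight at least
\<open>R\<close> on \<open>c\<close>, so by \<open>middle\<close> it has weight less than \<open>R\<close> on \<open>d\<close>, contradicting the choice.\<close>

lemma row_point_determined:
  assumes cd: "{c, d} = {a, b}" and y: "y \<in> Y" "y' \<in> Y"
    and size: "2 * R + D + 1 \<le> M" "h - M * height a \<le> D"
    and above: "\<And>u. pt u \<in> dilate V M \<Longrightarrow> h < height (pt u) \<Longrightarrow> y u = y' u"
    and middle: "\<And>u \<mu>. weights V M \<mu> (pt u) \<Longrightarrow> height (pt u) = h \<Longrightarrow> R \<le> \<mu> a \<Longrightarrow> R \<le> \<mu> b \<Longrightarrow> y u = y' u"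
    and u: "weights V M \<mu> (pt u)" "height (pt u) = h" "\<mu> d < R"
  shows "y u = y' u"
proof (rule ccontr)
  assume neq: "y u \<noteq> y' u"
  have cdV: "c \<in> V" "d \<in> V" "c \<noteq> d" using abV cd by (auto simp: doubleton_eq_iff)
  obtain kc where kc: "c = pt kc" using cdV intV by blast
  define S where "S = {u. pt u \<in> dilate V M \<and> height (pt u) = h \<and> y u \<noteq> y' u \<and> (\<exists>\<mu>. weights V M \<mu> (pt u) \<and> \<mu> d < R)}"
  define g where "g u = (d - c) \<bullet> pt u" for u
  have "finite S"
    by (rule finite_subset[OF _ finite_lattice_points[OF bounded_dilate[OF finV, of M]]]) (auto simp: S_def)
  moreover have "u \<in> S" using u neq by (auto simp: S_def dilate_def)
  ultimately have "Max (g ` S) \<in> g ` S" by (intro Max_in) auto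
  then obtain w where w: "w \<in> S" "g w = Max (g ` S)" by auto
  have max: "g s \<le> g w" if "s \<in> S" for s using w(2) that \<open>finite S\<close> by simp
  obtain \<nu> where \<nu>: "weights V M \<nu> (pt w)" "\<nu> d < R" using w(1) by (auto simp: S_def)
  have wS: "height (pt w) = h" "y w \<noteq> y' w" using w(1) by (auto simp: S_def)
  have "\<nu> a + \<nu> b = \<nu> c + \<nu> d" using cd by (auto simp: doubleton_eq_iff)
  then have \<nu>c: "R + 1 \<le> \<nu> c"
    using height_weights(1,2)[OF \<nu>(1)] \<nu> wS size by (simp add: weights_def)
  have R: "0 \<le> R" using \<nu> cdV by (auto simp: weights_def intro: order.trans less_imp_le)
  have nudge: "weights V M (\<nu>(c := \<nu> c - s, d := \<nu> d + s)) (pt w + s *\<^sub>R (d - c))"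
    if "0 \<le> s" "s \<le> 1" for s
  proof -
    have 1: "weights V (M + - s) (\<nu>(c := \<nu> c + - s)) (pt w + - s *\<^sub>R c)"
      by (rule weights_update[OF finV \<nu>(1) cdV(1)]) (use \<nu>c R that in linarith)
    have "0 \<le> \<nu> d" using \<nu>(1) cdV by (simp add: weights_def)
    have "weights V (M + - s + s) ((\<nu>(c := \<nu> c + - s))(d := (\<nu>(c := \<nu> c + - s)) d + s)) (pt w + - s *\<^sub>R c + s *\<^sub>R d)"
      by (rule weights_update[OF finV 1 cdV(2)]) (use cdV \<open>0 \<le> \<nu> d\<close> that in auto)
    then show ?thesis using cdV by (simp add: algebra_simps)
  qed
  have "y ((w - kc) + kc) = y' ((w - kc) + kc)"
  proof (rule determinesD_translate[OF subshift_inv[OF Y] coding y])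
    show "pt kc \<in> V" using kc cdV by simp
    fix z assume "z \<in> {u. pt u \<in> convex hull V \<and> u \<noteq> kc}"
    then have z: "pt z \<in> convex hull V" "z \<noteq> kc" by auto
    have hc: "height c = height a" using cd by (auto simp: doubleton_eq_iff height_simps)
    have eq: "pt (w - kc + z) = (pt w - c) + pt z" by (simp add: pt_add pt_diff kc)
    have "weights V (M + - 1) (\<nu>(c := \<nu> c + - 1)) (pt w + - 1 *\<^sub>R c)"
      by (rule weights_update[OF finV \<nu>(1) cdV(1)]) (use \<nu>c R in linarith)
    then have "pt w - c \<in> dilate V (M - 1)" by (auto simp: dilate_def)
    from dilate_add[OF this, of "pt z" 1] have in_dil: "pt (w - kc + z) \<in> dilate V M"
      using z finV by (simp add: eq convex_hull_eq_dilate)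
    have hz: "height (pt (w - kc + z)) = h + (height (pt z) - height a)"
      unfolding eq using wS hc by (simp add: height_simps)
    show "y (w - kc + z) = y' (w - kc + z)"
    proof (cases "height (pt z) \<le> height a")
      case False
      then show ?thesis using above[OF in_dil] hz by simp
    next
      case True
      obtain s where s: "0 \<le> s" "s \<le> 1" "pt z = c + s *\<^sub>R (d - c)"
      proof -
        obtain s where s: "0 \<le> s" "s \<le> 1" "pt z = a + s *\<^sub>R (b - a)" using edge_points[OF z(1) True] .
        from cd consider "c = a" "d = b" | "c = b" "d = a" by (auto simp: doubleton_eq_iff)
        then show thesis
        proof cases
          case 1 then show ?thesis using that s by blast
        next
          case 2 then show ?thesis using s by (intro that[of "1 - s"]) (auto simp: algebra_simps)
        qed
      qed
      have "s \<noteq> 0"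
      proof
        assume "s = 0"
        then have "pt z = pt kc" using s(3) kc by simp
        then show False using z(2) by (simp only: pt_inject)
      qed
      have eqw: "pt (w - kc + z) = pt w + s *\<^sub>R (d - c)" unfolding eq s by simp
      note wt = nudge[OF s(1,2), folded eqw]
      have hh: "height (pt (w - kc + z)) = h" using hz height_dilate[of "pt z" 1] z True finV
        by (simp add: convex_hull_eq_dilate)
      show ?thesis
      proof (rule ccontr)
        assume bad: "y (w - kc + z) \<noteq> y' (w - kc + z)"
        have "\<not> (R \<le> \<nu> c - s \<and> R \<le> \<nu> d + s)"
        proof
          assume *: "R \<le> \<nu> c - s \<and> R \<le> \<nu> d + s"
          from cd consider "c = a" "d = b" | "c = b" "d = a" by (auto simp: doubleton_eq_iff)
          then have "R \<le> (\<nu>(c := \<nu> c - s, d := \<nu> d + s)) a" "R \<le> (\<nu>(c := \<nu> c - s, d := \<nu> d + s)) b"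
            using * cdV(3) by (cases; simp)+
          with middle[OF wt hh] bad show False by blast
        qed
        then have "\<nu> d + s < R" using \<nu>c s by linarith
        then have "w - kc + z \<in> S" unfolding S_def using in_dil hh bad wt
          by (auto intro!: exI[of _ "\<nu>(c := \<nu> c - s, d := \<nu> d + s)"])
        from max[OF this] have "s * ((d - c) \<bullet> (d - c)) \<le> 0"
          unfolding g_def eqw by (simp add: inner_add_right)
        moreover have "(d - c) \<bullet> (d - c) > 0" using cdV by simp
        ultimately show False using s \<open>s \<noteq> 0\<close> by (simp add: mult_le_0_iff)
      qed
    qed
  qed
  then show False using wS by simp
qed

lemma combination_in_dilate:
  assumes \<mu>: "weights V M \<mu> x" and w: "w \<in> V" "w \<noteq> a" "w \<noteq> b"
    and c: "0 \<le> \<mu> w + cw" "0 \<le> \<mu> a + ca" "0 \<le> \<mu> b + cb" "cw + ca + cb = 0"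
  shows "x + (cw *\<^sub>R w + ca *\<^sub>R a + cb *\<^sub>R b) \<in> dilate V M"
proof -
  note 1 = weights_update[OF finV \<mu> w(1) c(1)]
  have "0 \<le> (\<mu>(w := \<mu> w + cw)) a + ca" using w c by simp
  note 2 = weights_update[OF finV 1 abV(1) this]
  have "0 \<le> ((\<mu>(w := \<mu> w + cw))(a := (\<mu>(w := \<mu> w + cw)) a + ca)) b + cb" using w c abV by simp
  note 3 = weights_update[OF finV 2 abV(2) this]
  have "M + cw + ca + cb = M" using c by simp
  with 3 show ?thesis unfolding dilate_def by (auto simp: add.assoc)
qed

text \<open>Consider a disagreement of maximal height. If its weights on both \<open>a\<close> and \<open>b\<close> are at least \<open>R\<close>, then
the translate of the finite code \<open>K\<close> stays inside the dilate and above the row; otherwise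
\<open>row_point_determined\<close> applies at one of the ends. Here \<open>R\<close> bounds the weight of \<open>a\<close> and \<open>b\<close>
consumed when a vector of \<open>K\<close> is written in terms of \<open>w - a\<close> and \<open>b - a\<close>.\<close>

lemma upper_part_determines_dilate:
  assumes K: "finite K" "\<And>k. k \<in> K \<Longrightarrow> 0 < height (pt k)" "determines Y K {0}"
    and w: "w \<in> V" "w \<noteq> a" "w \<noteq> b" and D: "0 \<le> D"
  obtains M0 where "\<And>M. M0 \<le> M \<Longrightarrow>
    determines Y {u. pt u \<in> dilate V M \<and> M * height a + D \<le> height (pt u)} {u. pt u \<in> dilate V M}"
proof -
  have "\<exists>\<tau> \<sigma>. 0 \<le> \<tau> \<and> pt k = \<tau> *\<^sub>R w + (- \<tau> - \<sigma>) *\<^sub>R a + \<sigma> *\<^sub>R b" if "k \<in> K" for k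
  proof -
    define \<tau> where "\<tau> = height (pt k) / height (w - a)"
    have hw: "1 \<le> height (w - a)" by (rule height_vertex[OF w])
    have "cross (b - a) (pt k - \<tau> *\<^sub>R (w - a)) = 0"
      using hw unfolding height_def[symmetric] by (simp add: height_simps(2)[of "pt k"] height_simps(3) \<tau>_def)
    from cross_zero_multiple[OF this] obtain \<sigma> where "pt k - \<tau> *\<^sub>R (w - a) = \<sigma> *\<^sub>R (b - a)"
      using abV by auto
    then have "pt k = \<tau> *\<^sub>R w + (- \<tau> - \<sigma>) *\<^sub>R a + \<sigma> *\<^sub>R b" by (simp add: algebra_simps)
    moreover have "0 \<le> \<tau>" using K(2)[OF that] hw by (simp add: \<tau>_def)
    ultimately show ?thesis by blast
  qed
  then obtain \<tau> \<sigma> where ts: "\<And>k. k \<in> K \<Longrightarrow> 0 \<le> \<tau> k"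
      "\<And>k. k \<in> K \<Longrightarrow> pt k = \<tau> k *\<^sub>R w + (- \<tau> k - \<sigma> k) *\<^sub>R a + \<sigma> k *\<^sub>R b" by metis
  define R where "R = (\<Sum>k\<in>K. \<tau> k + \<bar>\<sigma> k\<bar>)"
  have R: "\<tau> k + \<bar>\<sigma> k\<bar> \<le> R" if "k \<in> K" for k
    unfolding R_def using that K(1) ts(1) by (intro member_le_sum) auto
  have "determines Y {u. pt u \<in> dilate V M \<and> M * height a + D \<le> height (pt u)} {u. pt u \<in> dilate V M}"
    if M: "2 * R + D + 1 \<le> M" for M
  proof (rule determinesI, rule ccontr)
    fix y y' u0 assume y: "y \<in> Y" "y' \<in> Y"
      and eq: "\<And>s. s \<in> {u. pt u \<in> dilate V M \<and> M * height a + D \<le> height (pt u)} \<Longrightarrow> y s = y' s"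
      and u0: "u0 \<in> {u. pt u \<in> dilate V M}" "y u0 \<noteq> y' u0"
    define S where "S = {u. pt u \<in> dilate V M \<and> y u \<noteq> y' u}"
    have "finite S"
      by (rule finite_subset[OF _ finite_lattice_points[OF bounded_dilate[OF finV, of M]]]) (auto simp: S_def)
    moreover have "u0 \<in> S" using u0 by (simp add: S_def)
    ultimately have "Max ((\<lambda>u. height (pt u)) ` S) \<in> (\<lambda>u. height (pt u)) ` S" by (intro Max_in) auto
    then obtain u where u: "u \<in> S" "height (pt u) = Max ((\<lambda>u. height (pt u)) ` S)" by auto
    define h where "h = height (pt u)"
    have above: "y s = y' s" if "pt s \<in> dilate V M" "h < height (pt s)" for s
    proof (rule ccontr)
      assume "y s \<noteq> y' s"
      then have "s \<in> S" using that by (simp add: S_def)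
      then have "height (pt s) \<le> h" using u(2) \<open>finite S\<close> by (simp add: h_def)
      then show False using that by simp
    qed
    have h: "h - M * height a \<le> D"
    proof (rule ccontr)
      assume "\<not> ?thesis"
      then have "y u = y' u" using u(1) by (intro eq) (auto simp: S_def h_def)
      then show False using u(1) by (simp add: S_def)
    qed
    have middle: "y s = y' s"
      if \<mu>: "weights V M \<mu> (pt s)" "height (pt s) = h" "R \<le> \<mu> a" "R \<le> \<mu> b" for s \<mu>
    proof -
      have "y (s + 0) = y' (s + 0)"
      proof (rule determinesD_translate[OF subshift_inv[OF Y] K(3) y])
        fix k assume k: "k \<in> K"
        have "pt s + (\<tau> k *\<^sub>R w + (- \<tau> k - \<sigma> k) *\<^sub>R a + \<sigma> k *\<^sub>R b) \<in> dilate V M"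
          by (rule combination_in_dilate[OF \<mu>(1) w])
             (use R[OF k] ts(1)[OF k] \<mu> w in \<open>auto simp: weights_def\<close>)
        then have "pt (s + k) \<in> dilate V M" using ts(2)[OF k] by (simp add: pt_add)
        then show "y (s + k) = y' (s + k)"
          using K(2)[OF k] \<mu>(2) by (intro above) (auto simp: pt_add height_simps)
      qed
      then show ?thesis by simp
    qed
    obtain \<mu> where \<mu>: "weights V M \<mu> (pt u)" using u(1) by (auto simp: S_def dilate_def)
    consider "\<mu> b < R" | "\<mu> a < R" | "R \<le> \<mu> a" "R \<le> \<mu> b" by linarith
    then have "y u = y' u"
    proof cases
      case 1
      show ?thesis by (rule row_point_determined[OF refl y M h above middle \<mu> h_def[symmetric] 1])
    next
      case 2
      show ?thesis by (rule row_point_determined[OF insert_commute y M h above middle \<mu> h_def[symmetric] 2])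
    next
      case 3
      then show ?thesis using middle[OF \<mu> h_def[symmetric]] by blast
    qed
    then show False using u(1) by (simp add: S_def)
  qed
  then show thesis by (rule that)
qed

text \<open>The vector \<open>d w\<close> points from the bottom edge towards \<open>w\<close>: subtracting it moves weight \<open>\<alpha> + \<beta>\<close>
from \<open>w\<close> to \<open>a\<close> and \<open>b\<close>. A point high enough has that much weight on some vertex \<open>w\<close>. The bound
\<open>D\<close> must not depend on \<open>M\<close>, which is chosen after it.\<close>

lemma high_points_can_descend:
  assumes "\<And>w. w \<in> V - {a, b} \<Longrightarrow> \<exists>\<alpha> \<beta>. 0 \<le> \<alpha> \<and> 0 \<le> \<beta> \<and> pt (d w) = (\<alpha> + \<beta>) *\<^sub>R w - \<alpha> *\<^sub>R a - \<beta> *\<^sub>R b"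
  obtains D where "0 \<le> D"
    "\<And>M u. pt u \<in> dilate V M \<Longrightarrow> M * height a + D \<le> height (pt u) \<Longrightarrow> \<exists>w\<in>V - {a, b}. pt (u - d w) \<in> dilate V M"
proof -
  obtain \<alpha> \<beta> where ab: "\<And>w. w \<in> V - {a, b} \<Longrightarrow> 0 \<le> \<alpha> w" "\<And>w. w \<in> V - {a, b} \<Longrightarrow> 0 \<le> \<beta> w"
    "\<And>w. w \<in> V - {a, b} \<Longrightarrow> pt (d w) = (\<alpha> w + \<beta> w) *\<^sub>R w - \<alpha> w *\<^sub>R a - \<beta> w *\<^sub>R b"
    using assms by metis
  define D where "D = 1 + (\<Sum>w\<in>V - {a, b}. (\<alpha> w + \<beta> w) * height (w - a))"
  have nn: "0 \<le> height (w - a)" if "w \<in> V - {a, b}" for w using height_vertex_nonneg that by auto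
  have "0 \<le> (\<Sum>w\<in>V - {a, b}. (\<alpha> w + \<beta> w) * height (w - a))"
    using ab nn by (intro sum_nonneg) auto
  then have "0 \<le> D" by (simp add: D_def)
  moreover have "\<exists>w\<in>V - {a, b}. pt (u - d w) \<in> dilate V M"
    if u: "pt u \<in> dilate V M" "M * height a + D \<le> height (pt u)" for M u
  proof -
    obtain \<mu> where \<mu>: "weights V M \<mu> (pt u)" using u by (auto simp: dilate_def)
    have "\<exists>w\<in>V - {a, b}. \<alpha> w + \<beta> w \<le> \<mu> w"
    proof (rule ccontr)
      assume "\<not> ?thesis"
      then have "(\<Sum>w\<in>V - {a, b}. \<mu> w * height (w - a)) \<le> (\<Sum>w\<in>V - {a, b}. (\<alpha> w + \<beta> w) * height (w - a))"
        using nn by (intro sum_mono mult_right_mono) (auto simp: not_le less_imp_le)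
      then show False using height_weights(3)[OF \<mu>] u(2) by (simp add: D_def)
    qed
    then obtain w where w: "w \<in> V - {a, b}" "\<alpha> w + \<beta> w \<le> \<mu> w" by blast
    have "pt u + (- (\<alpha> w + \<beta> w) *\<^sub>R w + \<alpha> w *\<^sub>R a + \<beta> w *\<^sub>R b) \<in> dilate V M"
      by (rule combination_in_dilate[OF \<mu>]) (use w ab[OF w(1)] \<mu> abV in \<open>auto simp: weights_def\<close>)
    then have "pt (u - d w) \<in> dilate V M" by (simp add: pt_diff ab(3)[OF w(1)] algebra_simps)
    with w show ?thesis by blast
  qed
  ultimately show thesis by (rule that)
qed

text \<open>Seen from \<open>a\<close>, the preceding vertex \<open>p\<close> is the one furthest to the left, i.e. with the least
quotient of the coordinate along the edge by the height; symmetrically for \<open>r\<close> seen from \<open>b\<close>.\<close>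

lemma neighbours:
  assumes "V \<noteq> {a, b}"
  obtains p r where "p \<in> V - {a, b}" "r \<in> V - {a, b}"
    "\<And>v. v \<in> V \<Longrightarrow> 0 \<le> cross (a - p) (v - a)" "\<And>v. v \<in> V \<Longrightarrow> 0 \<le> cross (r - b) (v - b)"
proof -
  let ?W = "V - {a, b}" and ?e = "b - a"
  have W: "finite ?W" "?W \<noteq> {}" using finV assms abV by auto
  have ee: "?e \<bullet> ?e > 0" using abV by simp
  define f where "f v = (?e \<bullet> (v - a)) / height (v - a)" for v
  define g where "g v = (?e \<bullet> (v - b)) / height (v - b)" for v
  have "Min (f ` ?W) \<in> f ` ?W" "Max (g ` ?W) \<in> g ` ?W" using W by (auto intro!: Min_in Max_in)
  then obtain p r where "Min (f ` ?W) = f p" and p: "p \<in> ?W" and "Max (g ` ?W) = g r" and r: "r \<in> ?W"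
    by (elim imageE)
  then have min: "f p \<le> f v" and max: "g v \<le> g r" if "v \<in> ?W" for v
    using Min_le[of "f ` ?W" "f v"] Max_ge[of "g ` ?W" "g v"] W(1) that by simp_all
  have hb: "height (v - b) = height (v - a)" for v by (simp add: height_simps)
  have pos: "0 < height (v - a)" if "v \<in> ?W" for v using height_vertex[of v] that by force
  have 1: "0 \<le> cross (a - p) (v - a)" if v: "v \<in> V" for v
  proof -
    have "(?e \<bullet> ?e) * cross (p - a) (v - a) \<le> 0"
    proof (cases "v = a \<or> v = b")
      case True
      then show ?thesis
      proof
        assume "v = b"
        have "cross (p - a) (b - a) = - height (p - a)" unfolding height_def by (rule cross_commute)
        then show ?thesis using pos[OF p] ee \<open>v = b\<close> by (simp add: mult_le_0_iff)
      qed (simp add: cross_simps)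
    next
      case False
      then have v: "v \<in> ?W" using v by simp
      have "f p * height (p - a) * height (v - a) \<le> f v * height (p - a) * height (v - a)"
        using min[OF v] pos[OF v] pos[OF p] by (intro mult_right_mono) auto
      then have "(?e \<bullet> (p - a)) * height (v - a) \<le> (?e \<bullet> (v - a)) * height (p - a)"
        using pos[OF v] pos[OF p] by (simp add: f_def)
      then show ?thesis unfolding inner_cross_identity height_def[symmetric] by (simp add: mult.commute)
    qed
    then have "cross (p - a) (v - a) \<le> 0" using ee by (simp add: mult_le_0_iff)
    then show ?thesis by (simp add: cross_simps)
  qed
  have 2: "0 \<le> cross (r - b) (v - b)" if v: "v \<in> V" for v
  proof -
    have "0 \<le> (?e \<bullet> ?e) * cross (r - b) (v - b)"
    proof (cases "v = a \<or> v = b")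
      case True
      then show ?thesis
      proof
        assume "v = a"
        have "cross (r - b) (a - b) = height (r - b)" unfolding height_def by (simp add: cross_def algebra_simps)
        then show ?thesis using pos[OF r] ee \<open>v = a\<close> hb[of r] by simp
      qed (simp add: cross_simps)
    next
      case False
      then have v: "v \<in> ?W" using v by simp
      have "g v * height (r - b) * height (v - b) \<le> g r * height (r - b) * height (v - b)"
        using max[OF v] pos[OF v] pos[OF r] unfolding hb by (intro mult_right_mono) auto
      then have "(?e \<bullet> (v - b)) * height (r - b) \<le> (?e \<bullet> (r - b)) * height (v - b)"
        using pos[OF v] pos[OF r] unfolding g_def hb by (simp add: mult.commute)
      then show ?thesis unfolding inner_cross_identity height_def[symmetric] by (simp add: mult.commute)
    qed
    then show ?thesis using ee by (simp add: zero_le_mult_iff)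
  qed
  show thesis using that[OF p r 1 2] .
qed

lemma finite_code_above:
  assumes "expansive_direction Y (b - a)"
  obtains K where "finite K" "\<And>k. k \<in> K \<Longrightarrow> 0 < height (pt k)" "determines Y K {0}"
proof -
  have "determines Y {u. 1 \<le> cross (b - a) (pt u)} {0}"
    using assms determines_mono unfolding expansive_direction_def by blast
  then obtain K where "finite K" "K \<subseteq> {u. 1 \<le> cross (b - a) (pt u)}" "determines Y K {0}"
    by (rule determines_finite_subset[OF Y])
  then show thesis by (intro that[of K]) (auto simp: height_def)
qed

text \<open>All of \<open>P\<close> lies between the parallels to \<open>p - a\<close> through \<open>a\<close> and \<open>b\<close>. So from each vertex \<open>w\<close> the
direction \<open>a - p\<close> leads down to the edge, and points at sufficient height in a dilate stay in it
when \<open>p - a\<close> is subtracted. Thus the dilate contains the upper part of its translate by \<open>a - p\<close>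
and determines the rest of it.\<close>

lemma period_of_converging_neighbours:
  assumes exp: "expansive_direction Y (b - a)"
    and p: "p \<in> V - {a, b}" "\<And>v. v \<in> V \<Longrightarrow> 0 \<le> cross (a - p) (v - a)"
    and r: "r \<in> V - {a, b}" "\<And>v. v \<in> V \<Longrightarrow> 0 \<le> cross (r - b) (v - b)"
    and conv: "0 \<le> cross (a - p) (b - r)"
  obtains d where "d \<noteq> 0" "has_period Y d"
proof -
  obtain ka kp where k: "a = pt ka" "p = pt kp" using abV p intV by blast
  define dk where "dk = kp - ka"
  have dk: "pt dk = p - a" by (simp add: dk_def k pt_diff)
  have hd: "1 \<le> height (p - a)" using height_vertex[of p] p by auto
  have hr: "1 \<le> height (r - b)" using height_vertex[of r] r by (auto simp: height_simps)
  have comb: "\<exists>\<alpha> \<beta>. 0 \<le> \<alpha> \<and> 0 \<le> \<beta> \<and> pt dk = (\<alpha> + \<beta>) *\<^sub>R w - \<alpha> *\<^sub>R a - \<beta> *\<^sub>R b" if w: "w \<in> V - {a, b}" for w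
  proof -
    define \<tau> where "\<tau> = height (w - a) / height (p - a)"
    have hw: "1 \<le> height (w - a)" using height_vertex[of w] w by auto
    have \<tau>: "0 < \<tau>" using hw hd by (simp add: \<tau>_def)
    have "cross (b - a) ((w - a) - \<tau> *\<^sub>R (p - a)) = 0"
      using hd unfolding height_def[symmetric] by (simp add: height_simps(2)[of "w - a"] height_simps(3) \<tau>_def)
    from cross_zero_multiple[OF this] obtain \<sigma> where \<sigma>: "(w - a) - \<tau> *\<^sub>R (p - a) = \<sigma> *\<^sub>R (b - a)"
      using abV by auto
    have \<sigma>1: "w - a = \<sigma> *\<^sub>R (b - a) + \<tau> *\<^sub>R (p - a)" using \<sigma> by (simp add: algebra_simps)
    have \<sigma>2: "w - b = (\<sigma> - 1) *\<^sub>R (b - a) + \<tau> *\<^sub>R (p - a)" using \<sigma>1 by (simp add: algebra_simps)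
    \<comment> \<open>\<open>w - \<tau> (p - a)\<close> is the point \<open>a + \<sigma> (b - a)\<close> of the line through the edge; it is not left of \<open>a\<close>
      because of \<open>p\<close>, and not right of \<open>b\<close> because of \<open>r\<close> and \<open>conv\<close>\<close>
    have "0 \<le> cross (a - p) (w - a)" using p(2) w by blast
    also have "\<dots> = \<sigma> * height (p - a)"
      unfolding \<sigma>1 cross_simps(1,3) by (simp add: height_def cross_def algebra_simps)
    finally have "0 \<le> \<sigma>" using hd by (simp add: zero_le_mult_iff)
    have "0 \<le> cross (r - b) (w - b)" using r(2) w by blast
    also have "\<dots> = (1 - \<sigma>) * height (r - b) - \<tau> * cross (a - p) (b - r)"
      unfolding \<sigma>2 cross_simps(1,3) by (simp add: height_def cross_def algebra_simps)
    also have "\<dots> \<le> (1 - \<sigma>) * height (r - b)" using \<tau> conv by simp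
    finally have "\<sigma> \<le> 1" using hr by (simp add: zero_le_mult_iff)
    define \<kappa> where "\<kappa> = 1 / \<tau>"
    have "p - a = \<kappa> *\<^sub>R ((w - a) - \<sigma> *\<^sub>R (b - a))" unfolding \<sigma>1 using \<tau> by (simp add: \<kappa>_def)
    then have "pt dk = (\<kappa> * (1 - \<sigma>) + \<kappa> * \<sigma>) *\<^sub>R w - (\<kappa> * (1 - \<sigma>)) *\<^sub>R a - (\<kappa> * \<sigma>) *\<^sub>R b"
      unfolding dk by (simp add: algebra_simps)
    moreover have "0 \<le> \<kappa>" using \<tau> by (simp add: \<kappa>_def)
    ultimately show ?thesis using \<open>0 \<le> \<sigma>\<close> \<open>\<sigma> \<le> 1\<close> by (meson diff_ge_0_iff_ge mult_nonneg_nonneg)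
  qed
  obtain D where D: "0 \<le> D"
    "\<And>M u. pt u \<in> dilate V M \<Longrightarrow> M * height a + D \<le> height (pt u) \<Longrightarrow> \<exists>w\<in>V - {a, b}. pt (u - dk) \<in> dilate V M"
    by (rule high_points_can_descend[of "\<lambda>_. dk", OF comb]) (assumption | rule that)+
  obtain K where K: "finite K" "\<And>k. k \<in> K \<Longrightarrow> 0 < height (pt k)" "determines Y K {0}"
    by (rule finite_code_above[OF exp]) (rule that; assumption)
  obtain M0 where M0: "\<And>M. M0 \<le> M \<Longrightarrow>
    determines Y {u. pt u \<in> dilate V M \<and> M * height a + D \<le> height (pt u)} {u. pt u \<in> dilate V M}"
    by (rule upper_part_determines_dilate[OF K, of p D]) (use p D in \<open>auto intro: that\<close>)
  define M where "M = nat \<lceil>M0\<rceil>"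
  have "M0 \<le> real M" by (simp add: M_def real_nat_ceiling_ge)
  define S where "S = {u. pt u \<in> dilate V (real M)}"
  define T where "T = {u. pt u \<in> dilate V (real M) \<and> real M * height a + D \<le> height (pt u)}"
  have "determines Y T S" using M0[OF \<open>M0 \<le> real M\<close>] by (simp add: S_def T_def)
  then have "determines Y ((+) (- dk) ` T) ((+) (- dk) ` S)"
    by (rule determines_translate[OF subshift_inv[OF Y]])
  moreover have "(+) (- dk) ` T \<subseteq> S"
  proof
    fix x assume "x \<in> (+) (- dk) ` T"
    then obtain u where u: "x = u - dk" "u \<in> T" by auto
    then show "x \<in> S" using D(2)[of u "real M"] by (auto simp: S_def T_def)
  qed
  ultimately have det: "determines Y S ((+) (- dk) ` S)" by (rule determines_mono) simp
  have "finite S" unfolding S_def by (rule finite_lattice_points[OF bounded_dilate[OF finV]])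
  moreover have "zscale (int M) ka \<in> S"
    using dilate_mult[OF dilate_vertex[OF finV abV(1)], of "real M"] by (simp add: S_def pt_zscale k)
  ultimately obtain q :: nat where q: "q > 0" "has_period Y (zscale (int q) (- dk))"
    using period_of_determines[OF Y _ _ det] by blast
  have "dk \<noteq> 0" using hd dk pt_zero by (auto simp: height_simps(5))
  then have "zscale (int q) (- dk) \<noteq> 0" using q(1) by (auto simp: zscale_def prod_eq_iff)
  with q that show thesis by blast
qed

end

section \<open>Counting sides and the case of a segment\<close>

lemma num_sides_segment: "num_sides (closed_segment p q) \<le> 2"
proof -
  have vs: "vertices (closed_segment p q) = {p, q}"
    unfolding vertices_def extreme_point_of_segment by blast
  have "oriented_edges (closed_segment p q) \<subseteq> {(p, q), (q, p)}"
  proof (rule subrelI)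
    fix u w assume e: "(u, w) \<in> oriented_edges (closed_segment p q)"
    from oriented_edgeD(2,3)[OF e, unfolded vs] have "u = p \<or> u = q" "w = p \<or> w = q" by simp_all
    then show "(u, w) \<in> {(p, q), (q, p)}" using oriented_edgeD(1)[OF e] by (elim disjE) simp_all
  qed
  then have "num_sides (closed_segment p q) \<le> card {(p, q), (q, p)}"
    unfolding num_sides_def by (rule card_mono[rotated]) simp
  also have "\<dots> \<le> 2"
  proof (cases "p = q")
    case False
    then have "(p, q) \<notin> {(q, p)}" by blast
    then show ?thesis by (subst card_insert_disjoint) simp_all
  qed simp
  finally show ?thesis .
qed

context polygon_edge
begin

text \<open>By the coding property at \<open>b\<close>, the points of the segment determine the next segment on the same
line, so \<open>Y\<close> has a period \<open>f\<close> along the line. A strip of height \<open>h\<close> is then determined by the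
finite box \<open>S2\<close> of width \<open>f\<close>, and if \<open>h\<close> is at least the height of the code \<open>K\<close> the strip
determines everything below it. This gives a transversal period, which carries every site into
the part that \<open>S2\<close> determines.\<close>

lemma finite_of_segment:
  assumes V: "V = {a, b}" and exp: "expansive_direction Y (b - a)"
  shows "finite Y"
proof -
  note inv = subshift_inv[OF Y]
  obtain ka kb where k: "a = pt ka" "b = pt kb" using abV intV by blast
  define e where "e = b - a"
  define ke where "ke = kb - ka"
  have e: "e = pt ke" "e \<noteq> 0" using abV by (auto simp: e_def ke_def k pt_diff)
  have ee: "0 < idot ke ke" using e of_int_idot[of ke ke] inner_self_pos[of e] by (metis of_int_0_less_iff)
  have hull: "convex hull V = closed_segment a b" by (simp add: V segment_convex_hull)
  have hte: "height x = cross e x" for x by (simp add: height_def e_def)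
  have hke: "height (pt ke) = 0" unfolding hte e(1) by (simp add: cross_simps)
  have kbe: "kb = ka + ke" by (simp add: ke_def)
  define S where "S = {u. pt u \<in> convex hull V}"
  have "finite S" unfolding S_def hull by (rule finite_lattice_points) (rule bounded_closed_segment)
  have kaS: "ka \<in> S" using hull_inc[OF abV(1)] by (simp add: S_def k)
  define U where "U = {u. height (pt u) = height a}"
  have idot_real: "of_int (idot ke u) = e \<bullet> pt u" for u by (simp add: of_int_idot e)
  have det: "determines Y S ((+) ke ` S)"
  proof (rule determinesI)
    fix y y' u assume y: "y \<in> Y" "y' \<in> Y" and eq: "\<And>s. s \<in> S \<Longrightarrow> y s = y' s" and u: "u \<in> (+) ke ` S"
    have seg: "u \<in> S" if "u \<in> U" "idot ke ka \<le> idot ke u" "idot ke u \<le> idot ke kb" for u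
    proof -
      have "e \<bullet> a \<le> e \<bullet> pt u" "e \<bullet> pt u \<le> e \<bullet> b" using that(2,3) by (simp_all add: k flip: idot_real)
      then have "pt u \<in> closed_segment a b"
        using closed_segment_on_line_iff[OF e(2), of a "height a" b] that(1) height_simps(4)
        by (auto simp: U_def hte closed_segment_eq_real_ivl)
      then show ?thesis by (simp add: S_def hull)
    qed
    show "y u = y' u"
    proof (rule agreement_propagates[OF inv coding y, of kb U "idot ke ka" "idot ke" "idot ke ke"])
      show "pt kb \<in> V" using abV k by simp
      show "y u = y' u" if "u \<in> U" "idot ke ka \<le> idot ke u" "idot ke u \<le> idot ke ka + idot ke ke" for u
        by (rule eq, rule seg) (use that in \<open>auto simp: kbe idot_simps\<close>)
      fix u z assume u: "u \<in> U" "idot ke ka + idot ke ke < idot ke u" and "z \<in> {u. pt u \<in> convex hull V \<and> u \<noteq> kb}"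
      then have z: "pt z \<in> convex hull V" "z \<noteq> kb" by auto
      have "height (pt z) = height a"
        using z(1) closed_segment_on_line_iff[OF e(2), of a "height a" b "pt z"] height_simps(4) by (simp add: hull hte)
      then obtain s where s: "0 \<le> s" "s \<le> 1" "pt z = a + s *\<^sub>R (b - a)" using edge_points[OF z(1)] by auto
      have "s \<noteq> 1"
      proof
        assume "s = 1"
        then have "pt z = pt kb" using s k by simp
        then show False using z(2) by (simp only: pt_inject)
      qed
      have eq2: "pt (u - kb + z) = pt u - (1 - s) *\<^sub>R e"
        by (simp add: pt_add pt_diff s(3) e_def algebra_simps flip: k)
      have "height (pt (u - kb + z)) = height (pt u)" unfolding eq2 by (simp add: hte cross_simps)
      moreover have "of_int (idot ke (u - kb + z)) = of_int (idot ke u) - (1 - s) * of_int (idot ke ke)"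
        unfolding idot_real eq2 by (simp add: inner_diff_right e(1))
      moreover have "0 < (1 - s) * of_int (idot ke ke)" "(1 - s) * of_int (idot ke ke) \<le> of_int (idot ke ke)"
        using s \<open>s \<noteq> 1\<close> ee by (auto simp: mult_le_cancel_right1)
      ultimately show "y (u - kb + z) = y' (u - kb + z) \<or> (u - kb + z \<in> U \<and>
          idot ke ka \<le> idot ke (u - kb + z) \<and> idot ke (u - kb + z) < idot ke u)"
        using u by (auto simp: U_def)
    next
      obtain w where w: "u = ke + w" "w \<in> S" using u by auto
      have "pt w \<in> closed_segment a b" using w by (simp add: S_def hull)
      then have "height (pt w) = height a \<and> e \<bullet> pt w \<in> closed_segment (e \<bullet> a) (e \<bullet> b)"
        using closed_segment_on_line_iff[OF e(2), of a "height a" b] height_simps(4) by (simp add: hte)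
      moreover have "e \<bullet> a \<le> e \<bullet> b" using inner_ge_zero[of e] unfolding e_def by (simp add: inner_diff_right)
      ultimately have "height (pt w) = height a" "idot ke ka \<le> idot ke w"
        by (simp_all add: closed_segment_eq_real_ivl k flip: idot_real)
      then show "u \<in> U" "idot ke ka \<le> idot ke u"
        using hke ee by (auto simp: U_def w(1) pt_add height_simps idot_simps)
    qed
  qed
  obtain q :: nat where q: "q > 0" "has_period Y (zscale (int q) ke)"
    using period_of_determines[OF Y \<open>finite S\<close> _ det] kaS by blast
  define f where "f = zscale (int q) ke"
  define G where "G = int q * idot ke ke"
  have G: "0 < G" using q ee by (simp add: G_def)
  have f: "idot ke f = G" "height (pt f) = 0" "has_period Y f"
    using q hke by (simp_all add: f_def G_def idot_simps pt_zscale height_simps)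
  obtain K where K: "finite K" "\<And>k. k \<in> K \<Longrightarrow> 0 < height (pt k)" "determines Y K {0}"
    by (rule finite_code_above[OF exp]) (rule that; assumption)
  define h where "h = (\<Sum>k\<in>K. height (pt k))"
  have h: "height (pt k) \<le> h" if "k \<in> K" for k
    unfolding h_def using that K(1) by (intro member_le_sum) (auto intro: less_imp_le K(2))
  have "0 \<le> h" unfolding h_def by (intro sum_nonneg) (auto intro: less_imp_le K(2))
  have K1: "1 \<le> height (pt k)" if "k \<in> K" for k
    using K(2)[OF that] height_integer[of k] by auto
  define S2 where "S2 = {u. 0 \<le> idot ke u \<and> idot ke u < G \<and> 0 \<le> height (pt u) \<and> height (pt u) \<le> h}"
  have "finite S2"
  proof -
    let ?R = "{x. 0 \<le> e \<bullet> x \<and> e \<bullet> x \<le> of_int G \<and> 0 \<le> height x \<and> height x \<le> h}"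
    have "bounded ?R"
      unfolding bounded_iff
    proof (intro exI ballI)
      fix x assume x: "x \<in> ?R"
      have "norm ((e \<bullet> e) *\<^sub>R x) \<le> norm ((e \<bullet> x) *\<^sub>R e) + norm (cross e x *\<^sub>R (- snd e, fst e))"
        unfolding plane_coordinates by (rule norm_triangle_ineq)
      also have "\<dots> \<le> of_int G * norm e + h * norm (- snd e, fst e)"
        unfolding norm_scaleR by (intro add_mono mult_right_mono) (use x in \<open>auto simp: hte\<close>)
      finally show "norm x \<le> (of_int G * norm e + h * norm (- snd e, fst e)) / (e \<bullet> e)"
        using inner_self_pos[OF e(2)] by (simp add: field_simps)
    qed
    moreover have "S2 \<subseteq> {u. pt u \<in> ?R}"
    proof
      fix u assume u: "u \<in> S2"
      then have "0 \<le> real_of_int (idot ke u)" "real_of_int (idot ke u) \<le> of_int G" by (auto simp: S2_def)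
      then show "u \<in> {u. pt u \<in> ?R}" using u by (simp add: S2_def idot_real)
    qed
    ultimately show ?thesis using finite_lattice_points finite_subset by blast
  qed
  have low: "y u = y' u"
    if y: "y \<in> Y" "y' \<in> Y" and eq: "\<And>s. s \<in> S2 \<Longrightarrow> y s = y' s" and u: "height (pt u) \<le> h" for y y' u
  proof -
    have strip: "y u = y' u" if u: "0 \<le> height (pt u)" "height (pt u) \<le> h" for u
    proof -
      define n where "n = idot ke u div G"
      define u' where "u' = u - zscale n f"
      have "u' \<in> S2"
        using u G f(1,2) unfolding S2_def u'_def n_def
        by (auto simp: idot_simps pt_diff pt_zscale height_simps minus_div_mult_eq_mod)
      then have "y u' = y' u'" by (rule eq)
      moreover have "u = u' + zscale n f" by (simp add: u'_def)
      ultimately show ?thesis using has_period_multiple[OF f(3) y(1)] has_period_multiple[OF f(3) y(2)] by metis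
    qed
    have "- real n \<le> height (pt u) \<Longrightarrow> height (pt u) \<le> h \<Longrightarrow> y u = y' u" for n u
    proof (induction n arbitrary: u)
      case 0
      then show ?case using strip by simp
    next
      case (Suc n)
      show ?case
      proof (cases "0 \<le> height (pt u)")
        case True
        then show ?thesis using strip Suc.prems by blast
      next
        case False
        have "y (u + 0) = y' (u + 0)"
        proof (rule determinesD_translate[OF inv K(3) y])
          fix k assume "k \<in> K"
          then show "y (u + k) = y' (u + k)"
            using h[of k] K1[of k] Suc.prems False by (intro Suc.IH) (auto simp: pt_add height_simps)
        qed
        then show ?thesis by simp
      qed
    qed
    moreover obtain n where "- height (pt u) \<le> real n" using real_arch_simple by blast
    ultimately show ?thesis using u by (metis minus_le_iff)
  qed
  obtain t where t: "1 \<le> height (pt t)" unfolding hte by (rule half_plane_integer_translate[OF e(2)])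
  have "determines Y S2 ((+) (- t) ` S2)"
  proof (rule determinesI)
    fix y y' u assume y: "y \<in> Y" "y' \<in> Y" and eq: "\<And>s. s \<in> S2 \<Longrightarrow> y s = y' s" and u: "u \<in> (+) (- t) ` S2"
    then have "height (pt u) \<le> h" using t by (auto simp: S2_def pt_diff height_simps)
    then show "y u = y' u" by (rule low[OF y, rotated]) (rule eq)
  qed
  moreover have "0 \<in> S2" using G \<open>0 \<le> h\<close> by (simp add: S2_def idot_simps pt_zero height_simps)
  ultimately obtain q2 :: nat where q2: "q2 > 0" "has_period Y (zscale (int q2) (- t))"
    using period_of_determines[OF Y \<open>finite S2\<close>] by blast
  have "determines Y S2 UNIV"
  proof (rule determinesI)
    fix y y' u assume y: "y \<in> Y" "y' \<in> Y" and eq: "\<And>s. s \<in> S2 \<Longrightarrow> y s = y' s"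
    obtain n where n: "height (pt u) - h \<le> real n" using real_arch_simple by blast
    define u' where "u' = u + zscale (int n) (zscale (int q2) (- t))"
    have "1 \<le> real q2 * height (pt t)" using q2(1) t by (metis (no_types, opaque_lifting) Suc_leI mult_mono' mult_1 of_nat_1 of_nat_mono One_nat_def zero_le_one)
    then have "real n * 1 \<le> real n * (real q2 * height (pt t))" by (rule mult_left_mono) simp
    moreover have "height (pt u') = height (pt u) - real n * (real q2 * height (pt t))"
      unfolding u'_def zscale_simps(4) using pt_diff[of 0 t]
      by (simp add: pt_add pt_zscale height_simps pt_zero)
    ultimately have "height (pt u') \<le> h" using n by simp
    then have "y u' = y' u'" by (rule low[OF y, rotated]) (rule eq)
    then show "y u = y' u"
      unfolding u'_def has_period_multiple[OF q2(2) y(1)] has_period_multiple[OF q2(2) y(2)] .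
  qed
  then show ?thesis by (rule finite_subshift[OF Y \<open>finite S2\<close>])
qed

text \<open>The edges along \<open>a - p\<close>, \<open>b - a\<close> and \<open>r - b\<close> have a descending, a horizontal and an ascending
direction.\<close>

lemma three_sides:
  assumes e: "(a, b) \<in> oriented_edges (convex hull V)"
    and p: "p \<in> V - {a, b}" "\<And>v. v \<in> V \<Longrightarrow> 0 \<le> cross (a - p) (v - a)"
    and r: "r \<in> V - {a, b}" "\<And>v. v \<in> V \<Longrightarrow> 0 \<le> cross (r - b) (v - b)"
  shows "3 \<le> num_sides (convex hull V)"
proof -
  let ?P = "convex hull V"
  have cP: "convex ?P" "compact ?P" using finV by (simp_all add: finite_imp_compact_convex_hull)
  have inP: "v \<in> ?P" if "v \<in> V" for v using that by (rule hull_inc)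
  have hp: "1 \<le> height (p - a)" using height_vertex[of p] p by auto
  have hr: "1 \<le> height (r - b)" using height_vertex[of r] r by (auto simp: height_simps)
  have pe: "cross (a - p) p = cross (a - p) a" "cross (r - b) r = cross (r - b) b"
    by (simp_all add: cross_simps cross_commute[of a p] cross_commute[of b r])
  obtain c1 d1 t1 where 1: "(c1, d1) \<in> oriented_edges ?P" "t1 > 0" "d1 - c1 = t1 *\<^sub>R (a - p)"
  proof (rule oriented_edge_exists[OF cP, of "a - p" "cross (a - p) a" a p])
    show "cross (a - p) a \<le> cross (a - p) x" if "x \<in> ?P" for x
      by (rule cross_ge_on_hull[OF _ that]) (use p(2) in \<open>simp add: cross_simps(2)\<close>)
  qed (use p pe abV inP in auto)
  obtain c2 d2 t2 where 2: "(c2, d2) \<in> oriented_edges ?P" "t2 > 0" "d2 - c2 = t2 *\<^sub>R (r - b)"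
  proof (rule oriented_edge_exists[OF cP, of "r - b" "cross (r - b) b" b r])
    show "cross (r - b) b \<le> cross (r - b) x" if "x \<in> ?P" for x
      by (rule cross_ge_on_hull[OF _ that]) (use r(2) in \<open>simp add: cross_simps(2)\<close>)
  qed (use r pe abV inP in auto)
  have h: "height (b - a) = 0" "height (d1 - c1) < 0" "0 < height (d2 - c2)"
    unfolding 1(3) 2(3) height_simps(3) using 1(2) 2(2) hp hr by (auto simp: height_simps mult_less_0_iff)
  have "(a, b) \<noteq> (c1, d1)" "(a, b) \<noteq> (c2, d2)" "(c1, d1) \<noteq> (c2, d2)" using h by auto
  then have "card {(a, b), (c1, d1), (c2, d2)} = 3" by simp
  moreover have "vertices ?P \<subseteq> V" by (rule vertices_convex_hull)
  then have "finite (oriented_edges ?P)" using finV finite_subset by (intro finite_oriented_edges) blast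
  then have "card {(a, b), (c1, d1), (c2, d2)} \<le> card (oriented_edges ?P)"
    by (rule card_mono) (use e 1 2 in auto)
  ultimately show ?thesis by (simp add: num_sides_def)
qed

section \<open>Removing an expansive edge\<close>

text \<open>In terms of windows based at the sites of the \<open>N\<close>-th dilate: every site of the window at the
vertex \<open>N v\<close>, except for its corner, belongs to a window based at another site. Indeed, if a point
\<open>x\<close> of the window has weight at least 1 on some vertex \<open>w \<noteq> v\<close>, the base point can be moved by
\<open>w - v\<close>; if not, the weight off \<open>v\<close> is less than the number of vertices, hence at most \<open>N\<close>, and
the whole displacement of \<open>x\<close> from the corner can be moved into the base point. The corner itself
is coded by a translate of \<open>P\<close>.\<close>

lemma remaining_vertex_coded:
  assumes v: "pt k \<in> V" and N: "card V \<le> N" and M: "1 \<le> M"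
  shows "determines Y (\<Union>w\<in>{u. pt u \<in> dilate V (real M)}. (+) w ` {u. pt u \<in> dilate V (real N) \<and> u \<noteq> zscale (int N) k})
    ((+) (zscale (int N) k) ` {u. pt u \<in> dilate V (real M)})"
proof (rule determinesI)
  let ?W = "{u. pt u \<in> dilate V (real M)}" and ?Q = "{u. pt u \<in> dilate V (real N) \<and> u \<noteq> zscale (int N) k}"
  fix y y' u assume y: "y \<in> Y" "y' \<in> Y" and eq: "\<And>s. s \<in> (\<Union>w\<in>?W. (+) w ` ?Q) \<Longrightarrow> y s = y' s"
    and "u \<in> (+) (zscale (int N) k) ` ?W"
  then obtain x where x: "x \<in> ?W" "u = zscale (int N) k + x" by auto
  have "1 \<le> card V" using finV v by (metis One_nat_def Suc_leI card_gt_0_iff empty_iff)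
  then have N1: "1 \<le> N" using N by simp
  have agree: "y (z + x') = y' (z + x')" if "z \<in> ?Q" "x' \<in> ?W" for z x'
    by (rule eq, rule UN_I[OF that(2)], rule image_eqI[OF _ that(1)]) (simp add: add.commute)
  have kN: "real j *\<^sub>R pt k \<in> dilate V (real j)" for j
    using dilate_mult[OF dilate_vertex[OF finV v], of "real j"] by simp
  have main: "y (zscale (int N) k + x) = y' (zscale (int N) k + x)" if x: "x \<in> ?W" "x \<noteq> zscale (int M) k" for x
  proof -
    obtain \<mu> where \<mu>: "weights V (real M) \<mu> (pt x)" using x by (auto simp: dilate_def)
    have \<mu>0: "0 \<le> \<mu> v" if "v \<in> V" for v using \<mu> that by (simp add: weights_def)
    show ?thesis
    proof (cases "\<exists>w\<in>V - {pt k}. 1 \<le> \<mu> w")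
      case True
      then obtain w where w: "w \<in> V" "w \<noteq> pt k" "1 \<le> \<mu> w" by blast
      obtain kw where kw: "w = pt kw" using w intV by blast
      have "weights V (real M + - 1) (\<mu>(w := \<mu> w + - 1)) (pt x + - 1 *\<^sub>R w)"
        by (rule weights_update[OF finV \<mu> w(1)]) (use w in simp)
      then have "pt x - w \<in> dilate V (real M - 1)" by (auto simp: dilate_def)
      from dilate_add[OF this dilate_vertex[OF finV v]] have 1: "x - kw + k \<in> ?W"
        by (simp add: pt_add pt_diff kw)
      have "real (N - 1) *\<^sub>R pt k + w \<in> dilate V (real (N - 1) + 1)"
        by (rule dilate_add[OF kN dilate_vertex[OF finV w(1)]])
      moreover have "real (N - 1) *\<^sub>R pt k + w = pt (zscale (int N) k - k + kw)"
        using N1 by (simp add: pt_add pt_diff pt_zscale kw of_nat_diff scaleR_left_diff_distrib)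
      ultimately have "zscale (int N) k - k + kw \<in> ?Q" using N1 w kw by (auto simp: of_nat_diff)
      from agree[OF this 1] show ?thesis by (simp add: algebra_simps)
    next
      case False
      have "(\<Sum>w\<in>V - {pt k}. \<mu> w) \<le> (\<Sum>w\<in>V - {pt k}. 1)"
        by (rule sum_mono) (use False in \<open>auto simp: not_le less_imp_le\<close>)
      also have "\<dots> \<le> real (card V)" using finV by (simp add: card_Diff1_le)
      also have "\<dots> \<le> real N" using N by simp
      finally have "(\<Sum>w\<in>V - {pt k}. \<mu> w) \<le> real N" .
      moreover have "real M = \<mu> (pt k) + (\<Sum>w\<in>V - {pt k}. \<mu> w)"
        using \<mu> sum.remove[OF finV v, of \<mu>] by (simp add: weights_def)
      ultimately have "0 \<le> \<mu> (pt k) + (real N - real M)" by simp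
      from weights_update[OF finV \<mu> v this] have "pt x + (real N - real M) *\<^sub>R pt k \<in> dilate V (real N)"
        by (auto simp: dilate_def)
      moreover have "pt x + (real N - real M) *\<^sub>R pt k = pt (zscale (int N) k + (x - zscale (int M) k))"
        by (simp add: pt_add pt_diff pt_zscale algebra_simps)
      ultimately have 1: "zscale (int N) k + (x - zscale (int M) k) \<in> ?Q" using x by auto
      have "zscale (int M) k \<in> ?W" using kN by (simp add: pt_zscale)
      from agree[OF 1 this] show ?thesis by (simp add: algebra_simps)
    qed
  qed
  show "y u = y' u"
  proof (cases "x = zscale (int M) k")
    case False
    then show ?thesis using main x by blast
  next
    case True
    define t where "t = zscale (int N) k + zscale (int M - 1) k"
    have "y (t + k) = y' (t + k)"
    proof (rule determinesD_translate[OF subshift_inv[OF Y] coding[OF v] y])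
      fix z assume z: "z \<in> {u. pt u \<in> convex hull V \<and> u \<noteq> k}"
      then have "pt z \<in> dilate V 1" using finV by (simp add: convex_hull_eq_dilate)
      from dilate_add[OF kN[of "M - 1"] this] have "zscale (int M - 1) k + z \<in> ?W"
        using M by (simp add: pt_add pt_zscale of_nat_diff)
      moreover have "zscale (int M - 1) k + z \<noteq> zscale (int M) k"
        using z by (auto simp: zscale_simps)
      ultimately have "y (zscale (int N) k + (zscale (int M - 1) k + z)) = y' (zscale (int N) k + (zscale (int M - 1) k + z))"
        by (rule main)
      then show "y (t + z) = y' (t + z)" by (simp add: t_def add.assoc)
    qed
    moreover have "t + k = u" by (simp add: t_def x(2) True zscale_simps)
    ultimately show ?thesis by simp
  qed
qed

text \<open>By Cramer's rule the lines \<open>a + s (a - p)\<close> and \<open>b + t (b - r)\<close> meet at a point with rational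
coordinates, whose denominator divides the determinant. The sign of the determinant makes \<open>s\<close> and
\<open>t\<close> positive, and the defining properties of \<open>p\<close> and \<open>r\<close> place \<open>V\<close> in the cone at \<open>q\<close> spanned by
\<open>a\<close> and \<open>b\<close>.\<close>

lemma corner_exists:
  assumes p: "p \<in> V - {a, b}" "\<And>v. v \<in> V \<Longrightarrow> 0 \<le> cross (a - p) (v - a)"
    and r: "r \<in> V - {a, b}" "\<And>v. v \<in> V \<Longrightarrow> 0 \<le> cross (r - b) (v - b)"
    and div: "0 < cross (b - r) (a - p)"
  obtains q and n :: nat and kq where "height q < height a" "0 < n" "real n *\<^sub>R q = pt kq"
    "a \<in> closed_segment q p" "b \<in> closed_segment q r"
    "\<And>w. w \<in> V \<Longrightarrow> \<exists>\<alpha> \<beta>. 0 \<le> \<alpha> \<and> 0 \<le> \<beta> \<and> w - q = \<alpha> *\<^sub>R (a - q) + \<beta> *\<^sub>R (b - q)"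
proof -
  define A where "A = a - p"
  define E where "E = b - r"
  define \<Delta> where "\<Delta> = cross E A"
  define s where "s = cross E (b - a) / \<Delta>"
  define t where "t = cross A (b - a) / \<Delta>"
  define q where "q = a + s *\<^sub>R A"
  have \<Delta>: "0 < \<Delta>" using div by (simp add: \<Delta>_def A_def E_def)
  have hp: "1 \<le> height (p - a)" using height_vertex[of p] p by auto
  have hr: "1 \<le> height (r - b)" using height_vertex[of r] r by (auto simp: height_simps)
  have hA: "cross A (b - a) = height (p - a)" "height A = - height (p - a)"
    unfolding A_def height_def by (simp_all add: cross_def algebra_simps)
  have hE: "cross E (b - a) = height (r - b)" "height E = - height (r - b)"
    unfolding E_def height_def by (simp_all add: cross_def algebra_simps)
  have s: "0 < s" using \<Delta> hr by (simp add: s_def hE)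
  have t: "0 < t" using \<Delta> hp by (simp add: t_def hA)
  have qb: "q = b + t *\<^sub>R E"
  proof -
    have "\<Delta> *\<^sub>R (b - a) = cross E (b - a) *\<^sub>R A - cross A (b - a) *\<^sub>R E"
      by (simp add: \<Delta>_def cross_def prod_eq_iff algebra_simps)
    then have "(1 / \<Delta>) *\<^sub>R (\<Delta> *\<^sub>R (b - a)) = (1 / \<Delta>) *\<^sub>R (cross E (b - a) *\<^sub>R A - cross A (b - a) *\<^sub>R E)"
      by simp
    then have "b - a = s *\<^sub>R A - t *\<^sub>R E"
      using \<Delta> by (simp add: s_def t_def scaleR_right_diff_distrib)
    then show ?thesis by (simp add: q_def algebra_simps)
  qed
  have int: "\<exists>k. v = pt k" if "v \<in> V" for v using intV that by blast
  obtain ka kb kp kr where k: "a = pt ka" "b = pt kb" "p = pt kp" "r = pt kr"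
    using int[of a] int[of b] int[of p] int[of r] abV p(1) r(1) by auto
  have A: "A = pt (ka - kp)" and E: "E = pt (kb - kr)" by (simp_all add: A_def E_def k pt_diff)
  obtain i :: int where i: "\<Delta> = of_int i"
    using cross_pt_Ints[of "kb - kr" "ka - kp"] unfolding \<Delta>_def A E by (auto elim: Ints_cases)
  obtain j :: int where j: "cross E (b - a) = of_int j"
    using cross_pt_Ints[of "kb - kr" "kb - ka"] unfolding E k pt_diff[symmetric] by (auto elim: Ints_cases)
  show thesis
  proof (rule that[of q "nat i" "zscale i ka + zscale j (ka - kp)"])
    have "0 < s * height (p - a)" using s hp by simp
    then show "height q < height a" by (simp add: q_def height_simps(1,3) hA(2))
    show "0 < nat i" using \<Delta> i by simp
    have "real (nat i) = \<Delta>" using \<Delta> i by simp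
    then show "real (nat i) *\<^sub>R q = pt (zscale i ka + zscale j (ka - kp))"
      using \<Delta> by (simp add: q_def s_def i[symmetric] j[symmetric] k(1)[symmetric] A[symmetric] pt_add pt_zscale scaleR_right_distrib)
    have seg: "x \<in> closed_segment (x + c *\<^sub>R (x - y)) y" if "0 < c" for x y :: plane and c
    proof -
      define d where "d = c / (1 + c)"
      have "x = (1 - d) *\<^sub>R (x + c *\<^sub>R (x - y)) + d *\<^sub>R y"
      proof -
        have "(1 - d) *\<^sub>R (x + c *\<^sub>R (x - y)) + d *\<^sub>R y = x + ((1 - d) * c - d) *\<^sub>R (x - y)"
          by (simp add: algebra_simps)
        moreover have "(1 - d) * c - d = 0" using that by (simp add: d_def field_simps)
        ultimately show ?thesis by simp
      qed
      moreover have "0 \<le> d" "d \<le> 1" using that by (auto simp: d_def)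
      ultimately show ?thesis unfolding in_segment by blast
    qed
    show "a \<in> closed_segment q p" using seg[OF s, of a p] by (simp add: q_def A_def)
    show "b \<in> closed_segment q r" using seg[OF t, of b r] by (simp add: qb E_def)
    show "\<exists>\<alpha> \<beta>. 0 \<le> \<alpha> \<and> 0 \<le> \<beta> \<and> w - q = \<alpha> *\<^sub>R (a - q) + \<beta> *\<^sub>R (b - q)" if w: "w \<in> V" for w
    proof -
      define \<alpha> where "\<alpha> = cross (- E) (w - q) / (s * \<Delta>)"
      define \<beta> where "\<beta> = cross A (w - q) / (t * \<Delta>)"
      have "cross (- E) (w - q) = cross (r - b) (w - b)"
        unfolding qb E_def by (simp add: cross_def algebra_simps)
      then have "0 \<le> \<alpha>" using r(2)[OF w] s \<Delta> by (simp add: \<alpha>_def)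
      have "cross A (w - q) = cross (a - p) (w - a)"
        unfolding q_def A_def by (simp add: cross_def algebra_simps)
      then have "0 \<le> \<beta>" using p(2)[OF w] t \<Delta> by (simp add: \<beta>_def)
      have "\<Delta> *\<^sub>R (w - q) = cross E (w - q) *\<^sub>R A - cross A (w - q) *\<^sub>R E"
        by (simp add: \<Delta>_def cross_def prod_eq_iff algebra_simps)
      then have "(1 / \<Delta>) *\<^sub>R (\<Delta> *\<^sub>R (w - q)) = (1 / \<Delta>) *\<^sub>R (cross E (w - q) *\<^sub>R A - cross A (w - q) *\<^sub>R E)"
        by simp
      then have 1: "w - q = (cross E (w - q) / \<Delta>) *\<^sub>R A - (cross A (w - q) / \<Delta>) *\<^sub>R E"
        using \<Delta> by (simp add: scaleR_right_diff_distrib)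
      have aq: "a - q = (- s) *\<^sub>R A" by (simp add: q_def)
      have bq: "b - q = (- t) *\<^sub>R E" by (simp add: qb)
      have "\<alpha> *\<^sub>R (a - q) + \<beta> *\<^sub>R (b - q) = (cross E (w - q) / \<Delta>) *\<^sub>R A - (cross A (w - q) / \<Delta>) *\<^sub>R E"
        unfolding aq bq \<alpha>_def \<beta>_def using s t by (simp add: cross_simps(8))
      with 1 \<open>0 \<le> \<alpha>\<close> \<open>0 \<le> \<beta>\<close> show ?thesis by metis
    qed
  qed
qed

text \<open>The segment from \<open>w\<close> to \<open>q\<close> crosses the edge, so \<open>w - q\<close> is a multiple of the difference of \<open>w\<close> and
a point of the edge; the factor \<open>n\<close> makes the vector integral.\<close>

lemma corner_descent:
  assumes hq: "height q < height a" and n: "0 < n" "real n *\<^sub>R q = pt kq"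
    and cone: "\<And>w. w \<in> V \<Longrightarrow> \<exists>\<alpha> \<beta>. 0 \<le> \<alpha> \<and> 0 \<le> \<beta> \<and> w - q = \<alpha> *\<^sub>R (a - q) + \<beta> *\<^sub>R (b - q)"
    and w: "w \<in> V - {a, b}" and kw: "pt kw = w"
  shows "\<exists>\<alpha> \<beta>. 0 \<le> \<alpha> \<and> 0 \<le> \<beta> \<and> pt (zscale (int n) kw - kq) = (\<alpha> + \<beta>) *\<^sub>R w - \<alpha> *\<^sub>R a - \<beta> *\<^sub>R b"
proof -
  obtain \<alpha> \<beta> where ab: "0 \<le> \<alpha>" "0 \<le> \<beta>" "w - q = \<alpha> *\<^sub>R (a - q) + \<beta> *\<^sub>R (b - q)" using cone w by blast
  have "1 \<le> height (w - a)" using height_vertex[of w] w by auto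
  moreover have "height (w - q) = (\<alpha> + \<beta>) * (height a - height q)" unfolding ab(3) by (simp add: height_simps algebra_simps)
  ultimately have "0 < (\<alpha> + \<beta> - 1) * (height a - height q)" by (simp add: height_simps algebra_simps)
  then have \<kappa>: "0 < \<alpha> + \<beta> - 1" using hq by (simp add: zero_less_mult_iff)
  define c where "c = real n / (\<alpha> + \<beta> - 1)"
  have c: "0 \<le> c" using \<kappa> by (simp add: c_def)
  have "(\<alpha> + \<beta> - 1) *\<^sub>R (w - q) = (\<alpha> + \<beta>) *\<^sub>R w - \<alpha> *\<^sub>R a - \<beta> *\<^sub>R b"
  proof -
    have "(\<alpha> + \<beta> - 1) *\<^sub>R (w - q) = (\<alpha> + \<beta>) *\<^sub>R (w - q) - (w - q)" by (simp add: scaleR_left_diff_distrib)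
    also have "\<dots> = (\<alpha> + \<beta>) *\<^sub>R (w - q) - (\<alpha> *\<^sub>R (a - q) + \<beta> *\<^sub>R (b - q))" by (simp only: ab(3))
    finally show ?thesis by (simp add: algebra_simps)
  qed
  then have "c *\<^sub>R ((\<alpha> + \<beta> - 1) *\<^sub>R (w - q)) = c *\<^sub>R ((\<alpha> + \<beta>) *\<^sub>R w - \<alpha> *\<^sub>R a - \<beta> *\<^sub>R b)" by simp
  moreover have "c * (\<alpha> + \<beta> - 1) = real n" using \<kappa> by (simp add: c_def)
  ultimately have "real n *\<^sub>R (w - q) = c *\<^sub>R ((\<alpha> + \<beta>) *\<^sub>R w - \<alpha> *\<^sub>R a - \<beta> *\<^sub>R b)"
    by (simp only: scaleR_scaleR)
  then have "real n *\<^sub>R (w - q) = (c * \<alpha> + c * \<beta>) *\<^sub>R w - (c * \<alpha>) *\<^sub>R a - (c * \<beta>) *\<^sub>R b"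
    by (simp add: scaleR_right_diff_distrib distrib_left)
  moreover have "pt (zscale (int n) kw - kq) = real n *\<^sub>R (w - q)"
    by (simp add: pt_diff pt_zscale kw n(2)[symmetric] scaleR_right_diff_distrib)
  ultimately show ?thesis using ab c by (metis mult_nonneg_nonneg)
qed

text \<open>An edge of the enlarged polygon minimises a linear functional on it. If both of its ends are
multiples of vertices of \<open>P\<close>, the functional exposes an edge of \<open>P\<close> as well. If one end is the
multiple of \<open>q\<close>, then the other one is a vertex in the cone at \<open>q\<close>, which forces \<open>a\<close> or \<open>b\<close> to be a
second minimiser in \<open>P\<close>. It is not parallel to the edge from \<open>a\<close> to \<open>b\<close>, as \<open>q\<close> is lower.\<close>

lemma cut_polygon_edges:
  assumes hq: "height q < height a"
    and aq: "a \<in> convex hull (insert q (V - {a, b}))" and bq: "b \<in> convex hull (insert q (V - {a, b}))"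
    and cone: "\<And>w. w \<in> V \<Longrightarrow> \<exists>\<alpha> \<beta>. 0 \<le> \<alpha> \<and> 0 \<le> \<beta> \<and> w - q = \<alpha> *\<^sub>R (a - q) + \<beta> *\<^sub>R (b - q)"
    and N: "0 < N" and edge: "(u1, u2) \<in> oriented_edges (convex hull ((\<lambda>x. N *\<^sub>R x) ` insert q (V - {a, b})))"
  obtains c d t where "(c, d) \<in> oriented_edges (convex hull V)" "(c, d) \<noteq> (a, b)" "0 < t" "u2 - u1 = t *\<^sub>R (d - c)"
proof -
  let ?U = "insert q (V - {a, b})"
  let ?Q = "convex hull ((\<lambda>x. N *\<^sub>R x) ` ?U)"
  note E = oriented_edgeD[OF edge]
  have "vertices ?Q \<subseteq> (\<lambda>x. N *\<^sub>R x) ` ?U"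
    by (rule vertices_convex_hull)
  then obtain w1 w2 where w: "w1 \<in> ?U" "w2 \<in> ?U" "u1 = N *\<^sub>R w1" "u2 = N *\<^sub>R w2" using E(2,3) by blast
  have ne: "w1 \<noteq> w2" using E(1) w by auto
  define v where "v = w2 - w1"
  have v: "v \<noteq> 0" using ne by (simp add: v_def)
  define m where "m = cross v w1"
  have m2: "cross v w2 = m" by (simp add: m_def v_def cross_simps cross_commute[of w1 w2])
  have u21: "u2 - u1 = N *\<^sub>R v" by (simp add: w v_def scaleR_right_diff_distrib)
  have minU: "m \<le> cross v x" if "x \<in> ?U" for x
  proof -
    have "N *\<^sub>R x \<in> ?Q" using that by (intro hull_inc) blast
    from E(4)[OF this] have "0 \<le> cross (u2 - u1) (N *\<^sub>R x - u1)" .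
    also have "\<dots> = N * (N * (cross v x - m))"
      unfolding u21 by (simp add: w(3) cross_simps m_def right_diff_distrib)
    finally show ?thesis using N by (simp add: zero_le_mult_iff)
  qed
  have minV: "m \<le> cross v x" if "x \<in> V" for x
  proof (cases "x = a \<or> x = b")
    case True
    then have "x \<in> convex hull ?U" using aq bq by blast
    then show ?thesis using cross_ge_on_hull[OF minU] by blast
  next
    case False
    then show ?thesis using minU that by blast
  qed
  have corner: "\<exists>x\<in>{a, b}. cross v x = m" if w: "w \<in> V - {a, b}" "cross v w = m" "cross v q = m" for w
  proof -
    obtain \<alpha> \<beta> where ab: "0 \<le> \<alpha>" "0 \<le> \<beta>" "w - q = \<alpha> *\<^sub>R (a - q) + \<beta> *\<^sub>R (b - q)" using cone w by blast
    have "cross v (w - q) = \<alpha> * (cross v a - m) + \<beta> * (cross v b - m)"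
      unfolding ab(3) using w by (simp add: cross_simps)
    moreover have "cross v (w - q) = 0" using w by (simp add: cross_simps)
    moreover have "0 \<le> \<alpha> * (cross v a - m)" "0 \<le> \<beta> * (cross v b - m)" using ab minV abV by auto
    ultimately have z: "\<alpha> * (cross v a - m) = 0" "\<beta> * (cross v b - m) = 0" by linarith+
    have "\<not> (\<alpha> = 0 \<and> \<beta> = 0)"
    proof
      assume "\<alpha> = 0 \<and> \<beta> = 0"
      then have "w = q" using ab(3) by simp
      then show False using hq height_vertex_nonneg[of w] w by (simp add: height_simps)
    qed
    with z show ?thesis by auto
  qed
  have "\<exists>p1\<in>V. \<exists>p2\<in>V. p1 \<noteq> p2 \<and> cross v p1 = m \<and> cross v p2 = m"
  proof -
    consider "w1 \<in> V - {a, b}" "w2 \<in> V - {a, b}" | "w1 \<in> V - {a, b}" "w2 = q" | "w2 \<in> V - {a, b}" "w1 = q"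
      using w ne by blast
    then show ?thesis
    proof cases
      case 1
      then show ?thesis using ne m2 m_def[symmetric] by (intro bexI[of _ w1] bexI[of _ w2]) simp_all
    next
      case 2
      obtain x where "x \<in> {a, b}" "cross v x = m"
        using corner[OF 2(1) m_def[symmetric]] m2 unfolding 2(2) by blast
      with 2(1) abV(1,2) have "x \<in> V" "w1 \<in> V" "w1 \<noteq> x" by auto
      with \<open>cross v x = m\<close> show ?thesis by (intro bexI[of _ w1] bexI[of _ x]) (simp_all add: m_def)
    next
      case 3
      obtain x where "x \<in> {a, b}" "cross v x = m"
        using corner[OF 3(1) m2] m_def[symmetric] unfolding 3(2) by blast
      with 3(1) abV(1,2) have "x \<in> V" "w2 \<in> V" "w2 \<noteq> x" by auto
      with \<open>cross v x = m\<close> show ?thesis using m2 by (intro bexI[of _ w2] bexI[of _ x]) simp_all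
    qed
  qed
  then obtain p1 p2 where p: "p1 \<in> V" "p2 \<in> V" "p1 \<noteq> p2" "cross v p1 = m" "cross v p2 = m" by blast
  have cP: "convex (convex hull V)" "compact (convex hull V)" using finV by (simp_all add: finite_imp_compact_convex_hull)
  obtain c d t where cd: "(c, d) \<in> oriented_edges (convex hull V)" "t > 0" "d - c = t *\<^sub>R v" "cross v c = m"
    by (rule oriented_edge_exists[OF cP v _ hull_inc[OF p(1)] hull_inc[OF p(2)] p(3-5)])
       (use cross_ge_on_hull[OF minV] in \<open>blast intro: that\<close>)+
  have "(c, d) \<noteq> (a, b)"
  proof
    assume "(c, d) = (a, b)"
    then have "height x = t * cross v x" for x using cd(3) by (simp add: height_def cross_simps)
    moreover have "cross v a \<le> cross v q" using minU[of q] cd(4) \<open>(c, d) = (a, b)\<close> by simp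
    ultimately have "height a \<le> height q" using cd(2) by simp
    then show False using hq by simp
  qed
  moreover have "u2 - u1 = (N / t) *\<^sub>R (d - c)" unfolding u21 cd(3) using cd(2) by simp
  moreover have "0 < N / t" using N cd by simp
  ultimately show thesis using that cd(1) by blast
qed

text \<open>The new vertex is treated as follows. A site \<open>u\<close> of the window with sufficient height can be written as
\<open>(u - d) + d\<close> with \<open>u - d\<close> in the window and \<open>d\<close> a vector from the new vertex to another site of
\<open>Q\<close>, by \<open>high_points_can_descend\<close>; so the windows based at these sites cover the upper part of the
window at the new vertex, and this part determines the rest.\<close>

lemma cut_corner:
  assumes edge: "(a, b) \<in> oriented_edges (convex hull V)" and exp: "expansive_direction Y (b - a)"
    and p: "p \<in> V - {a, b}" "\<And>v. v \<in> V \<Longrightarrow> 0 \<le> cross (a - p) (v - a)"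
    and r: "r \<in> V - {a, b}" "\<And>v. v \<in> V \<Longrightarrow> 0 \<le> cross (r - b) (v - b)"
    and div: "0 < cross (b - r) (a - p)"
  obtains Q W where "finite W" "W \<noteq> {}" "convex_integer_polygon Q" "num_sides Q < num_sides (convex hull V)"
    "\<And>k. pt k extreme_point_of Q \<Longrightarrow> determines Y (\<Union>w\<in>W. (+) w ` {u. pt u \<in> Q \<and> u \<noteq> k}) ((+) k ` W)"
proof -
  obtain q and n :: nat and kq where hq: "height q < height a" and n: "0 < n" "real n *\<^sub>R q = pt kq"
    and aq: "a \<in> closed_segment q p" and bq: "b \<in> closed_segment q r"
    and cone: "\<And>w. w \<in> V \<Longrightarrow> \<exists>\<alpha> \<beta>. 0 \<le> \<alpha> \<and> 0 \<le> \<beta> \<and> w - q = \<alpha> *\<^sub>R (a - q) + \<beta> *\<^sub>R (b - q)"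
    by (rule corner_exists[OF p r div]) (assumption | rule that)+
  let ?U = "insert q (V - {a, b})"
  have hull_seg: "closed_segment q w \<subseteq> convex hull ?U" if "w \<in> V - {a, b}" for w
    by (rule closed_segment_subset) (use that in \<open>auto intro: hull_inc\<close>)
  have abU: "a \<in> convex hull ?U" "b \<in> convex hull ?U" using aq bq hull_seg p(1) r(1) by blast+
  have VU: "V \<subseteq> convex hull ?U"
  proof
    fix x assume "x \<in> V"
    then show "x \<in> convex hull ?U" using abU hull_inc[of x ?U] by (cases "x = a \<or> x = b") auto
  qed
  \<comment> \<open>a multiple of \<open>n\<close>, so that \<open>N q\<close> is integral, and at least \<open>card V\<close> for the remaining vertices\<close>
  define N where "N = n * card V"
  have cardV: "1 \<le> card V" using finV abV by (metis One_nat_def Suc_leI card_gt_0_iff empty_iff)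
  have N: "n \<le> N" "card V \<le> N" using n cardV by (simp_all add: N_def)
  then have N0: "0 < real N" using n by simp
  define Q where "Q = convex hull ((\<lambda>x. real N *\<^sub>R x) ` ?U)"
  have Q_eq: "Q = (\<lambda>x. real N *\<^sub>R x) ` (convex hull ?U)" unfolding Q_def by (rule convex_hull_scaling)
  have dilQ: "dilate V (real N) \<subseteq> Q"
  proof
    fix x assume "x \<in> dilate V (real N)"
    from dilate_mult[OF this, of "1 / real N"] have "(1 / real N) *\<^sub>R x \<in> convex hull V"
      using N0 finV by (simp add: convex_hull_eq_dilate)
    also have "convex hull V \<subseteq> convex hull ?U" using VU by (simp add: hull_minimal)
    finally have "real N *\<^sub>R ((1 / real N) *\<^sub>R x) \<in> Q" unfolding Q_eq by blast
    then show "x \<in> Q" using N0 by simp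
  qed
  have descent: "\<exists>\<alpha> \<beta>. 0 \<le> \<alpha> \<and> 0 \<le> \<beta> \<and> pt (zscale (int n) (inv pt w) - kq) = (\<alpha> + \<beta>) *\<^sub>R w - \<alpha> *\<^sub>R a - \<beta> *\<^sub>R b"
    if "w \<in> V - {a, b}" for w
    by (rule corner_descent[OF hq n cone that]) (use that intV in \<open>auto intro!: f_inv_into_f\<close>)
  obtain D where D: "0 \<le> D" "\<And>M u. pt u \<in> dilate V M \<Longrightarrow> M * height a + D \<le> height (pt u) \<Longrightarrow>
      \<exists>w\<in>V - {a, b}. pt (u - (zscale (int n) (inv pt w) - kq)) \<in> dilate V M"
    by (rule high_points_can_descend[of "\<lambda>w. zscale (int n) (inv pt w) - kq", OF descent]) (assumption | rule that)+
  obtain K where K: "finite K" "\<And>k. k \<in> K \<Longrightarrow> 0 < height (pt k)" "determines Y K {0}"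
    by (rule finite_code_above[OF exp]) (rule that; assumption)
  obtain M0 where M0: "\<And>M. M0 \<le> M \<Longrightarrow>
    determines Y {u. pt u \<in> dilate V M \<and> M * height a + D \<le> height (pt u)} {u. pt u \<in> dilate V M}"
    by (rule upper_part_determines_dilate[OF K, of p D]) (use p D in \<open>auto intro: that\<close>)
  define M where "M = nat \<lceil>M0\<rceil> + 1"
  have "M0 \<le> real M" using real_nat_ceiling_ge[of M0] by (simp add: M_def)
  define W where "W = {u. pt u \<in> dilate V (real M)}"
  have WQ: "determines Y (\<Union>w\<in>W. (+) w ` {u. pt u \<in> Q \<and> u \<noteq> k}) ((+) k ` W)"
    if k: "pt k extreme_point_of Q" for k
  proof -
    have "pt k \<in> (\<lambda>x. real N *\<^sub>R x) ` ?U" using k unfolding Q_def by (rule extreme_point_of_convex_hull)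
    then obtain x where x: "x \<in> ?U" "pt k = real N *\<^sub>R x" by blast
    show ?thesis
    proof (cases "x = q")
      case False
      then have "x \<in> V" using x by blast
      then obtain kx where kx: "x = pt kx" using intV by blast
      have kk: "k = zscale (int N) kx" using x(2) by (simp add: kx pt_zscale flip: pt_inject)
      have "pt kx \<in> V" using \<open>x \<in> V\<close> kx by simp
      note old = remaining_vertex_coded[OF this N(2), of M]
      show ?thesis unfolding kk W_def
        by (rule determines_mono[OF old]) (use dilQ in \<open>auto simp: M_def\<close>)
    next
      case True
      define T where "T = {u. pt u \<in> dilate V (real M) \<and> real M * height a + D \<le> height (pt u)}"
      have "determines Y T W" unfolding T_def W_def by (rule M0[OF \<open>M0 \<le> real M\<close>])
      then have det: "determines Y ((+) k ` T) ((+) k ` W)" by (rule determines_translate[OF subshift_inv[OF Y]])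
      show ?thesis
      proof (rule determines_mono[OF det _ order_refl], rule subsetI)
        fix z assume "z \<in> (+) k ` T"
        then obtain u where u: "u \<in> T" "z = k + u" by blast
        then obtain w where w: "w \<in> V - {a, b}" "pt (u - (zscale (int n) (inv pt w) - kq)) \<in> dilate V (real M)"
          using D(2)[of u "real M"] by (auto simp: T_def)
        define d where "d = zscale (int n) (inv pt w) - kq"
        have "pt (inv pt w) = w" using w intV by (auto intro!: f_inv_into_f)
        then have d: "pt d = real n *\<^sub>R (w - q)"
          by (simp add: d_def pt_diff pt_zscale n(2)[symmetric] scaleR_right_diff_distrib)
        have "u - d \<in> W" using w(2) by (simp add: W_def d_def)
        moreover have "pt (k + d) \<in> Q"
        proof -
          define c where "c = real n / real N"
          have c: "0 \<le> c" "c \<le> 1" "real N * c = real n" using N n by (auto simp: c_def divide_le_eq)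
          have "(1 - c) *\<^sub>R q + c *\<^sub>R w \<in> closed_segment q w" unfolding in_segment using c by blast
          then have "(1 - c) *\<^sub>R q + c *\<^sub>R w \<in> convex hull ?U" using hull_seg[OF w(1)] by blast
          then have "real N *\<^sub>R ((1 - c) *\<^sub>R q + c *\<^sub>R w) \<in> Q" unfolding Q_eq by blast
          moreover have "real N *\<^sub>R ((1 - c) *\<^sub>R q + c *\<^sub>R w) = real N *\<^sub>R q + (real N * c) *\<^sub>R (w - q)"
            by (simp add: algebra_simps)
          ultimately show ?thesis using x(2) True d c(3) by (simp add: pt_add)
        qed
        moreover have "k + d \<noteq> k"
        proof
          assume "k + d = k"
          then have "pt d = 0" by (simp add: pt_zero)
          then have "w = q" using d n(1) by simp
          then show False using hq height_vertex_nonneg[of w] w(1) by (simp add: height_simps)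
        qed
        moreover have "z = (u - d) + (k + d)" by (simp add: u(2))
        ultimately show "z \<in> (\<Union>w\<in>W. (+) w ` {u. pt u \<in> Q \<and> u \<noteq> k})" by blast
      qed
    qed
  qed
  have "finite W" unfolding W_def by (rule finite_lattice_points[OF bounded_dilate[OF finV]])
  obtain ka where ka: "a = pt ka" using abV intV by blast
  have "zscale (int M) ka \<in> W"
    using dilate_mult[OF dilate_vertex[OF finV abV(1)], of "real M"] by (simp add: W_def pt_zscale ka)
  then have "W \<noteq> {}" by blast
  have Qpoly: "convex_integer_polygon Q"
    unfolding convex_integer_polygon_def
  proof (intro conjI allI impI)
    show "polytope Q" unfolding Q_def polytope_def by (rule exI[of _ "(\<lambda>x. real N *\<^sub>R x) ` ?U"]) (use finV in simp)
    have NQ: "real N *\<^sub>R v \<in> Q" if "v \<in> V" for v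
      using dilQ dilate_mult[OF dilate_vertex[OF finV that], of "real N"] by auto
    have "aff_dim {real N *\<^sub>R a, real N *\<^sub>R b} \<le> aff_dim Q" by (rule aff_dim_subset) (use NQ abV in auto)
    then show "1 \<le> aff_dim Q" using abV(3) N0 by (simp add: aff_dim_2)
    fix v assume "v extreme_point_of Q"
    then have "v \<in> (\<lambda>x. real N *\<^sub>R x) ` ?U" unfolding Q_def by (rule extreme_point_of_convex_hull)
    then obtain x where x: "x \<in> ?U" "v = real N *\<^sub>R x" by blast
    show "v \<in> range pt"
    proof (cases "x = q")
      case True
      have "v = real (card V) *\<^sub>R (real n *\<^sub>R q)" by (simp add: x(2) True N_def)
      also have "\<dots> = pt (zscale (int (card V)) kq)" by (simp add: n(2) pt_zscale)
      finally show ?thesis by blast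
    next
      case False
      then obtain kx where "x = pt kx" using x intV by blast
      then have "v = pt (zscale (int N) kx)" using x by (simp add: pt_zscale)
      then show ?thesis by blast
    qed
  qed
  have finP: "finite (oriented_edges (convex hull V))"
  proof (rule finite_oriented_edges, rule finite_subset[OF _ finV])
    show "vertices (convex hull V) \<subseteq> V" by (rule vertices_convex_hull)
  qed
  \<comment> \<open>edges of \<open>Q\<close> are matched with parallel edges of \<open>P\<close> other than the removed one\<close>
  have "card (oriented_edges Q) \<le> card (oriented_edges (convex hull V) - {(a, b)})"
  proof (rule card_le_if_inj_on_rel[where r = "\<lambda>e f. \<exists>t>0. snd e - fst e = t *\<^sub>R (snd f - fst f)"])
    show "finite (oriented_edges (convex hull V) - {(a, b)})" using finP by simp
    fix e assume "e \<in> oriented_edges Q"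
    then have "(fst e, snd e) \<in> oriented_edges (convex hull ((\<lambda>x. real N *\<^sub>R x) ` ?U))" by (simp add: Q_def)
    from cut_polygon_edges[OF hq abU cone N0 this]
    obtain c d t where "(c, d) \<in> oriented_edges (convex hull V)" "(c, d) \<noteq> (a, b)" "0 < t" "snd e - fst e = t *\<^sub>R (d - c)"
      by metis
    then show "\<exists>f. f \<in> oriented_edges (convex hull V) - {(a, b)} \<and> (\<exists>t>0. snd e - fst e = t *\<^sub>R (snd f - fst f))"
      by (intro exI[of _ "(c, d)"]) auto
  next
    fix e e' f assume e: "e \<in> oriented_edges Q" "e' \<in> oriented_edges Q"
      and "\<exists>t>0. snd e - fst e = t *\<^sub>R (snd f - fst f)" "\<exists>t>0. snd e' - fst e' = t *\<^sub>R (snd f - fst f)"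
    then obtain t t' where t: "0 < t" "snd e - fst e = t *\<^sub>R (snd f - fst f)"
        "0 < t'" "snd e' - fst e' = t' *\<^sub>R (snd f - fst f)" by blast
    have "snd e' - fst e' = (t' / t) *\<^sub>R (snd e - fst e)" using t by simp
    moreover have "0 < t' / t" using t by simp
    ultimately have "fst e' = fst e \<and> snd e' = snd e"
      using oriented_edges_parallel_unique[of "fst e" "snd e" Q "fst e'" "snd e'"] e by simp
    then show "e = e'" by (simp add: prod_eq_iff)
  qed
  also have "\<dots> < card (oriented_edges (convex hull V))" by (rule card_Diff1_less[OF finP edge])
  finally have "num_sides Q < num_sides (convex hull V)" by (simp add: num_sides_def)
  with \<open>finite W\<close> \<open>W \<noteq> {}\<close> Qpoly WQ show thesis by (intro that[of W Q])
qed

end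

section \<open>Edges of minimal coding polygons\<close>

text \<open>The recoding of \<open>X\<close> with window \<open>F + W\<close> is the block recoding of \<open>Y\<close> with window \<open>W\<close>, taken directly
from \<open>X\<close> so that its alphabet consists of natural numbers.\<close>

lemma recoding_with_window:
  assumes X: "subshift A X" and inf: "infinite X" and rec: "recoding A X B Y" and W: "finite W" "W \<noteq> {}"
    and Q: "convex_integer_polygon Q"
    and det: "\<And>k. pt k extreme_point_of Q \<Longrightarrow> determines Y (\<Union>w\<in>W. (+) w ` {u. pt u \<in> Q \<and> u \<noteq> k}) ((+) k ` W)"
  obtains C :: "nat set" and Z where "recoding A X C Z" "coding_polygon Z Q"
proof -
  obtain F \<Psi> where F: "finite F" "F \<noteq> {}" and bij: "bij_betw \<Psi> X Y" and Y: "subshift B Y"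
    and iff: "\<And>u x x'. x \<in> X \<Longrightarrow> x' \<in> X \<Longrightarrow> \<Psi> x u = \<Psi> x' u \<longleftrightarrow> (\<forall>f\<in>F. x (f + u) = x' (f + u))"
    by (rule recoding_data[OF X rec inf]) (rule that; assumption)
  have im: "\<Psi> ` X = Y" using bij by (simp add: bij_betw_def)
  define G where "G = (\<Union>f\<in>F. (+) f ` W)"
  have G: "finite G" "G \<noteq> {}" using F W by (auto simp: G_def)
  obtain C :: "nat set" and Z \<Theta> where Z: "recoding A X C Z" "Z = \<Theta> ` X"
    and iffZ: "\<And>x x' u. x \<in> X \<Longrightarrow> x' \<in> X \<Longrightarrow> \<Theta> x u = \<Theta> x' u \<longleftrightarrow> (\<forall>g\<in>G. x (g + u) = x' (g + u))"
    by (rule block_recoding[OF X G]) (rule that; assumption)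
  have GS: "(\<Union>g\<in>G. (+) g ` S) = (\<Union>f\<in>F. (+) f ` (\<Union>w\<in>W. (+) w ` S))" for S
  proof (rule set_eqI)
    fix x
    have "x \<in> (\<Union>g\<in>G. (+) g ` S) \<longleftrightarrow> (\<exists>f\<in>F. \<exists>w\<in>W. \<exists>s\<in>S. x = f + w + s)"
      unfolding G_def by blast
    moreover have "x \<in> (\<Union>f\<in>F. (+) f ` (\<Union>w\<in>W. (+) w ` S)) \<longleftrightarrow> (\<exists>f\<in>F. \<exists>w\<in>W. \<exists>s\<in>S. x = f + (w + s))"
      by blast
    ultimately show "x \<in> (\<Union>g\<in>G. (+) g ` S) \<longleftrightarrow> x \<in> (\<Union>f\<in>F. (+) f ` (\<Union>w\<in>W. (+) w ` S))"
      by (simp only: add.assoc)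
  qed
  have detZ: "determines Z S T \<longleftrightarrow> determines Y (\<Union>w\<in>W. (+) w ` S) (\<Union>w\<in>W. (+) w ` T)" for S T
    using recoding_determines[OF iffZ Z(2)[symmetric], of S T]
      recoding_determines[OF iff im, of "\<Union>w\<in>W. (+) w ` S" "\<Union>w\<in>W. (+) w ` T"]
    by (simp only: GS)
  have "coding_polygon Z Q"
    unfolding coding_polygon_def
  proof (intro conjI allI impI Q)
    fix v assume v: "v extreme_point_of Q"
    then obtain k where k: "v = pt k" using Q unfolding convex_integer_polygon_def by blast
    have 1: "pt -` (Q - {v}) = {u. pt u \<in> Q \<and> u \<noteq> k}" "pt -` {v} = {k}" by (auto simp: k pt_inject)
    have "(\<Union>w\<in>W. (+) w ` {k}) = (+) k ` W" by (auto simp: add.commute)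
    then show "codes Z (Q - {v}) {v}"
      unfolding codes_iff_determines 1 detZ using det[of k] v k by simp
  qed
  with Z(1) show thesis by (rule that)
qed

lemma polygon_edge_of_coding_polygon:
  assumes Y: "subshift B Y" and P: "coding_polygon Y P" and e: "(a, b) \<in> oriented_edges P"
  shows "polygon_edge (vertices P) a b B Y"
proof
  have cP: "convex_integer_polygon P" using P by (simp add: coding_polygon_def)
  note PV = polygon_vertices[OF cP] and E = oriented_edgeD[OF e]
  show "finite (vertices P)" "vertices P \<subseteq> range pt" using PV by blast+
  show "a \<in> vertices P" "b \<in> vertices P" "a \<noteq> b" "subshift B Y" using E Y by blast+
  show "determines Y {u. pt u \<in> convex hull vertices P \<and> u \<noteq> k} {k}" if "pt k \<in> vertices P" for k
    using coding_vertex[OF P that] unfolding PV(2)[symmetric] .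
  fix v assume v: "v \<in> vertices P" "v \<noteq> a" "v \<noteq> b"
  have vP: "v \<in> P" "a \<in> P" "b \<in> P" using PV(6) v E by blast+
  have "cross (b - a) (v - a) \<noteq> 0"
  proof
    assume "cross (b - a) (v - a) = 0"
    then have "v \<in> closed_segment a b" using E(5) vP by blast
    then have "v \<in> open_segment a b" using v by (simp add: open_segment_def)
    then show False using v(1) vP by (simp add: vertices_def extreme_point_of_def)
  qed
  then show "0 < cross (b - a) (v - a)" using E(4)[OF vP(1)] by simp
qed

lemma minimal_edge_nonexpansive:
  assumes X: "subshift A X" and inf: "infinite X" and min: "minimal_coding_polygon A X B Y P"
    and e: "(a, b) \<in> oriented_edges P"
  shows "\<not> expansive_direction Y (b - a)"
proof
  assume exp: "expansive_direction Y (b - a)"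
  have rec: "recoding A X B Y" and P: "coding_polygon Y P"
    and least: "\<And>(C :: nat set) Z Q. recoding A X C Z \<Longrightarrow> coding_polygon Z Q \<Longrightarrow> num_sides P \<le> num_sides Q"
    using min unfolding minimal_coding_polygon_def by blast+
  have Y: "subshift B Y" using rec by (simp add: recoding_def)
  have infY: "infinite Y"
    using recoding_data[OF X rec inf] inf bij_betw_finite by metis
  interpret polygon_edge "vertices P" a b B Y by (rule polygon_edge_of_coding_polygon[OF Y P e])
  have cP: "convex_integer_polygon P" using P by (simp add: coding_polygon_def)
  have PV: "convex hull (vertices P) = P" using polygon_vertices(2)[OF cP] by (rule sym)
  have edge: "(a, b) \<in> oriented_edges (convex hull (vertices P))" unfolding PV by (rule e)
  show False
  proof (cases "vertices P = {a, b}")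
    case True
    then show False using finite_of_segment exp infY by blast
  next
    case False
    obtain p r where p: "p \<in> vertices P - {a, b}" "\<And>v. v \<in> vertices P \<Longrightarrow> 0 \<le> cross (a - p) (v - a)"
      and r: "r \<in> vertices P - {a, b}" "\<And>v. v \<in> vertices P \<Longrightarrow> 0 \<le> cross (r - b) (v - b)"
      by (rule neighbours[OF False]) (rule that; assumption)
    show False
    proof (cases "0 < cross (b - r) (a - p)")
      case True
      obtain Q W where W: "finite W" "W \<noteq> {}" and Q: "convex_integer_polygon Q"
        and sides: "num_sides Q < num_sides (convex hull (vertices P))"
        and det: "\<And>k. pt k extreme_point_of Q \<Longrightarrow> determines Y (\<Union>w\<in>W. (+) w ` {u. pt u \<in> Q \<and> u \<noteq> k}) ((+) k ` W)"
        by (rule cut_corner[OF edge exp p r True]) (assumption | rule that)+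
      obtain C :: "nat set" and Z where "recoding A X C Z" "coding_polygon Z Q"
        by (rule recoding_with_window[OF X inf rec W Q det])
      then have "num_sides P \<le> num_sides Q" by (rule least)
      then show False using sides unfolding PV by simp
    next
      case False
      then have conv: "0 \<le> cross (a - p) (b - r)" using cross_commute[of "a - p" "b - r"] by simp
      obtain d where d: "d \<noteq> 0" "has_period Y d"
        by (rule period_of_converging_neighbours[OF exp p r conv])
      define Q where "Q = closed_segment 0 (pt d)"
      have d0: "pt d \<noteq> 0" using d(1) pt_inject[of d 0] by (simp add: pt_zero)
      have ext: "v extreme_point_of Q \<longleftrightarrow> v = pt 0 \<or> v = pt d" for v
        unfolding Q_def extreme_point_of_segment pt_zero ..
      have Qp: "convex_integer_polygon Q"
        unfolding convex_integer_polygon_def ext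
      proof (intro conjI allI impI)
        show "polytope Q" unfolding Q_def segment_convex_hull polytope_def by (rule exI[of _ "{0, pt d}"]) simp
        show "1 \<le> aff_dim Q" unfolding Q_def segment_convex_hull aff_dim_convex_hull using d0 by (simp add: aff_dim_2)
      qed blast
      have inQ: "pt 0 \<in> Q" "pt d \<in> Q" by (simp_all add: Q_def pt_zero)
      have det: "determines Y (\<Union>w\<in>{0}. (+) w ` {u. pt u \<in> Q \<and> u \<noteq> k}) ((+) k ` {0})"
        if "pt k extreme_point_of Q" for k
      proof (rule determinesI)
        fix y y' u assume y: "y \<in> Y" "y' \<in> Y" and u: "u \<in> (+) k ` {0}"
          and eq: "\<And>s. s \<in> (\<Union>w\<in>{0}. (+) w ` {u. pt u \<in> Q \<and> u \<noteq> k}) \<Longrightarrow> y s = y' s"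
        have per: "y (0 + d) = y 0" "y' (0 + d) = y' 0" using d(2) y unfolding has_period_def by blast+
        have "y s = y' s" if "pt s \<in> Q" "s \<noteq> k" for s by (rule eq) (use that in auto)
        moreover have "k = 0 \<or> k = d" using that unfolding ext pt_inject .
        ultimately have "y k = y' k" using inQ d(1) per by (metis add_0)
        then show "y u = y' u" using u by simp
      qed
      obtain C :: "nat set" and Z where "recoding A X C Z" "coding_polygon Z Q"
        by (rule recoding_with_window[OF X inf rec _ _ Qp det]) auto
      then have "num_sides P \<le> num_sides Q" by (rule least)
      moreover have "num_sides Q \<le> 2" unfolding Q_def by (rule num_sides_segment)
      moreover have "3 \<le> num_sides P" using three_sides[OF edge p r] unfolding PV .
      ultimately show False by simp
    qed
  qed
qed

lemma ray_translate: "(+) t ` ray 0 v = ray t v"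
proof (intro equalityI subsetI)
  fix x assume "x \<in> ray t v"
  then obtain s where "0 \<le> s" "x = t + (0 + s *\<^sub>R v)" by (auto simp: ray_def)
  then show "x \<in> (+) t ` ray 0 v" unfolding ray_def by blast
qed (auto simp: ray_def)

lemma ray_scale:
  assumes "0 < c" shows "ray p (c *\<^sub>R v) = ray p v"
proof (intro equalityI subsetI)
  fix x assume "x \<in> ray p v"
  then obtain t where t: "0 \<le> t" "x = p + t *\<^sub>R v" by (auto simp: ray_def)
  then show "x \<in> ray p (c *\<^sub>R v)" unfolding ray_def using assms
    by (intro CollectI exI[of _ "t / c"]) simp
next
  fix x assume "x \<in> ray p (c *\<^sub>R v)"
  then obtain t where t: "0 \<le> t" "x = p + t *\<^sub>R (c *\<^sub>R v)" by (auto simp: ray_def)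
  then show "x \<in> ray p v" unfolding ray_def using assms
    by (intro CollectI exI[of _ "t * c"]) simp
qed

theorem theorem5p13:
  fixes A :: "'a set" and X :: "'a config set"
    and B :: "'b set" and Y :: "'b config set"
    and P :: "plane set"
  assumes "subshift A X" and "infinite X" and "polygonal X"
    and "minimal_coding_polygon A X B Y P"
  shows "(\<forall>(a, b) \<in> oriented_edges P. closing_ray X (ray 0 (b - a))) \<and>
    (\<forall>l. nonexpansive_ray X l \<longleftrightarrow>
      (\<exists>(a, b) \<in> oriented_edges P. \<exists>t. l = (+) t ` ray 0 (b - a)))"
proof -
  note X = assms(1) and inf = assms(2) and min = assms(4)
  have rec: "recoding A X B Y" and P: "coding_polygon Y P"
    using min unfolding minimal_coding_polygon_def by blast+
  have Y: "subshift B Y" using rec by (simp add: recoding_def)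
  have edge: "b - a \<noteq> 0" "\<not> expansive_direction X (b - a)" if e: "(a, b) \<in> oriented_edges P" for a b
  proof -
    show ne: "b - a \<noteq> 0" using oriented_edgeD(1)[OF e] by simp
    show "\<not> expansive_direction X (b - a)"
      using minimal_edge_nonexpansive[OF X inf min e] expansive_direction_recoding[OF X inf rec ne] by blast
  qed
  have closing: "closing_ray X (ray 0 (b - a))" if "(a, b) \<in> oriented_edges P" for a b
    by (rule edge_ray_closing[OF X inf rec P that edge(2)[OF that]])
  have "nonexpansive_ray X l \<longleftrightarrow> (\<exists>(a, b) \<in> oriented_edges P. \<exists>t. l = (+) t ` ray 0 (b - a))" for l
  proof
    assume "nonexpansive_ray X l"
    then obtain p v where v: "v \<noteq> 0" "l = ray p v" "\<not> expansive X (left_half_plane p v)"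
      by (auto simp: nonexpansive_ray_def)
    then have "\<not> expansive_direction Y v"
      using expansive_left_half_plane[OF subshift_inv[OF X] v(1)] expansive_direction_recoding[OF X inf rec v(1)] by blast
    then obtain a b c where abc: "(a, b) \<in> oriented_edges P" "c > 0" "b - a = c *\<^sub>R v"
      using expansive_direction_no_edge[OF Y P v(1)] by blast
    have "l = (+) p ` ray 0 (b - a)" unfolding ray_translate abc(3) ray_scale[OF abc(2)] by (rule v(2))
    then show "\<exists>(a, b) \<in> oriented_edges P. \<exists>t. l = (+) t ` ray 0 (b - a)" using abc(1) by blast
  next
    assume "\<exists>(a, b) \<in> oriented_edges P. \<exists>t. l = (+) t ` ray 0 (b - a)"
    then obtain a b t where abt: "(a, b) \<in> oriented_edges P" "l = ray t (b - a)" by (auto simp: ray_translate)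
    then show "nonexpansive_ray X l"
      unfolding nonexpansive_ray_def
      using edge[OF abt(1)] expansive_left_half_plane[OF subshift_inv[OF X] edge(1)[OF abt(1)]] by blast
  qed
  with closing show ?thesis by blast
qed

end
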